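(* Let $\{G_i\}_{i\in\mathbb{N}}$ (with $\mathbb{N}=\{1,2,3,\dots\}$) be a fixed collection of non-trivial cyclic groups (each finite or infinite). Let $p$ be a constant, independent of $n$, satisfying $1-\frac{1}{\sqrt{2}}<p<1$. For a random graph $\Gamma\in G(n,p)$ on the vertex set $\{1,\dots,n\}$, let $\mathcal{G}_\Gamma=\mathcal{G}(\Gamma,\{G_i\})$ be the associated graph product, in which the vertex $i$ carries the group $G_i$. Then $\mathcal{G}_\Gamma$ has a finite outer automorphism group $\mathrm{Out}(\mathcal{G}_\Gamma)$, asymptotically almost surely.
   Context: Graph product: for a finite simplicial graph $\Gamma$ with vertex set $V$ and non-trivial finitely generated groups $\{G_v\}_{v\in V}$, the graph product $\mathcal{G}(\Gamma,\{G_v\})$ is the quotient of the free product of the groups $G_v$ ($v\in V$) by the relations that every element of $G_v$ commutes with every element of $G_w$ whenever $v,w$ are connected by an edge of $\Gamma$. Random graph model (Erdős–Rényi): $G(n,p)$ is the probability space of all graphs on the vertex set $\{1,\dots,n\}$, each edge of the complete graph being included independently with probability $p$; thus $\mathrm{Prob}(\Gamma)=p^{E_\Gamma}(1-p)^{\binom n2-E_\Gamma}$, where $E_\Gamma$ is the number of edges of $\Gamma$. A statement about $\Gamma\in G(n,p)$ holds asymptotically almost surely if the probability that it holds tends to $1$ as $n\to\infty$. *)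

theory Defs
  imports "HOL-Algebra.Algebra" "HOL-Probability.Probability"
begin

section \<open>Free products and graph products of groups\<close>

text \<open>The free product is the set of words in the letters \<open>(v, a)\<close>, \<open>a\<close> in the carrier of \<open>G v\<close>,
  modulo the congruence that deletes identity letters and multiplies adjacent letters from the
  same factor; the first component keeps the factors disjoint.\<close>

definition fp_words :: "'v set \<Rightarrow> ('v \<Rightarrow> 'a monoid) \<Rightarrow> ('v \<times> 'a) list set" where
  "fp_words V G = lists (SIGMA v:V. carrier (G v))"

inductive fp_step :: "'v set \<Rightarrow> ('v \<Rightarrow> 'a monoid) \<Rightarrow> ('v \<times> 'a) list \<Rightarrow> ('v \<times> 'a) list \<Rightarrow> bool"
  for V G where
  fp_step_one: "\<lbrakk>us \<in> fp_words V G; ws \<in> fp_words V G; v \<in> V\<rbrakk>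
    \<Longrightarrow> fp_step V G (us @ (v, \<one>\<^bsub>G v\<^esub>) # ws) (us @ ws)"
| fp_step_mult: "\<lbrakk>us \<in> fp_words V G; ws \<in> fp_words V G; v \<in> V;
     a \<in> carrier (G v); b \<in> carrier (G v)\<rbrakk>
    \<Longrightarrow> fp_step V G (us @ (v, a) # (v, b) # ws) (us @ (v, a \<otimes>\<^bsub>G v\<^esub> b) # ws)"

definition fp_rel :: "'v set \<Rightarrow> ('v \<Rightarrow> 'a monoid) \<Rightarrow> (('v \<times> 'a) list \<times> ('v \<times> 'a) list) set" where
  "fp_rel V G = {(x, y). x \<in> fp_words V G \<and> y \<in> fp_words V G \<and> equivclp (fp_step V G) x y}"

text \<open>Multiplication is concatenation of representatives; all products of representatives of two
  classes lie in one class, so the union below is that class.\<close>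

definition free_product :: "'v set \<Rightarrow> ('v \<Rightarrow> 'a monoid) \<Rightarrow> ('v \<times> 'a) list set monoid" where
  "free_product V G =
    \<lparr>carrier = fp_words V G // fp_rel V G,
     monoid.mult = (\<lambda>A B. \<Union>x\<in>A. \<Union>y\<in>B. fp_rel V G `` {x @ y}),
     one = fp_rel V G `` {[]}\<rparr>"

definition fp_inj :: "'v set \<Rightarrow> ('v \<Rightarrow> 'a monoid) \<Rightarrow> 'v \<Rightarrow> 'a \<Rightarrow> ('v \<times> 'a) list set" where
  "fp_inj V G v a = fp_rel V G `` {[(v, a)]}"

definition normal_closure :: "('a, 'b) monoid_scheme \<Rightarrow> 'a set \<Rightarrow> 'a set" where
  "normal_closure H S = \<Inter>{N. N \<lhd> H \<and> S \<subseteq> N}"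

definition commutator :: "('a, 'b) monoid_scheme \<Rightarrow> 'a \<Rightarrow> 'a \<Rightarrow> 'a" where
  "commutator H x y = x \<otimes>\<^bsub>H\<^esub> y \<otimes>\<^bsub>H\<^esub> inv\<^bsub>H\<^esub> x \<otimes>\<^bsub>H\<^esub> inv\<^bsub>H\<^esub> y"

text \<open>A finite simplicial graph is given by its vertex set \<open>V\<close> and a set \<open>E\<close> of two-element
  subsets of \<open>V\<close>.\<close>

definition graph_product ::
    "'v set \<Rightarrow> 'v set set \<Rightarrow> ('v \<Rightarrow> 'a monoid) \<Rightarrow> ('v \<times> 'a) list set set monoid" where
  "graph_product V E G =
    free_product V G Mod
      normal_closure (free_product V G)
        {commutator (free_product V G) (fp_inj V G v a) (fp_inj V G w b) | v w a b.
           v \<in> V \<and> w \<in> V \<and> {v, w} \<in> E \<and> a \<in> carrier (G v) \<and> b \<in> carrier (G w)}"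


section \<open>Outer automorphism groups\<close>

definition Inn :: "('a, 'b) monoid_scheme \<Rightarrow> ('a \<Rightarrow> 'a) set" where
  "Inn H = {(\<lambda>x\<in>carrier H. g \<otimes>\<^bsub>H\<^esub> x \<otimes>\<^bsub>H\<^esub> inv\<^bsub>H\<^esub> g) | g. g \<in> carrier H}"

definition Out :: "('a, 'b) monoid_scheme \<Rightarrow> ('a \<Rightarrow> 'a) set monoid" where
  "Out H = AutoGroup H Mod Inn H"


section \<open>Random graphs\<close>

definition complete_edges :: "nat \<Rightarrow> nat set set" where
  "complete_edges n = {e. e \<subseteq> {1..n} \<and> card e = 2}"

text \<open>The vertex set \<open>{1..n}\<close> being fixed, a graph is identified with its edge set.\<close>

definition random_graph :: "nat \<Rightarrow> real \<Rightarrow> nat set set pmf" where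
  "random_graph n p =
    map_pmf (\<lambda>f. {e \<in> complete_edges n. f e})
      (Pi_pmf (complete_edges n) False (\<lambda>_. bernoulli_pmf p))"

definition asymptotically_almost_surely :: "(nat \<Rightarrow> 'g pmf) \<Rightarrow> (nat \<Rightarrow> 'g \<Rightarrow> bool) \<Rightarrow> bool" where
  "asymptotically_almost_surely M P \<longleftrightarrow>
    (\<lambda>n. measure_pmf.prob (M n) {x. P n x}) \<longlonglongrightarrow> 1"


section \<open>Basic properties\<close>

lemma fp_words_Nil [simp]: "[] \<in> fp_words V G"
  and fp_words_Cons [simp]: "(v, a) # w \<in> fp_words V G \<longleftrightarrow> v \<in> V \<and> a \<in> carrier (G v) \<and> w \<in> fp_words V G"
  and fp_words_append [simp]: "x @ y \<in> fp_words V G \<longleftrightarrow> x \<in> fp_words V G \<and> y \<in> fp_words V G"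
  by (auto simp: fp_words_def)

lemma equiv_fp_rel: "equiv (fp_words V G) (fp_rel V G)"
  by (rule equivI)
     (auto simp: fp_rel_def refl_on_def sym_def trans_def intro: equivclp_sym equivclp_trans)

lemma fp_step_ctxt:
  assumes "fp_step V G x y" "u \<in> fp_words V G" "w \<in> fp_words V G"
  shows "fp_step V G (u @ x @ w) (u @ y @ w)"
  using assms(1)
proof cases
  case (fp_step_one us ws v)
  then show ?thesis using fp_step.fp_step_one[of "u @ us" V G "ws @ w" v] assms by simp
next
  case (fp_step_mult us ws v a b)
  then show ?thesis using fp_step.fp_step_mult[of "u @ us" V G "ws @ w" v a b] assms by simp
qed

lemma equivclp_fp_step_ctxt:
  assumes "equivclp (fp_step V G) x y" "u \<in> fp_words V G" "w \<in> fp_words V G"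
  shows "equivclp (fp_step V G) (u @ x @ w) (u @ y @ w)"
  using assms(1)
proof (induction rule: equivclp_induct)
  case base
  then show ?case by simp
next
  case (step y z)
  then show ?case using fp_step_ctxt[OF _ assms(2,3)] by (meson equivclp_into_equivclp)
qed

lemma fp_rel_append:
  assumes "(x, x') \<in> fp_rel V G" "(y, y') \<in> fp_rel V G"
  shows "(x @ y, x' @ y') \<in> fp_rel V G"
proof -
  have "equivclp (fp_step V G) (x @ y) (x' @ y)"
    using assms equivclp_fp_step_ctxt[of V G x x' "[]" y] by (auto simp: fp_rel_def)
  moreover have "equivclp (fp_step V G) (x' @ y) (x' @ y')"
    using assms equivclp_fp_step_ctxt[of V G y y' x' "[]"] by (auto simp: fp_rel_def)
  ultimately show ?thesis using assms by (auto simp: fp_rel_def intro: equivclp_trans)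
qed

lemma mult_free_product:
  assumes "x \<in> fp_words V G" "y \<in> fp_words V G"
  shows "(fp_rel V G `` {x}) \<otimes>\<^bsub>free_product V G\<^esub> (fp_rel V G `` {y}) = fp_rel V G `` {x @ y}"
proof -
  have eq: "fp_rel V G `` {x' @ y'} = fp_rel V G `` {x @ y}"
    if "x' \<in> fp_rel V G `` {x}" "y' \<in> fp_rel V G `` {y}" for x' y'
    using equiv_class_eq[OF equiv_fp_rel fp_rel_append[of x x' V G y y']] that by simp
  have mem: "x \<in> fp_rel V G `` {x}" "y \<in> fp_rel V G `` {y}"
    using assms by (auto simp: fp_rel_def)
  have "(\<Union>x'\<in>fp_rel V G `` {x}. \<Union>y'\<in>fp_rel V G `` {y}. fp_rel V G `` {x' @ y'})
      = (\<Union>x'\<in>fp_rel V G `` {x}. \<Union>y'\<in>fp_rel V G `` {y}. fp_rel V G `` {x @ y})"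
    by (intro SUP_cong refl eq)
  also have "\<dots> = fp_rel V G `` {x @ y}"
    using mem by blast
  finally show ?thesis by (simp add: free_product_def)
qed

lemma fp_left_inverse:
  assumes G: "\<And>v. v \<in> V \<Longrightarrow> group (G v)" and x: "x \<in> fp_words V G"
  shows "\<exists>y\<in>fp_words V G. (y @ x, []) \<in> fp_rel V G"
  using x
proof (induction x)
  case Nil
  then show ?case by (auto simp: fp_rel_def intro!: bexI[of _ "[]"])
next
  case (Cons c x)
  obtain v a where c: "c = (v, a)" by force
  with Cons obtain y where y: "y \<in> fp_words V G" "(y @ x, []) \<in> fp_rel V G"
    and va: "v \<in> V" "a \<in> carrier (G v)" and xw: "x \<in> fp_words V G" by auto
  interpret gv: group "G v" using G va by blast
  have "fp_step V G (y @ (v, inv\<^bsub>G v\<^esub> a) # (v, a) # x) (y @ (v, inv\<^bsub>G v\<^esub> a \<otimes>\<^bsub>G v\<^esub> a) # x)"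
    using y va xw by (intro fp_step_mult) auto
  then have 1: "equivclp (fp_step V G) (y @ (v, inv\<^bsub>G v\<^esub> a) # (v, a) # x) (y @ (v, \<one>\<^bsub>G v\<^esub>) # x)"
    unfolding gv.l_inv[OF va(2)] by (rule r_into_equivclp)
  have 2: "equivclp (fp_step V G) (y @ (v, \<one>\<^bsub>G v\<^esub>) # x) (y @ x)"
    by (rule r_into_equivclp, rule fp_step_one) (use y va xw in simp_all)
  have 3: "equivclp (fp_step V G) (y @ x) []"
    using y by (simp add: fp_rel_def)
  have "equivclp (fp_step V G) (y @ (v, inv\<^bsub>G v\<^esub> a) # (v, a) # x) []"
    by (rule equivclp_trans[OF 1 equivclp_trans[OF 2 3]])
  then have "((y @ [(v, inv\<^bsub>G v\<^esub> a)]) @ c # x, []) \<in> fp_rel V G"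
    using y va xw c by (simp add: fp_rel_def)
  moreover have "y @ [(v, inv\<^bsub>G v\<^esub> a)] \<in> fp_words V G"
    using y va by simp
  ultimately show ?case by blast
qed

lemma group_free_product:
  assumes "\<And>v. v \<in> V \<Longrightarrow> group (G v)"
  shows "group (free_product V G)"
proof (rule groupI)
  fix A assume "A \<in> carrier (free_product V G)"
  then obtain x where x: "x \<in> fp_words V G" "A = fp_rel V G `` {x}"
    by (auto simp: free_product_def elim: quotientE)
  obtain y where y: "y \<in> fp_words V G" "(y @ x, []) \<in> fp_rel V G"
    using fp_left_inverse[OF assms x(1)] by blast
  then have "(fp_rel V G `` {y}) \<otimes>\<^bsub>free_product V G\<^esub> A = \<one>\<^bsub>free_product V G\<^esub>"
    using x by (simp add: mult_free_product)
      (simp add: free_product_def equiv_class_eq[OF equiv_fp_rel])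
  then show "\<exists>B\<in>carrier (free_product V G). B \<otimes>\<^bsub>free_product V G\<^esub> A = \<one>\<^bsub>free_product V G\<^esub>"
    using y by (intro bexI[of _ "fp_rel V G `` {y}"]) (auto simp: free_product_def intro: quotientI)
next
  fix A B assume "A \<in> carrier (free_product V G)" "B \<in> carrier (free_product V G)"
  then obtain x y where "x \<in> fp_words V G" "A = fp_rel V G `` {x}"
      "y \<in> fp_words V G" "B = fp_rel V G `` {y}"
    by (auto simp: free_product_def elim!: quotientE)
  then show "A \<otimes>\<^bsub>free_product V G\<^esub> B \<in> carrier (free_product V G)"
    by (simp add: mult_free_product) (simp add: free_product_def quotientI)
next
  show "\<one>\<^bsub>free_product V G\<^esub> \<in> carrier (free_product V G)"
    by (simp add: free_product_def quotientI)
next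
  fix A B C assume "A \<in> carrier (free_product V G)" "B \<in> carrier (free_product V G)"
    "C \<in> carrier (free_product V G)"
  then obtain x y z where "x \<in> fp_words V G" "A = fp_rel V G `` {x}"
      "y \<in> fp_words V G" "B = fp_rel V G `` {y}" "z \<in> fp_words V G" "C = fp_rel V G `` {z}"
    by (auto simp: free_product_def elim!: quotientE)
  then show "A \<otimes>\<^bsub>free_product V G\<^esub> B \<otimes>\<^bsub>free_product V G\<^esub> C
      = A \<otimes>\<^bsub>free_product V G\<^esub> (B \<otimes>\<^bsub>free_product V G\<^esub> C)"
    by (simp add: mult_free_product)
next
  fix A assume "A \<in> carrier (free_product V G)"
  then obtain x where x: "x \<in> fp_words V G" "A = fp_rel V G `` {x}"
    by (auto simp: free_product_def elim: quotientE)
  then have "(fp_rel V G `` {[]}) \<otimes>\<^bsub>free_product V G\<^esub> A = A"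
    by (simp add: mult_free_product)
  then show "\<one>\<^bsub>free_product V G\<^esub> \<otimes>\<^bsub>free_product V G\<^esub> A = A"
    by (simp add: free_product_def)
qed

lemma fp_inj_hom:
  assumes "v \<in> V" "group (G v)"
  shows "fp_inj V G v \<in> hom (G v) (free_product V G)"
proof (rule homI)
  fix a assume "a \<in> carrier (G v)"
  then show "fp_inj V G v a \<in> carrier (free_product V G)"
    using assms by (simp add: fp_inj_def free_product_def quotientI)
next
  fix a b assume ab: "a \<in> carrier (G v)" "b \<in> carrier (G v)"
  have "fp_step V G ([] @ (v, a) # (v, b) # []) ([] @ (v, a \<otimes>\<^bsub>G v\<^esub> b) # [])"
    using assms ab by (intro fp_step_mult) auto
  then have "([(v, a), (v, b)], [(v, a \<otimes>\<^bsub>G v\<^esub> b)]) \<in> fp_rel V G"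
    using assms ab by (simp add: fp_rel_def group.is_monoid monoid.m_closed r_into_equivclp)
  then show "fp_inj V G v (a \<otimes>\<^bsub>G v\<^esub> b)
      = fp_inj V G v a \<otimes>\<^bsub>free_product V G\<^esub> fp_inj V G v b"
    using assms ab by (simp add: fp_inj_def mult_free_product equiv_class_eq[OF equiv_fp_rel])
qed

lemma normal_normal_closure:
  assumes "group H" "S \<subseteq> carrier H"
  shows "normal_closure H S \<lhd> H" "S \<subseteq> normal_closure H S"
proof -
  interpret group H by fact
  have car: "carrier H \<lhd> H"
    by (rule normal_invI[OF subgroup_self]) auto
  show "S \<subseteq> normal_closure H S" by (auto simp: normal_closure_def)
  have "subgroup (normal_closure H S) H"
    unfolding normal_closure_def using car assms(2)
    by (intro subgroups_Inter) (auto dest: normal_imp_subgroup)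
  then show "normal_closure H S \<lhd> H"
    by (rule normal_invI) (auto simp: normal_closure_def normal.inv_op_closed2)
qed

lemma group_graph_product:
  assumes "\<And>v. v \<in> V \<Longrightarrow> group (G v)"
  shows "group (graph_product V E G)"
proof -
  interpret group "free_product V G" using group_free_product[OF assms] .
  show ?thesis unfolding graph_product_def
    by (intro normal.factorgroup_is_group normal_normal_closure(1) is_group)
       (auto simp: commutator_def intro!: hom_in_carrier[OF fp_inj_hom] assms)
qed

lemma pmf_random_graph:
  assumes "0 \<le> p" "p \<le> 1" "E \<subseteq> complete_edges n"
  shows "pmf (random_graph n p) E = p ^ card E * (1 - p) ^ ((n choose 2) - card E)"
proof -
  have fin: "finite (complete_edges n)" by (auto simp: complete_edges_def)
  have cc: "card (complete_edges n) = n choose 2"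
    using n_subsets[of "{1..n}" 2] by (simp add: complete_edges_def)
  have finE: "finite E" using assms(3) fin finite_subset by blast
  let ?P = "Pi_pmf (complete_edges n) False (\<lambda>_. bernoulli_pmf p)"
  have "pmf (random_graph n p) E
      = measure_pmf.prob ?P ((\<lambda>f. {e \<in> complete_edges n. f e}) -` {E})"
    by (simp add: random_graph_def pmf_map)
  also have "\<dots> = measure_pmf.prob ?P {\<lambda>e. e \<in> E}"
  proof (rule measure_pmf.finite_measure_eq_AE)
    show "AE f in measure_pmf ?P. (f \<in> (\<lambda>f. {e \<in> complete_edges n. f e}) -` {E})
        = (f \<in> {\<lambda>e. e \<in> E})"
      using set_Pi_pmf_subset[OF fin] assms(3) by (fastforce simp: AE_measure_pmf_iff)
  qed auto
  also have "\<dots> = pmf ?P (\<lambda>e. e \<in> E)" by (simp add: measure_pmf_single)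
  also have "\<dots> = (\<Prod>e\<in>complete_edges n. pmf (bernoulli_pmf p) (e \<in> E))"
    using assms(3) fin by (subst pmf_Pi') auto
  also have "\<dots> = (\<Prod>e\<in>E. pmf (bernoulli_pmf p) (e \<in> E))
      * (\<Prod>e\<in>complete_edges n - E. pmf (bernoulli_pmf p) (e \<in> E))"
    by (subst prod.subset_diff[OF assms(3) fin]) (rule mult.commute)
  also have "\<dots> = p ^ card E * (1 - p) ^ card (complete_edges n - E)"
    using assms by simp
  finally show ?thesis using cc card_Diff_subset[OF finE assms(3)] by simp
qed

lemma Inn_normal:
  assumes "group H"
  shows "Inn H \<lhd> AutoGroup H"
proof -
  interpret group H by fact
  interpret A: group "AutoGroup H" by (rule AutoGroup)
  define c where "c g = (\<lambda>x\<in>carrier H. g \<otimes>\<^bsub>H\<^esub> x \<otimes>\<^bsub>H\<^esub> inv\<^bsub>H\<^esub> g)" for g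
  have carA: "carrier (AutoGroup H) = auto H" by (simp add: AutoGroup_def)
  have multA: "f \<otimes>\<^bsub>AutoGroup H\<^esub> h = compose (carrier H) f h" if "f \<in> auto H" "h \<in> auto H" for f h
    using that by (simp add: AutoGroup_def BijGroup_def auto_def)
  have c_comp: "compose (carrier H) (c g) (c h) = c (g \<otimes>\<^bsub>H\<^esub> h)"
    if "g \<in> carrier H" "h \<in> carrier H" for g h
    using that by (auto simp: c_def compose_def m_assoc inv_mult_group fun_eq_iff)
  have c_one: "c \<one>\<^bsub>H\<^esub> = (\<lambda>x\<in>carrier H. x)" by (auto simp: c_def fun_eq_iff)
  have oneA: "\<one>\<^bsub>AutoGroup H\<^esub> = c \<one>\<^bsub>H\<^esub>" by (simp add: AutoGroup_def BijGroup_def c_one)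
  have cancel: "inv\<^bsub>H\<^esub> g \<otimes>\<^bsub>H\<^esub> (g \<otimes>\<^bsub>H\<^esub> z) = z" "g \<otimes>\<^bsub>H\<^esub> (inv\<^bsub>H\<^esub> g \<otimes>\<^bsub>H\<^esub> z) = z"
    if "g \<in> carrier H" "z \<in> carrier H" for g z
    using that by (simp_all add: m_assoc[symmetric])
  have c_auto: "c g \<in> auto H" if g: "g \<in> carrier H" for g
  proof -
    have "c g \<in> hom H H"
    proof (rule homI)
      fix x y assume "x \<in> carrier H" "y \<in> carrier H"
      then show "c g (x \<otimes>\<^bsub>H\<^esub> y) = c g x \<otimes>\<^bsub>H\<^esub> c g y"
        using g by (simp add: c_def m_assoc cancel)
    qed (use g in \<open>simp add: c_def\<close>)
    moreover have "bij_betw (c g) (carrier H) (carrier H)"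
      by (rule bij_betw_byWitness[where f' = "c (inv\<^bsub>H\<^esub> g)"])
         (use g in \<open>auto simp: c_def m_assoc cancel\<close>)
    ultimately show ?thesis by (simp add: auto_def Bij_def c_def)
  qed
  have Inn_eq: "Inn H = c ` carrier H" by (auto simp: Inn_def c_def)
  have c_mult: "c g \<otimes>\<^bsub>AutoGroup H\<^esub> c h = c (g \<otimes>\<^bsub>H\<^esub> h)" if "g \<in> carrier H" "h \<in> carrier H" for g h
    using that by (simp add: multA c_auto c_comp)
  have c_inv: "inv\<^bsub>AutoGroup H\<^esub> (c g) = c (inv\<^bsub>H\<^esub> g)" if "g \<in> carrier H" for g
    using that by (intro A.inv_equality) (simp_all add: c_mult oneA carA c_auto)
  have sub: "subgroup (Inn H) (AutoGroup H)"
  proof (rule A.subgroupI)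
    show "Inn H \<subseteq> carrier (AutoGroup H)" by (auto simp: Inn_eq carA c_auto)
    show "Inn H \<noteq> {}" by (auto simp: Inn_eq)
  qed (auto simp: Inn_eq c_mult c_inv)
  show ?thesis
  proof (rule A.normal_invI[OF sub])
    fix f h assume f: "f \<in> carrier (AutoGroup H)" and h: "h \<in> Inn H"
    from h obtain g where g: "g \<in> carrier H" "h = c g" by (auto simp: Inn_eq)
    have fa: "f \<in> auto H" and fh: "f \<in> hom H H" using f by (auto simp: carA auto_def)
    interpret f: group_hom H H f by (unfold_locales) (rule fh)
    have fg: "f g \<in> carrier H" using g by simp
    have "f \<otimes>\<^bsub>AutoGroup H\<^esub> c g = c (f g) \<otimes>\<^bsub>AutoGroup H\<^esub> f"
      using fa g fg by (simp add: multA c_auto) (auto simp: compose_def c_def fun_eq_iff)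
    then have "f \<otimes>\<^bsub>AutoGroup H\<^esub> c g \<otimes>\<^bsub>AutoGroup H\<^esub> inv\<^bsub>AutoGroup H\<^esub> f = c (f g)"
      using f c_auto[OF fg] by (simp add: A.m_assoc flip: carA)
    then show "f \<otimes>\<^bsub>AutoGroup H\<^esub> h \<otimes>\<^bsub>AutoGroup H\<^esub> inv\<^bsub>AutoGroup H\<^esub> f \<in> Inn H"
      using g fg by (auto simp: Inn_eq)
  qed
qed

lemma group_Out:
  assumes "group H"
  shows "group (Out H)"
  unfolding Out_def using Inn_normal[OF assms] by (rule normal.factorgroup_is_group)

end

theory Submission
  imports Defs "HOL-Library.Sublist" "HOL-Real_Asymp.Real_Asymp"
begin

text \<open>
  For fixed \<open>0 < p < 1\<close>, a random graph asymptotically almost surely has, for any two vertices \<open>S\<close> and three other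
  vertices \<open>T\<close>, a further vertex joined to all of \<open>S\<close> and to none of \<open>T\<close>. Under this extension property
  every automorphism \<open>\<phi>\<close> agrees, up to an inner one, with a permutation of the vertex groups, and cyclic
  groups have finitely many generators.

  The centralizer of the derived subgroup of \<open>gspan (lk v)\<close> is the vertex group \<open>U v\<close>. For \<open>a\<close> in \<open>U v\<close>,
  consider \<open>\<phi> a\<close> in the Bass--Serre tree of the splitting of the graph product over \<open>gspan (lk w)\<close>. If
  it were hyperbolic, commutators of elements commuting with it would fix its axis and hence commute with a
  conjugate of \<open>U w\<close>; this conjugate would then lie in \<open>\<phi> ` U v\<close> and commute with \<open>\<phi> a\<close>, which
  makes \<open>\<phi> a\<close> elliptic. Being elliptic for all \<open>w\<close>, \<open>\<phi> a\<close> is conjugate into the subgroup of a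
  clique, and comparing centralizers for \<open>\<phi>\<close> and its inverse shows that \<open>\<phi>\<close> maps vertex groups to
  conjugates of vertex groups.

  The possible conjugators of a vertex group \<open>U s\<close> form a coset of \<open>gspan (st s)\<close>. The cosets of
  adjacent vertices meet; retracting to the common neighbours of two vertices shows that all cosets meet
  pairwise, and parabolic cosets have the Helly property, so there is one common conjugator.
\<close>

section \<open>Universal property of graph products\<close>

text \<open>Commutators enter because an element that commutes with a hyperbolic element may still
  shift its axis. Shifts of a line commute, so it is the derived subgroup of the centralizer that
  fixes the axis pointwise. This is why \<open>U v\<close> has to be recovered from the derived
  subgroup of \<open>gspan (lk v)\<close> and not from \<open>gspan (lk v)\<close> itself.

  Two tools carry the group theory. The retractions \<open>retr S\<close> turn questions on
  parabolic subgroups into questions on sets of vertices. The tree of the splitting at a single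
  vertex \<open>w\<close> yields centralizers.

  The bound two on \<open>S\<close> is for the common neighbours of two vertices, through which
  their conjugators are compared. The bound three on \<open>T\<close> is for the choice of three
  neighbours of \<open>v\<close> not joined to a given neighbour \<open>u\<close>: the third avoids
  \<open>u\<close> and both earlier ones. Three are chosen because a reduced word starts in at most
  one of three distinct cosets, which leaves two to play against each other.\<close>

lemma (in group) mult_inv_cancel:
  assumes "x \<in> carrier G" "y \<in> carrier G"
  shows "inv x \<otimes> (x \<otimes> y) = y" "x \<otimes> (inv x \<otimes> y) = y"
  using assms by (simp_all add: m_assoc[symmetric])

lemma (in group) commutator_eq_one_iff:
  assumes "x \<in> carrier G" "y \<in> carrier G"
  shows "commutator G x y = \<one> \<longleftrightarrow> x \<otimes> y = y \<otimes> x"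
proof -
  have "commutator G x y = (x \<otimes> y) \<otimes> inv (y \<otimes> x)"
    using assms by (simp add: commutator_def inv_mult_group m_assoc)
  then show ?thesis
    using assms by (metis inv_closed inv_equality inv_inv m_closed r_inv)
qed

definition word_prod :: "('b, 'c) monoid_scheme \<Rightarrow> ('v \<Rightarrow> 'a \<Rightarrow> 'b) \<Rightarrow> ('v \<times> 'a) list \<Rightarrow> 'b" where
  "word_prod K f w = foldr (\<lambda>(v, a) x. f v a \<otimes>\<^bsub>K\<^esub> x) w \<one>\<^bsub>K\<^esub>"

lemma free_product_lift:
  assumes K: "group K" and G: "\<And>v. v \<in> V \<Longrightarrow> group (G v)"
    and f: "\<And>v. v \<in> V \<Longrightarrow> f v \<in> hom (G v) K"
  obtains F where "F \<in> hom (free_product V G) K"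
    "\<And>v a. v \<in> V \<Longrightarrow> a \<in> carrier (G v) \<Longrightarrow> F (fp_inj V G v a) = f v a"
proof
  interpret K: group K by fact
  have fc: "f v a \<in> carrier K" if "v \<in> V" "a \<in> carrier (G v)" for v a
    using f[OF that(1)] that(2) by (auto simp: hom_def)
  have wc: "word_prod K f w \<in> carrier K" if "w \<in> fp_words V G" for w
    using that by (induction w) (auto simp: word_prod_def fc)
  have wapp: "word_prod K f (u @ w) = word_prod K f u \<otimes>\<^bsub>K\<^esub> word_prod K f w"
    if "u \<in> fp_words V G" "w \<in> fp_words V G" for u w
    using that
  proof (induction u)
    case Nil
    then show ?case using wc[of w] by (simp add: word_prod_def)
  next
    case (Cons c u)
    then show ?case using wc[of u] wc[of w] fc
      by (cases c) (simp add: word_prod_def K.m_assoc)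
  qed
  have wstep: "word_prod K f x = word_prod K f y" if "fp_step V G x y" for x y
    using that
  proof cases
    case (fp_step_one us ws v)
    interpret group_hom "G v" K "f v"
      using G f fp_step_one K by (auto simp: group_hom_def group_hom_axioms_def)
    from fp_step_one show ?thesis
      using wc[of ws] by (simp add: wapp) (simp add: word_prod_def)
  next
    case (fp_step_mult us ws v a b)
    interpret group_hom "G v" K "f v"
      using G f fp_step_mult K by (auto simp: group_hom_def group_hom_axioms_def)
    from fp_step_mult show ?thesis
      using wc[of ws] fc by (simp add: wapp) (simp add: word_prod_def K.m_assoc)
  qed
  have wrel: "word_prod K f x = word_prod K f y" if "(x, y) \<in> fp_rel V G" for x y
  proof -
    have "equivclp (fp_step V G) x y" using that by (simp add: fp_rel_def)
    then show ?thesis by (induction rule: equivclp_induct) (auto dest: wstep)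
  qed
  \<comment> \<open>Any representative will do: by \<open>wrel\<close> the value is constant on a
    class.\<close>
  define F where "F A = word_prod K f (SOME x. x \<in> A)" for A
  have F: "F (fp_rel V G `` {x}) = word_prod K f x" if "x \<in> fp_words V G" for x
  proof -
    have "x \<in> fp_rel V G `` {x}" using that by (simp add: fp_rel_def)
    then have "(SOME y. y \<in> fp_rel V G `` {x}) \<in> fp_rel V G `` {x}" by (rule someI)
    then show ?thesis unfolding F_def by (auto dest: wrel)
  qed
  show "F \<in> hom (free_product V G) K"
  proof (rule homI)
    fix A assume "A \<in> carrier (free_product V G)"
    then show "F A \<in> carrier K" by (auto simp: free_product_def F wc elim!: quotientE)
  next
    fix A B assume "A \<in> carrier (free_product V G)" "B \<in> carrier (free_product V G)"
    then obtain x y where "x \<in> fp_words V G" "A = fp_rel V G `` {x}"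
        "y \<in> fp_words V G" "B = fp_rel V G `` {y}"
      by (auto simp: free_product_def elim!: quotientE)
    then show "F (A \<otimes>\<^bsub>free_product V G\<^esub> B) = F A \<otimes>\<^bsub>K\<^esub> F B"
      by (simp add: mult_free_product F wapp)
  qed
  show "F (fp_inj V G v a) = f v a" if "v \<in> V" "a \<in> carrier (G v)" for v a
    using that fc[OF that] by (simp add: fp_inj_def F) (simp add: word_prod_def)
qed

definition edge_commutators :: "'v set \<Rightarrow> 'v set set \<Rightarrow> ('v \<Rightarrow> 'a monoid) \<Rightarrow> ('v \<times> 'a) list set set" where
  "edge_commutators V E G =
    {commutator (free_product V G) (fp_inj V G v a) (fp_inj V G w b) | v w a b.
       v \<in> V \<and> w \<in> V \<and> {v, w} \<in> E \<and> a \<in> carrier (G v) \<and> b \<in> carrier (G w)}"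

definition gp_inj :: "'v set \<Rightarrow> 'v set set \<Rightarrow> ('v \<Rightarrow> 'a monoid) \<Rightarrow> 'v \<Rightarrow> 'a \<Rightarrow> ('v \<times> 'a) list set set" where
  "gp_inj V E G v a =
    normal_closure (free_product V G) (edge_commutators V E G) #>\<^bsub>free_product V G\<^esub> fp_inj V G v a"

lemma graph_product_eq:
  "graph_product V E G = free_product V G Mod normal_closure (free_product V G) (edge_commutators V E G)"
  by (simp add: graph_product_def edge_commutators_def)

context
  fixes V :: "'v set" and E :: "'v set set" and G :: "'v \<Rightarrow> 'a monoid"
  assumes G: "\<And>v. v \<in> V \<Longrightarrow> group (G v)"
begin

interpretation FP: group "free_product V G"
  using G by (rule group_free_product)

lemma fp_inj_carrier: "v \<in> V \<Longrightarrow> a \<in> carrier (G v) \<Longrightarrow> fp_inj V G v a \<in> carrier (free_product V G)"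
  using fp_inj_hom[of v V G] G by (auto simp: hom_def)

lemma edge_commutators_carrier: "edge_commutators V E G \<subseteq> carrier (free_product V G)"
  by (auto simp: edge_commutators_def commutator_def fp_inj_carrier)

lemma edge_normal: "normal_closure (free_product V G) (edge_commutators V E G) \<lhd> free_product V G"
  and edge_commutators_sub: "edge_commutators V E G \<subseteq> normal_closure (free_product V G) (edge_commutators V E G)"
  using normal_normal_closure[OF FP.is_group edge_commutators_carrier] by auto

interpretation N: normal "normal_closure (free_product V G) (edge_commutators V E G)" "free_product V G"
  by (rule edge_normal)

lemma gp_inj_hom: "v \<in> V \<Longrightarrow> gp_inj V E G v \<in> hom (G v) (graph_product V E G)"
  using hom_compose[OF fp_inj_hom[of v V G] N.r_coset_hom_Mod] G
  by (simp add: graph_product_eq gp_inj_def[abs_def] comp_def)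

text \<open>The lift to the free product kills the edge commutators because the images commute. Its
  kernel is normal, so it contains their normal closure.\<close>

lemma graph_product_lift:
  assumes K: "group K" and f: "\<And>v. v \<in> V \<Longrightarrow> f v \<in> hom (G v) K"
    and comm: "\<And>v w a b. v \<in> V \<Longrightarrow> w \<in> V \<Longrightarrow> {v, w} \<in> E \<Longrightarrow> a \<in> carrier (G v) \<Longrightarrow> b \<in> carrier (G w) \<Longrightarrow>
      f v a \<otimes>\<^bsub>K\<^esub> f w b = f w b \<otimes>\<^bsub>K\<^esub> f v a"
  obtains F where "F \<in> hom (graph_product V E G) K"
    "\<And>v a. v \<in> V \<Longrightarrow> a \<in> carrier (G v) \<Longrightarrow> F (gp_inj V E G v a) = f v a"
proof -
  interpret K: group K by fact
  obtain F0 where F0: "F0 \<in> hom (free_product V G) K"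
    "\<And>v a. v \<in> V \<Longrightarrow> a \<in> carrier (G v) \<Longrightarrow> F0 (fp_inj V G v a) = f v a"
    using free_product_lift[of K V G f] K G f by metis
  interpret F0: group_hom "free_product V G" K F0
    by unfold_locales (rule F0)
  have fc: "f v a \<in> carrier K" if "v \<in> V" "a \<in> carrier (G v)" for v a
    using f[OF that(1)] that(2) by (auto simp: hom_def)
  have "edge_commutators V E G \<subseteq> kernel (free_product V G) K F0"
  proof
    fix c assume c: "c \<in> edge_commutators V E G"
    then obtain v w a b where c_eq: "c = commutator (free_product V G) (fp_inj V G v a) (fp_inj V G w b)"
      and h: "v \<in> V" "w \<in> V" "{v, w} \<in> E" "a \<in> carrier (G v)" "b \<in> carrier (G w)"
      by (auto simp: edge_commutators_def)
    have "F0 c = commutator K (f v a) (f w b)"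
      using h by (simp add: c_eq commutator_def F0(2) fp_inj_carrier)
    then have "F0 c = \<one>\<^bsub>K\<^esub>"
      using h comm by (simp add: K.commutator_eq_one_iff fc)
    then show "c \<in> kernel (free_product V G) K F0"
      using c edge_commutators_carrier by (auto simp: kernel_def)
  qed
  then have ker: "normal_closure (free_product V G) (edge_commutators V E G) \<subseteq> kernel (free_product V G) K F0"
    using F0.normal_kernel by (auto simp: normal_closure_def)
  obtain F where F: "F \<in> hom (graph_product V E G) K"
    "\<And>x. x \<in> carrier (free_product V G) \<Longrightarrow>
       F (normal_closure (free_product V G) (edge_commutators V E G) #>\<^bsub>free_product V G\<^esub> x) = F0 x"
    using F0.FactGroup_universal_kernel[OF edge_normal ker] unfolding graph_product_eq by metis
  show thesis
    by (rule that[OF F(1)]) (simp add: gp_inj_def F(2) F0(2) fp_inj_carrier)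
qed

lemma gp_inj_commute:
  assumes h: "v \<in> V" "w \<in> V" "{v, w} \<in> E" "a \<in> carrier (G v)" "b \<in> carrier (G w)"
  shows "gp_inj V E G v a \<otimes>\<^bsub>graph_product V E G\<^esub> gp_inj V E G w b
    = gp_inj V E G w b \<otimes>\<^bsub>graph_product V E G\<^esub> gp_inj V E G v a"
proof -
  let ?N = "normal_closure (free_product V G) (edge_commutators V E G)"
  let ?x = "fp_inj V G v a" and ?y = "fp_inj V G w b"
  have xy: "?x \<in> carrier (free_product V G)" "?y \<in> carrier (free_product V G)"
    using h by (auto simp: fp_inj_carrier)
  have "commutator (free_product V G) ?x ?y \<in> ?N"
    by (rule subsetD[OF edge_commutators_sub]) (use h in \<open>auto simp: edge_commutators_def\<close>)
  then have "?N #>\<^bsub>free_product V G\<^esub> (commutator (free_product V G) ?x ?y \<otimes>\<^bsub>free_product V G\<^esub> (?y \<otimes>\<^bsub>free_product V G\<^esub> ?x))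
     = ?N #>\<^bsub>free_product V G\<^esub> (?y \<otimes>\<^bsub>free_product V G\<^esub> ?x)"
    using xy by (metis FP.coset_join2 FP.coset_mult_assoc FP.m_closed N.subgroup_axioms N.subset N.mem_carrier)
  moreover have "commutator (free_product V G) ?x ?y \<otimes>\<^bsub>free_product V G\<^esub> (?y \<otimes>\<^bsub>free_product V G\<^esub> ?x)
     = ?x \<otimes>\<^bsub>free_product V G\<^esub> ?y"
    using xy by (simp add: commutator_def FP.m_assoc FP.mult_inv_cancel)
  ultimately show ?thesis
    using xy by (simp add: gp_inj_def graph_product_eq N.rcos_sum)
qed

text \<open>Killing all other vertex groups gives a left inverse of the embedding. It respects the
  relations because an edge joins two different vertices, so one of the two letters is always sent
  to one.\<close>

lemma gp_inj_injective:
  assumes v: "v \<in> V" and "\<And>w. {w} \<notin> E"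
  shows "inj_on (gp_inj V E G v) (carrier (G v))"
proof -
  interpret Gv: group "G v" using G v .
  obtain F where F: "F \<in> hom (graph_product V E G) (G v)"
    "\<And>w a. w \<in> V \<Longrightarrow> a \<in> carrier (G w) \<Longrightarrow> F (gp_inj V E G w a) = (if w = v then a else \<one>\<^bsub>G v\<^esub>)"
    by (rule graph_product_lift[of "G v" "\<lambda>w a. if w = v then a else \<one>\<^bsub>G v\<^esub>"])
       (use assms in \<open>auto simp: hom_def\<close>)
  show ?thesis by (rule inj_on_inverseI[of _ F]) (use v F(2) in simp)
qed

lemma graph_product_generate:
  "carrier (graph_product V E G) = generate (graph_product V E G) (\<Union>v\<in>V. gp_inj V E G v ` carrier (G v))"
    (is "_ = generate ?P ?U")
proof
  interpret P: group ?P using G by (rule group_graph_product)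
  have U: "?U \<subseteq> carrier ?P" using gp_inj_hom by (auto simp: hom_def)
  show "generate ?P ?U \<subseteq> carrier ?P" by (rule P.generate_incl[OF U])
  let ?N = "normal_closure (free_product V G) (edge_commutators V E G)"
  have "?N #>\<^bsub>free_product V G\<^esub> (fp_rel V G `` {w}) \<in> generate ?P ?U" if "w \<in> fp_words V G" for w
    using that
  proof (induction w)
    case Nil
    have "fp_rel V G `` {[]} = \<one>\<^bsub>free_product V G\<^esub>" by (simp add: free_product_def)
    then have "?N #>\<^bsub>free_product V G\<^esub> (fp_rel V G `` {[]}) = \<one>\<^bsub>?P\<^esub>"
      by (simp only: FP.coset_mult_one[OF N.subset]) (simp add: graph_product_eq)
    then show ?case by (simp add: generate.one)
  next
    case (Cons c w)
    obtain v a where c: "c = (v, a)" by force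
    have h: "v \<in> V" "a \<in> carrier (G v)" "w \<in> fp_words V G" using Cons c by auto
    have w: "fp_rel V G `` {w} \<in> carrier (free_product V G)"
      using h by (auto simp: free_product_def quotientI)
    have "?N #>\<^bsub>free_product V G\<^esub> (fp_rel V G `` {c # w})
      = ?N #>\<^bsub>free_product V G\<^esub> (fp_inj V G v a \<otimes>\<^bsub>free_product V G\<^esub> fp_rel V G `` {w})"
      using h by (simp add: fp_inj_def mult_free_product c)
    also have "\<dots> = gp_inj V E G v a \<otimes>\<^bsub>?P\<^esub> (?N #>\<^bsub>free_product V G\<^esub> (fp_rel V G `` {w}))"
      using w h fp_inj_carrier by (simp add: gp_inj_def graph_product_eq N.rcos_sum)
    finally show ?case
      using Cons.IH h by (simp only:) (rule generate.eng[OF generate.incl], auto)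
  qed
  then show "carrier ?P \<subseteq> generate ?P ?U"
    unfolding graph_product_eq carrier_FactGroup
    by (auto simp: free_product_def elim!: quotientE)
qed

end

section \<open>Parabolic subgroups and retractions\<close>

lemma (in group) generate_commute:
  assumes A: "A \<subseteq> carrier G" "B \<subseteq> carrier G"
    and comm: "\<And>x y. x \<in> A \<Longrightarrow> y \<in> B \<Longrightarrow> x \<otimes> y = y \<otimes> x"
    and "x \<in> generate G A" "y \<in> generate G B"
  shows "x \<otimes> y = y \<otimes> x"
proof -
  have inv_comm: "inv a \<otimes> b = b \<otimes> inv a"
    if "a \<otimes> b = b \<otimes> a" "a \<in> carrier G" "b \<in> carrier G" for a b
    using that by (metis inv_closed m_assoc m_closed r_inv l_inv r_one l_one)
  have 1: "x \<otimes> b = b \<otimes> x" if b: "b \<in> B" for b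
    using \<open>x \<in> generate G A\<close>
  proof (induction rule: generate.induct)
    case (eng h1 h2)
    have "h1 \<in> carrier G" "h2 \<in> carrier G" "b \<in> carrier G"
      using eng generate_in_carrier[OF A(1)] A(2) b by auto
    then show ?case using eng by (metis m_assoc)
  next
    case (inv h)
    then show ?case using A b comm inv_comm[of h b] by auto
  qed (use A b comm in auto)
  have x: "x \<in> carrier G" using generate_in_carrier[OF A(1)] assms by blast
  show ?thesis
    using \<open>y \<in> generate G B\<close>
  proof (induction rule: generate.induct)
    case (inv h)
    then show ?case using A(2) x 1 inv_comm[of h x] by auto
  next
    case (eng h1 h2)
    have "h1 \<in> carrier G" "h2 \<in> carrier G"
      using eng generate_in_carrier[OF A(2)] by auto
    then show ?case using eng x by (metis m_assoc)
  qed (use A x 1 in auto)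
qed

text \<open>A locale cannot quantify over types, so the universal property of a graph product is assumed
  only for the two kinds of target groups that are used: the group itself, for the retractions, and
  permutation groups of words, for the actions.\<close>

locale graph_product_group = group G for G :: "'g monoid" (structure) +
  fixes V :: "'v set" and E :: "'v set set" and U :: "'v \<Rightarrow> 'g set"
  assumes finite_V: "finite V"
    and no_loops: "{v} \<notin> E"
    and U_subgroup: "v \<in> V \<Longrightarrow> subgroup (U v) G"
    and U_abelian: "v \<in> V \<Longrightarrow> a \<in> U v \<Longrightarrow> b \<in> U v \<Longrightarrow> a \<otimes> b = b \<otimes> a"
    and U_adjacent: "v \<in> V \<Longrightarrow> w \<in> V \<Longrightarrow> {v, w} \<in> E \<Longrightarrow> a \<in> U v \<Longrightarrow> b \<in> U w \<Longrightarrow> a \<otimes> b = b \<otimes> a"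
    and U_nontrivial: "v \<in> V \<Longrightarrow> \<exists>a\<in>U v. a \<noteq> \<one>"
    and U_generate: "carrier G = generate G (\<Union>v\<in>V. U v)"
    and lift_endo: "\<lbrakk>\<And>v. v \<in> V \<Longrightarrow> f v \<in> hom (G\<lparr>carrier := U v\<rparr>) G;
        \<And>v w a b. v \<in> V \<Longrightarrow> w \<in> V \<Longrightarrow> {v, w} \<in> E \<Longrightarrow> a \<in> U v \<Longrightarrow> b \<in> U w \<Longrightarrow>
          f v a \<otimes> f w b = f w b \<otimes> f v a\<rbrakk>
      \<Longrightarrow> \<exists>F\<in>hom G G. \<forall>v\<in>V. \<forall>a\<in>U v. F a = f v a"
    and lift_perm: "\<lbrakk>\<And>v. v \<in> V \<Longrightarrow> p v \<in> hom (G\<lparr>carrier := U v\<rparr>) (BijGroup R);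
        \<And>v w a b. v \<in> V \<Longrightarrow> w \<in> V \<Longrightarrow> {v, w} \<in> E \<Longrightarrow> a \<in> U v \<Longrightarrow> b \<in> U w \<Longrightarrow>
          p v a \<otimes>\<^bsub>BijGroup R\<^esub> p w b = p w b \<otimes>\<^bsub>BijGroup R\<^esub> p v a\<rbrakk>
      \<Longrightarrow> \<exists>F\<in>hom G (BijGroup (R :: ('g set \<times> 'g) list set)). \<forall>v\<in>V. \<forall>a\<in>U v. F a = p v a"
begin

definition lk :: "'v \<Rightarrow> 'v set" where "lk v = {w \<in> V. {v, w} \<in> E}"
definition st :: "'v \<Rightarrow> 'v set" where "st v = insert v (lk v)"
text \<open>Intersecting with \<open>V\<close> admits index sets that are not contained in
  \<open>V\<close>, in particular \<open>UNIV\<close>, the intersection of an empty family.\<close>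

definition gspan :: "'v set \<Rightarrow> 'g set" where "gspan S = generate G (\<Union>v\<in>S \<inter> V. U v)"
text \<open>The retraction of \<open>G\<close> onto the parabolic subgroup \<open>gspan S\<close>.
  It exists by \<open>lift_endo\<close>: commuting letters still commute after some of them are
  replaced by one.\<close>

definition retr :: "'v set \<Rightarrow> 'g \<Rightarrow> 'g" where
  "retr S = (SOME F. F \<in> hom G G \<and> (\<forall>v\<in>V. \<forall>a\<in>U v. F a = (if v \<in> S then a else \<one>)))"

lemma lk_subset: "lk v \<subseteq> V" by (auto simp: lk_def)
lemma not_in_lk [simp]: "v \<notin> lk v" using no_loops[of v] by (auto simp: lk_def)
lemma lk_sym: "v \<in> V \<Longrightarrow> w \<in> lk v \<Longrightarrow> v \<in> lk w" by (auto simp: lk_def insert_commute)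

lemma U_carrier: "v \<in> V \<Longrightarrow> a \<in> U v \<Longrightarrow> a \<in> carrier G"
  using U_subgroup by (blast dest: subgroup.mem_carrier)
lemma U_Union_carrier: "(\<Union>v\<in>S \<inter> V. U v) \<subseteq> carrier G"
  using U_carrier by auto
lemma U_one: "v \<in> V \<Longrightarrow> \<one> \<in> U v" using U_subgroup by (blast intro: subgroup.one_closed)
lemma U_mult: "v \<in> V \<Longrightarrow> a \<in> U v \<Longrightarrow> b \<in> U v \<Longrightarrow> a \<otimes> b \<in> U v"
  using U_subgroup by (blast intro: subgroup.m_closed)
lemma U_inv: "v \<in> V \<Longrightarrow> a \<in> U v \<Longrightarrow> inv a \<in> U v"
  using U_subgroup by (blast intro: subgroup.m_inv_closed)

lemma gspan_subgroup: "subgroup (gspan S) G"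
  unfolding gspan_def by (rule generate_is_subgroup[OF U_Union_carrier])
lemma gspan_carrier: "x \<in> gspan S \<Longrightarrow> x \<in> carrier G"
  using gspan_subgroup by (blast dest: subgroup.mem_carrier)
lemma gspan_one [simp]: "\<one> \<in> gspan S" using gspan_subgroup by (blast intro: subgroup.one_closed)
lemma gspan_mult: "x \<in> gspan S \<Longrightarrow> y \<in> gspan S \<Longrightarrow> x \<otimes> y \<in> gspan S"
  using gspan_subgroup by (blast intro: subgroup.m_closed)
lemma gspan_inv: "x \<in> gspan S \<Longrightarrow> inv x \<in> gspan S"
  using gspan_subgroup by (blast intro: subgroup.m_inv_closed)
lemma gspan_mono: "S \<inter> V \<subseteq> T \<Longrightarrow> gspan S \<subseteq> gspan T"
  unfolding gspan_def by (rule mono_generate) auto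
lemma U_span: "v \<in> S \<Longrightarrow> v \<in> V \<Longrightarrow> a \<in> U v \<Longrightarrow> a \<in> gspan S"
  unfolding gspan_def by (rule generate.incl) auto
lemma gspan_V: "gspan V = carrier G" by (simp add: gspan_def U_generate)

lemma gspan_least:
  assumes "subgroup K G" "\<And>v a. v \<in> S \<Longrightarrow> v \<in> V \<Longrightarrow> a \<in> U v \<Longrightarrow> a \<in> K"
  shows "gspan S \<subseteq> K"
  unfolding gspan_def by (rule generate_subgroup_incl[OF _ assms(1)]) (use assms(2) in auto)

lemma gspan_singleton: "v \<in> V \<Longrightarrow> gspan {v} = U v"
  by (rule antisym[OF gspan_least]) (use U_subgroup U_span in auto)

lemma gspan_empty: "gspan {} = {\<one>}"
  by (auto simp: gspan_def generate_empty)

lemma gspan_commute: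
  assumes "\<And>v w a b. v \<in> S \<Longrightarrow> w \<in> T \<Longrightarrow> v \<in> V \<Longrightarrow> w \<in> V \<Longrightarrow> a \<in> U v \<Longrightarrow> b \<in> U w \<Longrightarrow> a \<otimes> b = b \<otimes> a"
    and "x \<in> gspan S" "y \<in> gspan T"
  shows "x \<otimes> y = y \<otimes> x"
  using assms(2,3) unfolding gspan_def
  by (rule generate_commute[OF U_Union_carrier U_Union_carrier, rotated]) (use assms(1) in auto)

lemma U_span_lk: "v \<in> V \<Longrightarrow> a \<in> U v \<Longrightarrow> x \<in> gspan (lk v) \<Longrightarrow> a \<otimes> x = x \<otimes> a"
  by (rule gspan_commute[of "{v}" "lk v"]) (auto simp: lk_def gspan_singleton intro: U_adjacent)

lemma U_span_st: "v \<in> V \<Longrightarrow> a \<in> U v \<Longrightarrow> x \<in> gspan (st v) \<Longrightarrow> a \<otimes> x = x \<otimes> a"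
  by (rule gspan_commute[of "{v}" "st v"]) (auto simp: lk_def st_def gspan_singleton intro: U_adjacent U_abelian)

lemma retr: "retr S \<in> hom G G" "v \<in> V \<Longrightarrow> a \<in> U v \<Longrightarrow> retr S a = (if v \<in> S then a else \<one>)"
proof -
  have "\<exists>F\<in>hom G G. \<forall>v\<in>V. \<forall>a\<in>U v. F a = (if v \<in> S then a else \<one>)"
    by (rule lift_endo) (auto simp: hom_def U_carrier intro: U_adjacent)
  then have "\<exists>F. F \<in> hom G G \<and> (\<forall>v\<in>V. \<forall>a\<in>U v. F a = (if v \<in> S then a else \<one>))"
    by blast
  from someI_ex[OF this] show "retr S \<in> hom G G"
    "v \<in> V \<Longrightarrow> a \<in> U v \<Longrightarrow> retr S a = (if v \<in> S then a else \<one>)"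
    by (auto simp: retr_def)
qed

lemma retr_group_hom: "group_hom G G (retr S)"
  using retr(1) by unfold_locales

lemma retr_carrier [simp]: "x \<in> carrier G \<Longrightarrow> retr S x \<in> carrier G"
  using retr(1) by (auto simp: hom_def)
lemma retr_mult [simp]: "x \<in> carrier G \<Longrightarrow> y \<in> carrier G \<Longrightarrow> retr S (x \<otimes> y) = retr S x \<otimes> retr S y"
  using retr(1) by (auto simp: hom_def)
lemma retr_inv [simp]: "x \<in> carrier G \<Longrightarrow> retr S (inv x) = inv (retr S x)"
  by (rule group_hom.hom_inv[OF retr_group_hom])
lemma retr_one [simp]: "retr S \<one> = \<one>"
  by (rule group_hom.hom_one[OF retr_group_hom])

lemma retr_span:
  assumes "x \<in> gspan T" shows "retr S x \<in> gspan (S \<inter> T)"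
  using assms unfolding gspan_def[of T]
proof (induction rule: generate.induct)
  case (incl h)
  then show ?case by (auto simp: retr(2) U_span)
next
  case (inv h)
  then show ?case by (auto simp: retr(2) U_span U_carrier U_inv)
next
  case (eng h1 h2)
  then have "h1 \<in> carrier G" "h2 \<in> carrier G"
    using gspan_carrier[of _ T] by (auto simp: gspan_def)
  then show ?case using eng by (simp add: gspan_mult)
qed auto

lemma retr_id:
  assumes "x \<in> gspan T" "T \<inter> V \<subseteq> S" shows "retr S x = x"
  using assms(1) unfolding gspan_def[of T]
proof (induction rule: generate.induct)
  case (eng h1 h2)
  then have "h1 \<in> carrier G" "h2 \<in> carrier G"
    using gspan_carrier[of _ T] by (auto simp: gspan_def)
  then show ?case using eng by simp
qed (use assms(2) in \<open>auto simp: retr(2) U_carrier\<close>)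

lemma retr_in_span: "x \<in> carrier G \<Longrightarrow> retr S x \<in> gspan S"
  using retr_span[of x V S] gspan_mono[of "S \<inter> V" S] by (auto simp: gspan_V)

text \<open>\<open>retr S\<close> is the identity on \<open>gspan S\<close> and carries
  \<open>gspan T\<close> into \<open>gspan (S \<inter> T)\<close>.\<close>

lemma gspan_Int: "x \<in> gspan S \<Longrightarrow> x \<in> gspan T \<Longrightarrow> x \<in> gspan (S \<inter> T)"
  using retr_span[of x T S] retr_id[of x S S] by simp

text \<open>If the two sets were disjoint, \<open>retr T\<close> would kill \<open>gspan S\<close>.
  With \<open>T\<close> a single vertex this detects which vertices an element really
  involves.\<close>

lemma gspan_disjoint: "x \<in> gspan S \<Longrightarrow> retr T x \<noteq> \<one> \<Longrightarrow> S \<inter> T \<noteq> {}"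
  using retr_span[of x S T] by (auto simp: Int_commute gspan_empty)

lemma gspan_Inter:
  assumes "finite \<S>" "x \<in> carrier G" "\<And>S. S \<in> \<S> \<Longrightarrow> x \<in> gspan S"
  shows "x \<in> gspan (\<Inter>\<S>)"
  using assms
proof (induction rule: finite_induct)
  case empty
  then show ?case using gspan_mono[of V UNIV] by (auto simp: gspan_V)
qed (simp add: gspan_Int)

text \<open>\<open>U v\<close> commutes with everything spanned by its link, so the products of the
  two factors already form a subgroup.\<close>

lemma gspan_star_decomp:
  assumes v: "v \<in> V" and S: "S \<inter> V \<subseteq> st v" and x: "x \<in> gspan S"
  obtains a l where "a \<in> U v" "l \<in> gspan (S - {v})" "x = a \<otimes> l" "retr {v} x = a"
proof -
  have sub: "gspan (S - {v}) \<subseteq> gspan (lk v)"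
    by (rule gspan_mono) (use S in \<open>auto simp: st_def\<close>)
  have comm: "a \<otimes> l = l \<otimes> a" if "a \<in> U v" "l \<in> gspan (S - {v})" for a l
    using that sub U_span_lk[OF v] by blast
  have car: "a \<in> carrier G" "l \<in> carrier G" if "a \<in> U v" "l \<in> gspan (S - {v})" for a l
    using that U_carrier v gspan_carrier by auto
  have "subgroup {a \<otimes> l | a l. a \<in> U v \<and> l \<in> gspan (S - {v})} G" (is "subgroup ?K G")
  proof (rule subgroupI)
    show "?K \<subseteq> carrier G" using car by auto
    show "?K \<noteq> {}" using U_one[OF v] gspan_one by blast
  next
    fix x assume "x \<in> ?K"
    then obtain a l where h: "x = a \<otimes> l" "a \<in> U v" "l \<in> gspan (S - {v})" by blast
    then have "inv x = inv a \<otimes> inv l" using car comm[of "inv a" "inv l"] U_inv[OF v] gspan_inv by (simp add: inv_mult_group)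
    then show "inv x \<in> ?K" using h U_inv[OF v] gspan_inv by blast
  next
    fix x y assume "x \<in> ?K" "y \<in> ?K"
    then obtain a l b k where h: "x = a \<otimes> l" "a \<in> U v" "l \<in> gspan (S - {v})"
      "y = b \<otimes> k" "b \<in> U v" "k \<in> gspan (S - {v})" by blast
    have "x \<otimes> y = a \<otimes> (l \<otimes> b) \<otimes> k" using h car by (simp add: m_assoc)
    also have "\<dots> = a \<otimes> (b \<otimes> l) \<otimes> k" using h comm[of b l] by simp
    also have "\<dots> = (a \<otimes> b) \<otimes> (l \<otimes> k)" using h car by (simp add: m_assoc)
    finally show "x \<otimes> y \<in> ?K" using h U_mult[OF v] gspan_mult by blast
  qed
  then have "gspan S \<subseteq> ?K"
  proof (rule gspan_least)
    fix u a assume "u \<in> S" "u \<in> V" "a \<in> U u"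
    then show "a \<in> ?K"
      using U_one[OF v] gspan_one[of "S - {v}"] U_carrier[of u a] U_span[of u "S - {v}" a]
      by (cases "u = v") (force intro: exI[of _ a] exI[of _ \<one>])+
  qed
  with x obtain a l where h: "a \<in> U v" "l \<in> gspan (S - {v})" "x = a \<otimes> l" by blast
  moreover have "retr {v} x = a"
    using h car v gspan_disjoint[of l "S - {v}" "{v}"] by (auto simp: retr(2))
  ultimately show thesis using that by blast
qed

end

section \<open>Action on reduced words\<close>

context graph_product_group
begin

text \<open>The default value one lets \<open>cons_syl\<close> treat a new syllable, a merged one
  and a cancelled one by the same formula: it is left multiplication by a letter of the factor
  \<open>x\<close> on normal forms of a free product.\<close>

definition hd_coeff :: "'x \<Rightarrow> ('x \<times> 'g) list \<Rightarrow> 'g" where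
  "hd_coeff x m = (if m \<noteq> [] \<and> fst (hd m) = x then snd (hd m) else \<one>)"
definition strip :: "'x \<Rightarrow> ('x \<times> 'g) list \<Rightarrow> ('x \<times> 'g) list" where
  "strip x m = (if m \<noteq> [] \<and> fst (hd m) = x then tl m else m)"
definition cons_syl :: "'x \<Rightarrow> 'g \<Rightarrow> ('x \<times> 'g) list \<Rightarrow> ('x \<times> 'g) list" where
  "cons_syl x a m = (if a \<otimes> hd_coeff x m = \<one> then strip x m else (x, a \<otimes> hd_coeff x m) # strip x m)"

definition cosets :: "'v \<Rightarrow> 'g set set" where
  "cosets w = {h <# gspan (lk w) | h. h \<in> gspan (V - {w})}"

definition reduced :: "'v \<Rightarrow> ('g set \<times> 'g) list set" where
  "reduced w = {m. set m \<subseteq> cosets w \<times> (U w - {\<one>}) \<and> distinct_adj (map fst m)}"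

text \<open>Conjugation by an element \<open>s\<close> of \<open>gspan (V - {w})\<close>: it
  permutes the free factors, which are indexed by cosets, and keeps the labels in
  \<open>U w\<close>.\<close>

definition translate :: "'g \<Rightarrow> ('g set \<times> 'g) list \<Rightarrow> ('g set \<times> 'g) list" where
  "translate s m = map (\<lambda>(x, a). (s <# x, a)) m"

lemma reduced_Nil [simp]: "[] \<in> reduced w" by (simp add: reduced_def)

lemma reduced_Cons: "(x, a) # m \<in> reduced w \<longleftrightarrow>
    x \<in> cosets w \<and> a \<in> U w \<and> a \<noteq> \<one> \<and> m \<in> reduced w \<and> (m = [] \<or> fst (hd m) \<noteq> x)"
  by (cases m) (auto simp: reduced_def)

lemma reduced_append: "m @ n \<in> reduced w \<longleftrightarrow>
    m \<in> reduced w \<and> n \<in> reduced w \<and> (m = [] \<or> n = [] \<or> fst (last m) \<noteq> fst (hd n))"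
  by (auto simp: reduced_def distinct_adj_append_iff last_map hd_map)

lemma translate_simps [simp]:
  "translate s [] = []" "translate s (m @ n) = translate s m @ translate s n"
  "translate s ((x, a) # m) = (s <# x, a) # translate s m"
  "length (translate s m) = length m" "translate s m = [] \<longleftrightarrow> m = []"
  by (auto simp: translate_def)

lemma fst_hd_translate: "m \<noteq> [] \<Longrightarrow> fst (hd (translate s m)) = s <# fst (hd m)"
  by (cases m) (auto simp: translate_def)

context
  fixes w assumes w: "w \<in> V"
begin

lemma coset_carrier: "x \<in> cosets w \<Longrightarrow> x \<subseteq> carrier G"
  by (auto simp: cosets_def l_coset_def gspan_carrier)

lemma base_coset: "gspan (lk w) \<in> cosets w"
  unfolding cosets_def
  by (rule CollectI, rule exI[of _ \<one>]) (auto intro!: lcos_mult_one[symmetric] gspan_carrier)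

lemma coset_mult: "s \<in> carrier G \<Longrightarrow> t \<in> carrier G \<Longrightarrow> x \<in> cosets w \<Longrightarrow> s <# (t <# x) = (s \<otimes> t) <# x"
  by (rule lcos_m_assoc[OF coset_carrier])

lemma coset_one: "x \<in> cosets w \<Longrightarrow> \<one> <# x = x"
  by (rule lcos_mult_one[OF coset_carrier])

lemma coset_translate:
  assumes s: "s \<in> gspan (V - {w})" and "x \<in> cosets w" shows "s <# x \<in> cosets w"
proof -
  obtain h where h: "h \<in> gspan (V - {w})" "x = h <# gspan (lk w)"
    using assms by (auto simp: cosets_def)
  then have "s <# x = (s \<otimes> h) <# gspan (lk w)"
    using s by (simp add: coset_mult base_coset gspan_carrier)
  then show ?thesis using h gspan_mult[OF s] by (auto simp: cosets_def)
qed

lemma coset_inj: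
  assumes "s \<in> carrier G" "x \<in> cosets w" "y \<in> cosets w" "s <# x = s <# y" shows "x = y"
proof -
  have "x = inv s <# (s <# x)" using assms(1,2) by (simp add: coset_mult coset_one)
  also have "\<dots> = y" unfolding assms(4) using assms(1,3) by (simp add: coset_mult coset_one)
  finally show ?thesis .
qed

lemma base_coset_fixed_iff: "s \<in> carrier G \<Longrightarrow> s <# gspan (lk w) = gspan (lk w) \<longleftrightarrow> s \<in> gspan (lk w)"
proof
  assume s: "s \<in> carrier G" "s <# gspan (lk w) = gspan (lk w)"
  have "s \<otimes> \<one> \<in> s <# gspan (lk w)" by (auto simp: l_coset_def)
  then show "s \<in> gspan (lk w)" using s by simp
next
  assume "s \<in> carrier G" "s \<in> gspan (lk w)"
  then show "s <# gspan (lk w) = gspan (lk w)"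
    by (metis subgroup.lcos_module_rev coset_join3 gspan_subgroup)
qed

lemma reduced_translate:
  assumes s: "s \<in> gspan (V - {w})" shows "m \<in> reduced w \<Longrightarrow> translate s m \<in> reduced w"
proof (induction m)
  case (Cons c m)
  obtain x a where c: "c = (x, a)" by force
  have "fst (hd m) \<in> cosets w" if "m \<noteq> []"
    using Cons.prems c that by (cases m) (auto simp: reduced_Cons)
  then show ?case
    using Cons c coset_translate[OF s] coset_inj[OF gspan_carrier[OF s], of "fst (hd m)" x]
    by (cases "m = []") (auto simp: reduced_Cons fst_hd_translate)
qed simp

lemma translate_mult: "s \<in> carrier G \<Longrightarrow> t \<in> carrier G \<Longrightarrow> m \<in> reduced w \<Longrightarrow>
    translate s (translate t m) = translate (s \<otimes> t) m"
  by (induction m) (auto simp: reduced_Cons coset_mult)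

lemma translate_one: "m \<in> reduced w \<Longrightarrow> translate \<one> m = m"
  by (induction m) (auto simp: reduced_Cons coset_one)

lemma hd_coeff_U: "m \<in> reduced w \<Longrightarrow> hd_coeff x m \<in> U w"
  by (cases m) (auto simp: hd_coeff_def reduced_Cons U_one[OF w])

lemma strip_reduced: "m \<in> reduced w \<Longrightarrow> strip x m \<in> reduced w"
  by (cases m) (auto simp: strip_def reduced_Cons)

lemma hd_strip: "m \<in> reduced w \<Longrightarrow> strip x m = [] \<or> fst (hd (strip x m)) \<noteq> x"
  by (cases m) (auto simp: strip_def reduced_Cons)

lemma cons_syl_reduced:
  assumes "m \<in> reduced w" "x \<in> cosets w" "a \<in> U w" shows "cons_syl x a m \<in> reduced w"
  using assms hd_coeff_U[of m x] strip_reduced[of m x] hd_strip[of m x] U_mult[OF w, of a "hd_coeff x m"]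
  by (auto simp: cons_syl_def reduced_Cons)

lemma hd_coeff_cons_syl:
  assumes "m \<in> reduced w" shows "hd_coeff x (cons_syl x a m) = a \<otimes> hd_coeff x m"
  using hd_strip[OF assms, of x] by (auto simp: cons_syl_def hd_coeff_def)

lemma strip_cons_syl:
  assumes "m \<in> reduced w" shows "strip x (cons_syl x a m) = strip x m"
  using hd_strip[OF assms, of x] by (auto simp: cons_syl_def) (auto simp: strip_def)

lemma cons_syl_mult:
  assumes "m \<in> reduced w" "a \<in> U w" "b \<in> U w"
  shows "cons_syl x a (cons_syl x b m) = cons_syl x (a \<otimes> b) m"
proof -
  have "a \<otimes> (b \<otimes> hd_coeff x m) = a \<otimes> b \<otimes> hd_coeff x m"
    using assms hd_coeff_U U_carrier[OF w] by (simp add: m_assoc)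
  then show ?thesis
    using assms(1) by (simp add: cons_syl_def[of x a] cons_syl_def[of x "a \<otimes> b"] hd_coeff_cons_syl strip_cons_syl)
qed

lemma cons_syl_one:
  assumes "m \<in> reduced w" shows "cons_syl x \<one> m = m"
  using assms U_carrier[OF w] by (cases m) (auto simp: cons_syl_def hd_coeff_def strip_def reduced_Cons)

lemma cons_syl_translate:
  assumes "m \<in> reduced w" "x \<in> cosets w" "s \<in> carrier G"
  shows "cons_syl (s <# x) a (translate s m) = translate s (cons_syl x a m)"
proof (cases m)
  case Nil
  then show ?thesis by (simp add: cons_syl_def hd_coeff_def strip_def)
next
  case (Cons c m')
  obtain y b where c: "c = (y, b)" by force
  have "y \<in> cosets w" using assms Cons c by (simp add: reduced_Cons)
  then have "s <# y = s <# x \<longleftrightarrow> y = x" using coset_inj assms by blast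
  then show ?thesis using Cons c by (simp add: cons_syl_def hd_coeff_def strip_def)
qed

lemma cons_syl_fresh: "a \<in> U w \<Longrightarrow> a \<noteq> \<one> \<Longrightarrow> m = [] \<or> fst (hd m) \<noteq> x \<Longrightarrow> cons_syl x a m = (x, a) # m"
  using U_carrier[OF w] by (auto simp: cons_syl_def hd_coeff_def strip_def)

lemma cons_syl_append: "m \<noteq> [] \<Longrightarrow> cons_syl x a (m @ n) = cons_syl x a m @ n"
  by (auto simp: cons_syl_def hd_coeff_def strip_def)

lemma length_cons_syl: "length (cons_syl x a m) \<le> Suc (length m)" "length m \<le> Suc (length (cons_syl x a m))"
  by (auto simp: cons_syl_def strip_def)

lemma BijI:
  assumes "\<And>m. m \<in> R \<Longrightarrow> f m \<in> R" "\<And>m. m \<in> R \<Longrightarrow> g m \<in> R"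
    "\<And>m. m \<in> R \<Longrightarrow> f (g m) = m" "\<And>m. m \<in> R \<Longrightarrow> g (f m) = m"
  shows "(\<lambda>m\<in>R. f m) \<in> Bij R"
proof -
  have "bij_betw f R R" by (rule bij_betw_byWitness[where f' = g]) (use assms in auto)
  then show ?thesis by (simp add: Bij_def)
qed

lemma Bij_translate:
  assumes s: "s \<in> gspan (V - {w})" shows "(\<lambda>m\<in>reduced w. translate s m) \<in> Bij (reduced w)"
  by (rule BijI[where g = "translate (inv s)"])
     (use s gspan_carrier[OF s] in \<open>auto simp: reduced_translate gspan_inv translate_mult translate_one\<close>)

lemma Bij_cons_syl:
  assumes "a \<in> U w" "x \<in> cosets w" shows "(\<lambda>m\<in>reduced w. cons_syl x a m) \<in> Bij (reduced w)"
  by (rule BijI[where g = "cons_syl x (inv a)"])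
     (use assms U_carrier[OF w] U_inv[OF w] in \<open>auto simp: cons_syl_reduced cons_syl_mult cons_syl_one\<close>)

text \<open>The van der Waerden trick. Reduced words are the vertices of the Bass--Serre tree of the
  splitting of \<open>G\<close> as the amalgam of \<open>gspan (V - {w})\<close> and \<open>gspan (st w)\<close> over \<open>gspan (lk w)\<close>:
  the kernel of \<open>retr (V - {w})\<close> is the free product of the conjugates of \<open>U w\<close> indexed by
  \<open>cosets w\<close>.\<close>

definition word_perm :: "'v \<Rightarrow> 'g \<Rightarrow> ('g set \<times> 'g) list \<Rightarrow> ('g set \<times> 'g) list" where
  "word_perm v a = (\<lambda>m\<in>reduced w. if v = w then cons_syl (gspan (lk w)) a m else translate a m)"

lemma word_perm_lift:
  "\<exists>F\<in>hom G (BijGroup (reduced w)). \<forall>v\<in>V. \<forall>a\<in>U v. F a = word_perm v a"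
proof (rule lift_perm)
  have Usp: "a \<in> gspan (V - {w})" if "v \<in> V" "v \<noteq> w" "a \<in> U v" for v a
    using that by (intro U_span) auto
  have B: "word_perm v a \<in> Bij (reduced w)" if "v \<in> V" "a \<in> U v" for v a
    using that Usp[of v a] Bij_translate[of a] Bij_cons_syl[of a] base_coset
    by (cases "v = w") (simp_all add: word_perm_def)
  have comp: "word_perm v a \<otimes>\<^bsub>BijGroup (reduced w)\<^esub> word_perm u b =
      (\<lambda>m\<in>reduced w. word_perm v a (word_perm u b m))" if "v \<in> V" "a \<in> U v" "u \<in> V" "b \<in> U u" for v a u b
    using that B by (simp add: BijGroup_def compose_def)
  have red: "word_perm v a m \<in> reduced w" if "v \<in> V" "a \<in> U v" "m \<in> reduced w" for v a m
    using Bij_imp_funcset[OF B[of v a]] that by auto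
  show "word_perm v \<in> hom (G\<lparr>carrier := U v\<rparr>) (BijGroup (reduced w))" if v: "v \<in> V" for v
  proof (rule homI)
    fix a assume "a \<in> carrier (G\<lparr>carrier := U v\<rparr>)"
    then show "word_perm v a \<in> carrier (BijGroup (reduced w))"
      using v B by (simp add: BijGroup_def)
  next
    fix a b assume "a \<in> carrier (G\<lparr>carrier := U v\<rparr>)" "b \<in> carrier (G\<lparr>carrier := U v\<rparr>)"
    then have ab: "a \<in> U v" "b \<in> U v" by auto
    show "word_perm v (a \<otimes>\<^bsub>G\<lparr>carrier := U v\<rparr>\<^esub> b) = word_perm v a \<otimes>\<^bsub>BijGroup (reduced w)\<^esub> word_perm v b"
    proof
      fix m
      show "word_perm v (a \<otimes>\<^bsub>G\<lparr>carrier := U v\<rparr>\<^esub> b) m = (word_perm v a \<otimes>\<^bsub>BijGroup (reduced w)\<^esub> word_perm v b) m"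
        unfolding comp[OF v ab(1) v ab(2)]
        using v ab red[OF v ab(2), of m] U_carrier[OF v] Usp[of v]
        by (auto simp: word_perm_def cons_syl_mult translate_mult)
    qed
  qed
  \<comment> \<open>This is the relation for an edge at \<open>w\<close>: the group of the other
    vertex lies in \<open>gspan (lk w)\<close> and so fixes the base coset.\<close>
  have fix_base: "cons_syl (gspan (lk w)) a (translate b m) = translate b (cons_syl (gspan (lk w)) a m)"
    if "v \<in> lk w" "b \<in> U v" "m \<in> reduced w" for v a b m
  proof -
    have v: "v \<in> V" using that lk_subset by auto
    have "b \<in> gspan (lk w)" using U_span[of v "lk w" b] that v by simp
    then have "b <# gspan (lk w) = gspan (lk w)"
      using base_coset_fixed_iff[of b] U_carrier[OF v] that by simp
    then show ?thesis
      using cons_syl_translate[OF that(3) base_coset, of b a] U_carrier[OF v that(2)] by simp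
  qed
  show "word_perm v a \<otimes>\<^bsub>BijGroup (reduced w)\<^esub> word_perm u b = word_perm u b \<otimes>\<^bsub>BijGroup (reduced w)\<^esub> word_perm v a"
    if h: "v \<in> V" "u \<in> V" "{v, u} \<in> E" "a \<in> U v" "b \<in> U u" for v u a b
  proof
    fix m
    have lks: "v = w \<Longrightarrow> u \<in> lk w" "u = w \<Longrightarrow> v \<in> lk w" using h by (auto simp: lk_def insert_commute)
    have "v \<noteq> u" using h no_loops[of v] by auto
    show "(word_perm v a \<otimes>\<^bsub>BijGroup (reduced w)\<^esub> word_perm u b) m = (word_perm u b \<otimes>\<^bsub>BijGroup (reduced w)\<^esub> word_perm v a) m"
      unfolding comp[OF h(1,4,2,5)] comp[OF h(2,5,1,4)]
      using h red[OF h(1,4), of m] red[OF h(2,5), of m] fix_base[OF lks(1)] fix_base[OF lks(2)] \<open>v \<noteq> u\<close>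
        U_adjacent[OF h] U_carrier[OF h(1,4)] U_carrier[OF h(2,5)]
      by (auto simp: word_perm_def translate_mult)
  qed
qed

end

definition act :: "'v \<Rightarrow> 'g \<Rightarrow> ('g set \<times> 'g) list \<Rightarrow> ('g set \<times> 'g) list" where
  "act w = (SOME F. F \<in> hom G (BijGroup (reduced w)) \<and> (\<forall>v\<in>V. \<forall>a\<in>U v. F a = word_perm w v a))"

context
  fixes w assumes w: "w \<in> V"
begin

lemma act: "act w \<in> hom G (BijGroup (reduced w))" "v \<in> V \<Longrightarrow> a \<in> U v \<Longrightarrow> act w a = word_perm w v a"
proof -
  have "\<exists>F. F \<in> hom G (BijGroup (reduced w)) \<and> (\<forall>v\<in>V. \<forall>a\<in>U v. F a = word_perm w v a)"
    using word_perm_lift[OF w] by blast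
  from someI_ex[OF this] show "act w \<in> hom G (BijGroup (reduced w))"
    "v \<in> V \<Longrightarrow> a \<in> U v \<Longrightarrow> act w a = word_perm w v a"
    by (auto simp: act_def)
qed

lemma act_Bij: "g \<in> carrier G \<Longrightarrow> act w g \<in> Bij (reduced w)"
  using act(1) by (auto simp: hom_def BijGroup_def)

lemma act_reduced: "g \<in> carrier G \<Longrightarrow> m \<in> reduced w \<Longrightarrow> act w g m \<in> reduced w"
  using Bij_imp_funcset[OF act_Bij] by auto

lemma act_mult:
  assumes "g \<in> carrier G" "h \<in> carrier G" "m \<in> reduced w"
  shows "act w (g \<otimes> h) m = act w g (act w h m)"
  using act(1) act_Bij assms by (simp add: hom_def BijGroup_def compose_def)

lemma act_one: "m \<in> reduced w \<Longrightarrow> act w \<one> m = m"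
  using group_hom.hom_one[of G "BijGroup (reduced w)" "act w"] act(1)
  by (simp add: group_hom_def group_hom_axioms_def is_group group_BijGroup) (simp add: BijGroup_def)

lemma act_U: "a \<in> U w \<Longrightarrow> m \<in> reduced w \<Longrightarrow> act w a m = cons_syl (gspan (lk w)) a m"
  using act(2)[OF w, of a] by (simp add: word_perm_def[OF w])

lemma act_inv: "g \<in> carrier G \<Longrightarrow> m \<in> reduced w \<Longrightarrow> act w (inv g) (act w g m) = m"
  "g \<in> carrier G \<Longrightarrow> m \<in> reduced w \<Longrightarrow> act w g (act w (inv g) m) = m"
  by (simp_all add: act_mult[symmetric] act_one)

lemma act_eq_iff:
  "g \<in> carrier G \<Longrightarrow> m \<in> reduced w \<Longrightarrow> n \<in> reduced w \<Longrightarrow> act w g m = act w g n \<longleftrightarrow> m = n"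
  by (metis act_inv(1))

lemma act_translate:
  assumes "s \<in> gspan (V - {w})" "m \<in> reduced w" shows "act w s m = translate s m"
  using assms unfolding gspan_def
proof (induction arbitrary: m rule: generate.induct)
  case one
  then show ?case by (simp add: act_one translate_one[OF w])
next
  case (incl h)
  then obtain v where v: "v \<in> V" "v \<noteq> w" "h \<in> U v" by auto
  then show ?case using incl by (simp add: act(2) word_perm_def[OF w])
next
  case (inv h)
  then obtain v where v: "v \<in> V" "v \<noteq> w" "h \<in> U v" by auto
  then show ?case using inv U_inv[of v h] by (simp add: act(2) word_perm_def[OF w])
next
  case (eng g h)
  have gh: "g \<in> gspan (V - {w})" "h \<in> gspan (V - {w})" using eng by (auto simp: gspan_def)
  show ?case
    using eng gspan_carrier[OF gh(1)] gspan_carrier[OF gh(2)] reduced_translate[OF w gh(2)]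
    by (simp add: act_mult translate_mult[OF w])
qed

end

end

section \<open>Evaluation of reduced words, normal forms and cancellation\<close>

context graph_product_group
begin

definition coset_rep :: "'v \<Rightarrow> 'g set \<Rightarrow> 'g" where
  "coset_rep w x = (SOME h. h \<in> gspan (V - {w}) \<and> x = h <# gspan (lk w))"
definition syl :: "'v \<Rightarrow> 'g set \<times> 'g \<Rightarrow> 'g" where
  "syl w = (\<lambda>(x, a). coset_rep w x \<otimes> a \<otimes> inv (coset_rep w x))"
definition ev :: "'v \<Rightarrow> ('g set \<times> 'g) list \<Rightarrow> 'g" where
  "ev w m = foldr (\<lambda>c g. syl w c \<otimes> g) m \<one>"
text \<open>\<open>G\<close> is the semidirect product of the kernel of
  \<open>retr (V - {w})\<close> with \<open>gspan (V - {w})\<close>. This is the second factor of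
  \<open>g\<close>; the first is the value of the word \<open>act w g []\<close>.\<close>

definition tail :: "'v \<Rightarrow> 'g \<Rightarrow> 'g" where
  "tail w g = inv (ev w (act w g [])) \<otimes> g"

lemma ev_simps [simp]: "ev w [] = \<one>" "ev w (c # m) = syl w c \<otimes> ev w m"
  by (simp_all add: ev_def)

context
  fixes w assumes w: "w \<in> V"
begin

lemma coset_rep: "x \<in> cosets w \<Longrightarrow> coset_rep w x \<in> gspan (V - {w})" "x \<in> cosets w \<Longrightarrow> x = coset_rep w x <# gspan (lk w)"
proof -
  assume "x \<in> cosets w"
  then have "\<exists>h. h \<in> gspan (V - {w}) \<and> x = h <# gspan (lk w)" by (auto simp: cosets_def)
  from someI_ex[OF this] show "coset_rep w x \<in> gspan (V - {w})" "x = coset_rep w x <# gspan (lk w)"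
    by (auto simp: coset_rep_def)
qed

lemma coset_rep_carrier: "x \<in> cosets w \<Longrightarrow> coset_rep w x \<in> carrier G"
  using coset_rep gspan_carrier by blast

text \<open>Two representatives of a coset differ by an element of \<open>gspan (lk w)\<close>,
  which commutes with \<open>a\<close>, so the chosen \<open>coset_rep\<close> may be replaced by
  any other.\<close>

lemma syl_eq:
  assumes h: "h \<in> gspan (V - {w})" and a: "a \<in> U w"
  shows "syl w (h <# gspan (lk w), a) = h \<otimes> a \<otimes> inv h"
proof -
  let ?x = "h <# gspan (lk w)" and ?k = "coset_rep w (h <# gspan (lk w))"
  have x: "?x \<in> cosets w" using h by (auto simp: cosets_def)
  have k: "?k \<in> carrier G" and hc: "h \<in> carrier G" and ac: "a \<in> carrier G"
    using coset_rep_carrier[OF x] gspan_carrier[OF h] U_carrier[OF w a] by auto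
  define l where "l = inv h \<otimes> ?k"
  have lc: "l \<in> carrier G" using k hc by (simp add: l_def)
  have "l <# gspan (lk w) = inv h <# (?k <# gspan (lk w))"
    using k hc by (simp add: l_def coset_mult[OF w] base_coset[OF w])
  also have "\<dots> = gspan (lk w)"
    using coset_rep(2)[OF x] hc by (simp add: coset_mult[OF w] coset_one[OF w] base_coset[OF w])
  finally have l: "l \<in> gspan (lk w)" using lc by (simp add: base_coset_fixed_iff[OF w])
  have "?k = h \<otimes> l" using k hc by (simp add: l_def mult_inv_cancel)
  then have "syl w (?x, a) = h \<otimes> (l \<otimes> a) \<otimes> inv l \<otimes> inv h"
    using hc lc ac by (simp add: syl_def inv_mult_group m_assoc)
  also have "\<dots> = h \<otimes> a \<otimes> inv h"
    unfolding U_span_lk[OF w a l, symmetric] using hc lc ac by (simp add: m_assoc mult_inv_cancel)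
  finally show ?thesis .
qed

lemma syl_base: "a \<in> U w \<Longrightarrow> syl w (gspan (lk w), a) = a"
  using syl_eq[of \<one> a] U_carrier[OF w] by (simp add: coset_one[OF w] base_coset[OF w])

lemma syl_carrier: "x \<in> cosets w \<Longrightarrow> a \<in> U w \<Longrightarrow> syl w (x, a) \<in> carrier G"
  using coset_rep_carrier U_carrier[OF w] by (simp add: syl_def)

lemma syl_mult:
  "x \<in> cosets w \<Longrightarrow> a \<in> U w \<Longrightarrow> b \<in> U w \<Longrightarrow> syl w (x, a) \<otimes> syl w (x, b) = syl w (x, a \<otimes> b)"
  using coset_rep_carrier U_carrier[OF w] by (simp add: syl_def m_assoc mult_inv_cancel)

lemma syl_one: "x \<in> cosets w \<Longrightarrow> syl w (x, \<one>) = \<one>"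
  using coset_rep_carrier by (simp add: syl_def)

lemma syl_translate:
  assumes s: "s \<in> gspan (V - {w})" and x: "x \<in> cosets w" and a: "a \<in> U w"
  shows "syl w (s <# x, a) = s \<otimes> syl w (x, a) \<otimes> inv s"
proof -
  obtain h where h: "h \<in> gspan (V - {w})" "x = h <# gspan (lk w)" using x by (auto simp: cosets_def)
  have "s <# x = (s \<otimes> h) <# gspan (lk w)"
    using h s by (simp add: coset_mult[OF w] base_coset[OF w] gspan_carrier)
  then show ?thesis
    using h s a gspan_mult[OF s h(1)] gspan_carrier[OF s] gspan_carrier[OF h(1)] U_carrier[OF w a]
    by (simp add: syl_eq inv_mult_group m_assoc)
qed

lemma ev_carrier: "m \<in> reduced w \<Longrightarrow> ev w m \<in> carrier G"
  by (induction m) (auto simp: reduced_Cons syl_carrier)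

lemma ev_append: "m @ n \<in> reduced w \<Longrightarrow> ev w (m @ n) = ev w m \<otimes> ev w n"
  by (induction m) (auto simp: reduced_Cons reduced_append syl_carrier ev_carrier m_assoc)

lemma ev_translate:
  assumes s: "s \<in> gspan (V - {w})"
  shows "m \<in> reduced w \<Longrightarrow> ev w (translate s m) = s \<otimes> ev w m \<otimes> inv s"
  using gspan_carrier[OF s]
  by (induction m) (auto simp: reduced_Cons syl_translate[OF s] syl_carrier ev_carrier m_assoc mult_inv_cancel)

lemma ev_cons_syl:
  assumes m: "m \<in> reduced w" and x: "x \<in> cosets w" and a: "a \<in> U w"
  shows "ev w (cons_syl x a m) = syl w (x, a) \<otimes> ev w m"
proof -
  have strip: "syl w (x, hd_coeff x m) \<otimes> ev w (strip x m) = ev w m"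
    using m x by (cases m) (auto simp: hd_coeff_def strip_def reduced_Cons syl_one ev_carrier syl_carrier)
  have c: "hd_coeff x m \<in> U w" "ev w (strip x m) \<in> carrier G"
    using hd_coeff_U[OF w m] strip_reduced[OF w m] ev_carrier by auto
  have "ev w (cons_syl x a m) = syl w (x, a \<otimes> hd_coeff x m) \<otimes> ev w (strip x m)"
    using c x by (simp add: cons_syl_def syl_one)
  also have "\<dots> = syl w (x, a) \<otimes> (syl w (x, hd_coeff x m) \<otimes> ev w (strip x m))"
    using c x a by (simp add: syl_carrier m_assoc flip: syl_mult)
  finally show ?thesis by (simp add: strip)
qed

text \<open>The action of \<open>U w\<close> is prescribed at the base coset only. Conjugating by a
  coset representative transports it to every other factor.\<close>

lemma act_syl:
  assumes x: "x \<in> cosets w" and a: "a \<in> U w" and m: "m \<in> reduced w"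
  shows "act w (syl w (x, a)) m = cons_syl x a m"
proof -
  let ?h = "coset_rep w x" and ?L = "gspan (lk w)"
  have h: "?h \<in> gspan (V - {w})" "inv ?h \<in> gspan (V - {w})" "?h \<in> carrier G" "a \<in> carrier G"
    using coset_rep(1)[OF x] gspan_inv gspan_carrier U_carrier[OF w a] by auto
  have m': "translate (inv ?h) m \<in> reduced w" by (rule reduced_translate[OF w h(2) m])
  have c: "cons_syl ?L a (translate (inv ?h) m) \<in> reduced w"
    by (rule cons_syl_reduced[OF w m' base_coset[OF w] a])
  have "act w (syl w (x, a)) m = translate ?h (cons_syl ?L a (translate (inv ?h) m))"
    using h m m' a c by (simp add: syl_def act_mult[OF w] act_translate[OF w] act_U[OF w] act_reduced[OF w])
  also have "\<dots> = cons_syl (?h <# ?L) a (translate ?h (translate (inv ?h) m))"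
    by (rule cons_syl_translate[OF w m' base_coset[OF w] h(3), symmetric])
  also have "\<dots> = cons_syl x a m"
    using h m by (simp add: translate_mult[OF w] translate_one[OF w] flip: coset_rep(2)[OF x])
  finally show ?thesis .
qed

lemma act_ev_append: "m @ n \<in> reduced w \<Longrightarrow> act w (ev w m) n = m @ n"
proof (induction m)
  case Nil
  then show ?case by (simp add: act_one[OF w])
next
  case (Cons c m)
  obtain x a where c: "c = (x, a)" by force
  have "n \<in> reduced w" "m \<in> reduced w" "m @ n \<in> reduced w" "x \<in> cosets w" "a \<in> U w" "a \<noteq> \<one>"
    using Cons.prems c by (auto simp: reduced_Cons reduced_append)
  then show ?case
    using Cons c
    by (simp add: act_mult[OF w] syl_carrier ev_carrier act_syl reduced_Cons cons_syl_fresh[OF w])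
qed

lemma act_ev_Nil: "m \<in> reduced w \<Longrightarrow> act w (ev w m) [] = m"
  using act_ev_append[of m "[]"] by simp

text \<open>The set \<open>K\<close> of these products is stable under left multiplication by every
  vertex group: a letter of \<open>U w\<close> is prepended to the word, any other letter passes
  through the word and translates it.\<close>

lemma normal_form:
  assumes "g \<in> carrier G"
  obtains m s where "m \<in> reduced w" "s \<in> gspan (V - {w})" "g = ev w m \<otimes> s"
proof -
  define K where "K = {ev w m \<otimes> s | m s. m \<in> reduced w \<and> s \<in> gspan (V - {w})}"
  have Kc: "K \<subseteq> carrier G" by (auto simp: K_def ev_carrier gspan_carrier)
  have gen: "a \<otimes> k \<in> K" if "v \<in> V" "a \<in> U v" "k \<in> K" for v a k
  proof -
    obtain m s where k: "k = ev w m \<otimes> s" "m \<in> reduced w" "s \<in> gspan (V - {w})"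
      using \<open>k \<in> K\<close> unfolding K_def by blast
    have ac: "a \<in> carrier G" using that U_carrier by blast
    show ?thesis
    proof (cases "v = w")
      case True
      then have "a \<otimes> k = ev w (cons_syl (gspan (lk w)) a m) \<otimes> s"
        using that k ac
        by (simp add: ev_cons_syl base_coset[OF w] syl_base ev_carrier gspan_carrier m_assoc)
      then show ?thesis using True that k cons_syl_reduced[OF w _ base_coset[OF w]] by (auto simp: K_def)
    next
      case False
      then have a: "a \<in> gspan (V - {w})" using that by (intro U_span) auto
      then have "a \<otimes> k = ev w (translate a m) \<otimes> (a \<otimes> s)"
        using k ac by (simp add: ev_translate ev_carrier gspan_carrier m_assoc mult_inv_cancel)
      then show ?thesis
        using k(2,3) gspan_mult[OF a k(3)] reduced_translate[OF w a k(2)] unfolding K_def by blast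
    qed
  qed
  have "g \<otimes> k \<in> K" if "k \<in> K" for k
    using assms that unfolding U_generate
  proof (induction arbitrary: k rule: generate.induct)
    case one
    then show ?case using Kc by auto
  next
    case (inv h)
    then show ?case using gen U_inv by blast
  next
    case (eng h1 h2)
    have "h1 \<in> carrier G" "h2 \<in> carrier G" using eng by (auto simp: U_generate)
    then show ?case using eng Kc by (auto simp: m_assoc)
  qed (use gen in blast)
  moreover have "\<one> \<in> K"
    unfolding K_def by (rule CollectI, rule exI[of _ "[]"], rule exI[of _ \<one>]) auto
  ultimately have "g \<in> K" using assms by fastforce
  then show thesis using that by (auto simp: K_def)
qed

lemma act_Nil_reduced: "g \<in> carrier G \<Longrightarrow> act w g [] \<in> reduced w"
  by (rule act_reduced[OF w]) auto

lemma tail: "g \<in> carrier G \<Longrightarrow> tail w g \<in> gspan (V - {w})"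
  "g \<in> carrier G \<Longrightarrow> g = ev w (act w g []) \<otimes> tail w g"
proof -
  assume g: "g \<in> carrier G"
  from normal_form[OF g] obtain m s where h: "m \<in> reduced w" "s \<in> gspan (V - {w})" "g = ev w m \<otimes> s" .
  have "act w g [] = m"
    using h by (simp add: act_mult[OF w] ev_carrier gspan_carrier act_translate[OF w] act_ev_Nil)
  then show "tail w g \<in> gspan (V - {w})" "g = ev w (act w g []) \<otimes> tail w g"
    using h g by (auto simp: tail_def ev_carrier gspan_carrier mult_inv_cancel)
qed

text \<open>How an arbitrary element acts: its tail permutes the factors, then its own word is
  multiplied on from the left.\<close>

lemma act_eq: "g \<in> carrier G \<Longrightarrow> n \<in> reduced w \<Longrightarrow> act w g n = act w (ev w (act w g [])) (translate (tail w g) n)"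
  by (subst tail(2), assumption)
     (simp add: act_mult[OF w] act_Nil_reduced ev_carrier gspan_carrier[OF tail(1)] act_translate[OF w tail(1)])

lemma act_Nil_eq_Nil: "g \<in> carrier G \<Longrightarrow> act w g [] = [] \<Longrightarrow> g \<in> gspan (V - {w})"
  using tail[of g] by (simp add: gspan_carrier)

text \<open>Each syllable of \<open>m\<close> changes the length by at most one.\<close>

lemma length_act_ev:
  assumes "m \<in> reduced w" "n \<in> reduced w"
  shows "length (act w (ev w m) n) \<le> length m + length n" "length n \<le> length m + length (act w (ev w m) n)"
proof -
  have "length (act w (ev w m) n) \<le> length m + length n \<and> length n \<le> length m + length (act w (ev w m) n)"
    using assms
  proof (induction m)
    case Nil
    then show ?case by (simp add: act_one[OF w])
  next
    case (Cons c m)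
    obtain x a where c: "c = (x, a)" by force
    have *: "m \<in> reduced w" "x \<in> cosets w" "a \<in> U w"
      using Cons.prems c by (auto simp: reduced_Cons)
    have "act w (ev w (c # m)) n = cons_syl x a (act w (ev w m) n)"
      using * Cons.prems c by (simp add: act_mult[OF w] syl_carrier ev_carrier act_syl act_reduced[OF w])
    then show ?case
      using Cons.IH[OF *(1) Cons.prems(2)] length_cons_syl[OF w, where m = "act w (ev w m) n" and x = x and a = a] by simp
  qed
  then show "length (act w (ev w m) n) \<le> length m + length n"
    "length n \<le> length m + length (act w (ev w m) n)" by auto
qed

lemma act_ev_snoc:
  assumes "m @ [(x, a)] \<in> reduced w" "(x, b) # n \<in> reduced w"
  shows "act w (ev w (m @ [(x, a)])) ((x, b) # n) = act w (ev w m) (if a \<otimes> b = \<one> then n else (x, a \<otimes> b) # n)"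
proof -
  have *: "m \<in> reduced w" "x \<in> cosets w" "a \<in> U w" using assms by (auto simp: reduced_append reduced_Cons)
  have "act w (ev w (m @ [(x, a)])) ((x, b) # n) = act w (ev w m) (act w (syl w (x, a)) ((x, b) # n))"
    using * assms by (simp add: ev_append syl_carrier ev_carrier act_mult[OF w])
  also have "act w (syl w (x, a)) ((x, b) # n) = cons_syl x a ((x, b) # n)"
    by (rule act_syl[OF *(2,3) assms(2)])
  also have "\<dots> = (if a \<otimes> b = \<one> then n else (x, a \<otimes> b) # n)"
    by (simp add: cons_syl_def hd_coeff_def strip_def)
  finally show ?thesis .
qed

lemma reduced_snocE:
  assumes "m \<noteq> []" "m \<in> reduced w"
  obtains m0 a where "m = m0 @ [(fst (last m), a)]" "a \<in> U w" "m0 \<in> reduced w"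
  using assms by (cases m rule: rev_cases) (auto simp: reduced_append reduced_Cons)

lemma reduced_consE:
  assumes "m \<noteq> []" "m \<in> reduced w"
  obtains m0 a where "m = (fst (hd m), a) # m0" "a \<in> U w" "m0 \<in> reduced w"
  using assms by (cases m) (auto simp: reduced_Cons)

lemma reduced_merge:
  assumes "(x, b) # n \<in> reduced w" "a \<in> U w"
  shows "(if a \<otimes> b = \<one> then n else (x, a \<otimes> b) # n) \<in> reduced w"
  using assms by (auto simp: reduced_Cons U_mult[OF w])

lemma length_act_ev_less:
  assumes m: "m \<in> reduced w" "m \<noteq> []" and n: "n \<in> reduced w" "n \<noteq> []"
    and eq: "fst (last m) = fst (hd n)"
  shows "length (act w (ev w m) n) < length m + length n"
proof -
  obtain m0 a where m0: "m = m0 @ [(fst (last m), a)]" "a \<in> U w" "m0 \<in> reduced w" by (rule reduced_snocE[OF m(2,1)])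
  obtain n0 b where n0: "n = (fst (hd n), b) # n0" "b \<in> U w" "n0 \<in> reduced w" by (rule reduced_consE[OF n(2,1)])
  let ?x = "fst (hd n)"
  have e: "m = m0 @ [(?x, a)]" using m0 eq by simp
  have "act w (ev w m) n = act w (ev w m0) (if a \<otimes> b = \<one> then n0 else (?x, a \<otimes> b) # n0)"
    using act_ev_snoc[of m0 ?x a b n0] m n e n0 by metis
  then have "length (act w (ev w m) n) \<le> length m0 + Suc (length n0)"
    using length_act_ev(1)[OF m0(3) reduced_merge[of ?x b n0 a]] n n0 m0 by (auto split: if_splits)
  moreover have "length m = Suc (length m0)" "length n = Suc (length n0)"
    using arg_cong[OF m0(1), of length] arg_cong[OF n0(1), of length] by auto
  ultimately show ?thesis by simp
qed

text \<open>Used through lengths: if the result is as long as \<open>m\<close> and \<open>n\<close>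
  together, no syllables were merged and it is the concatenation.\<close>

lemma act_ev_cases:
  assumes "m \<in> reduced w" "n \<in> reduced w"
  shows "act w (ev w m) n = m @ n \<or> length (act w (ev w m) n) < length m + length n"
  using assms length_act_ev_less[of m n] act_ev_append[of m n] by (auto simp: reduced_append)

text \<open>Cancellation caused by \<open>m\<close> reaches at most \<open>length m\<close>
  syllables deep, so it stays inside \<open>n\<close> and leaves \<open>k\<close> alone.\<close>

lemma act_ev_append_right:
  assumes "m \<in> reduced w" "n @ k \<in> reduced w" "length m \<le> length n"
  shows "act w (ev w m) (n @ k) = act w (ev w m) n @ k"
  using assms
proof (induction m)
  case Nil
  then show ?case by (simp add: act_one[OF w] reduced_append)
next
  case (Cons c m)
  obtain x a where c: "c = (x, a)" by force
  have *: "m \<in> reduced w" "x \<in> cosets w" "a \<in> U w" "n \<in> reduced w"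
    using Cons.prems c by (auto simp: reduced_Cons reduced_append)
  have e: "act w (ev w (c # m)) q = cons_syl x a (act w (ev w m) q)" if "q \<in> reduced w" for q
    using * c that by (simp add: act_mult[OF w] syl_carrier ev_carrier act_syl act_reduced[OF w])
  \<comment> \<open>The syllable \<open>c\<close> is still to be applied, so \<open>m\<close> is
    strictly shorter than \<open>n\<close> and cannot have used it up. On a nonempty word
    \<open>cons_syl\<close> does not see what is appended.\<close>
  have "act w (ev w m) n \<noteq> []"
    using length_act_ev(2)[OF *(1,4)] Cons.prems(3) by auto
  then show ?case
    using Cons * e[OF Cons.prems(2)] e[OF *(4)] by (simp del: ev_simps add: cons_syl_append[OF w])
qed

text \<open>Dual to \<open>act_ev_append_right\<close>: each syllable of \<open>n\<close> removes or
  alters at most one syllable at the end of \<open>m\<close>. If \<open>n\<close> is the longer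
  word, the truncated difference is zero and nothing is claimed.\<close>

lemma take_act_ev:
  assumes "m \<in> reduced w" "n \<in> reduced w"
  shows "take (length m - length n) (act w (ev w m) n) = take (length m - length n) m"
  using assms
proof (induction n arbitrary: m)
  case Nil
  then show ?case by (simp add: act_ev_Nil)
next
  case (Cons c n)
  show ?case
  proof (cases "m = [] \<or> fst (last m) \<noteq> fst c")
    case True
    then have "m @ c # n \<in> reduced w" using Cons.prems by (auto simp: reduced_append)
    then show ?thesis by (simp add: act_ev_append)
  next
    case False
    obtain x b where c: "c = (x, b)" by force
    obtain m0 a where m0: "m = m0 @ [(x, a)]" "a \<in> U w" "m0 \<in> reduced w"
      using reduced_snocE[of m] False Cons.prems(1) c by auto
    have n: "n \<in> reduced w" using Cons.prems c by (auto simp: reduced_Cons)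
    have e: "act w (ev w m) (c # n) = act w (ev w m0) (if a \<otimes> b = \<one> then n else (x, a \<otimes> b) # n)"
      using act_ev_snoc[of m0 x a b n] Cons.prems c m0 by simp
    show ?thesis
    proof (cases "a \<otimes> b = \<one>")
      case True
      then show ?thesis using Cons.IH[OF m0(3) n] m0(1) e by simp
    next
      case False
      have "m0 @ (x, a \<otimes> b) # n \<in> reduced w"
        using False m0 reduced_merge[of x b n a] Cons.prems c by (auto simp: reduced_append reduced_Cons)
      then have "act w (ev w m0) ((x, a \<otimes> b) # n) = m0 @ (x, a \<otimes> b) # n" by (rule act_ev_append)
      then show ?thesis using False m0(1) e by simp
    qed
  qed
qed

end

end

section \<open>Centralizers\<close>

context graph_product_group
begin

context
  fixes w assumes w: "w \<in> V"
begin

lemma base_coset_moved: "s \<in> carrier G \<Longrightarrow> s <# gspan (lk w) = gspan (lk w) \<Longrightarrow> s \<in> gspan (lk w)"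
  by (simp add: base_coset_fixed_iff[OF w])

lemma gspan_lk_subset: "x \<in> gspan (lk w) \<Longrightarrow> x \<in> gspan (V - {w})"
  using gspan_mono[of "lk w" "V - {w}"] not_in_lk[of w] lk_subset[of w] by blast

text \<open>Dividing \<open>c\<close> by its leading coefficient \<open>b\<close> at the base coset
  gives an element \<open>d\<close> whose word \<open>m\<close> does not start there. On such words
  \<open>a \<otimes> l\<close> prepends a syllable at the base coset, whereas \<open>d\<close> puts
  \<open>m\<close> in front of a syllable. Commuting makes the two results equal, which forces
  \<open>m = []\<close>, and then \<open>d\<close> lies in the stabilizer
  \<open>gspan (lk w)\<close> of the base coset.\<close>

lemma commute_star:
  assumes a: "a \<in> U w" "a \<noteq> \<one>" and l: "l \<in> gspan (lk w)" and c: "c \<in> carrier G"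
    and comm: "c \<otimes> (a \<otimes> l) = (a \<otimes> l) \<otimes> c"
  shows "c \<in> gspan (st w)"
proof -
  let ?L = "gspan (lk w)"
  define b where "b = hd_coeff ?L (act w c [])"
  define d where "d = inv b \<otimes> c"
  define m where "m = act w d []"
  define s where "s = tail w d"
  have b: "b \<in> U w" "b \<in> carrier G"
    using hd_coeff_U[OF w act_Nil_reduced[OF w c]] U_carrier[OF w] by (auto simp: b_def)
  have ac: "a \<in> carrier G" and lc: "l \<in> carrier G" using U_carrier[OF w] a gspan_carrier l by auto
  have dc: "d \<in> carrier G" using b c by (simp add: d_def)
  have m: "m \<in> reduced w" using act_Nil_reduced[OF w dc] by (simp add: m_def)
  have m_eq: "m = cons_syl ?L (inv b) (act w c [])"
    using b c by (simp add: m_def d_def act_mult[OF w] act_U[OF w] U_inv[OF w] act_Nil_reduced[OF w])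
  have "hd_coeff ?L m = \<one>"
    unfolding m_eq hd_coeff_cons_syl[OF w act_Nil_reduced[OF w c]] using b by (simp add: b_def)
  then have hd: "m = [] \<or> fst (hd m) \<noteq> ?L"
    using m by (cases m) (auto simp: hd_coeff_def reduced_Cons)
  have binv: "inv b \<otimes> (a \<otimes> l) = (a \<otimes> l) \<otimes> inv b"
  proof -
    have "inv b \<otimes> a = a \<otimes> inv b" "inv b \<otimes> l = l \<otimes> inv b"
      using U_abelian[OF w _ a(1)] U_span_lk[OF w _ l] U_inv[OF w b(1)] by auto
    then show ?thesis using ac lc b by (metis inv_closed m_assoc)
  qed
  have "d \<otimes> (a \<otimes> l) = inv b \<otimes> ((a \<otimes> l) \<otimes> c)"
    using b ac lc c comm by (simp add: d_def m_assoc)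
  also have "\<dots> = (inv b \<otimes> (a \<otimes> l)) \<otimes> c"
    using b ac lc c by (simp add: m_assoc)
  also have "\<dots> = (a \<otimes> l) \<otimes> d"
    unfolding binv using b ac lc c by (simp add: d_def m_assoc)
  finally have dcomm: "d \<otimes> (a \<otimes> l) = (a \<otimes> l) \<otimes> d" .
  have lH: "l \<in> gspan (V - {w})" by (rule gspan_lk_subset[OF l])
  have lfix: "l <# ?L = ?L" using l lc by (simp add: base_coset_fixed_iff[OF w])
  have act_x: "act w (a \<otimes> l) n = cons_syl ?L a (translate l n)" if "n \<in> reduced w" for n
    using that ac lc lH by (simp add: act_mult[OF w] act_translate[OF w] act_U[OF w a(1)] reduced_translate[OF w])
  have "m = [] \<or> fst (hd (translate l m)) \<noteq> ?L"
  proof (cases "m = []")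
    case False
    have "fst (hd m) \<in> cosets w" using m False by (cases m) (auto simp: reduced_Cons)
    then have "l <# fst (hd m) \<noteq> l <# ?L"
      using hd False coset_inj[OF w lc _ base_coset[OF w]] by blast
    then show ?thesis using False lfix by (simp add: fst_hd_translate)
  qed simp
  then have rhs: "act w (a \<otimes> l) m = (?L, a) # translate l m"
    using m a by (simp add: act_x cons_syl_fresh[OF w])
  have s: "s \<in> gspan (V - {w})" "s \<in> carrier G"
    using tail(1)[OF w dc] gspan_carrier by (auto simp: s_def)
  have La: "[(?L, a)] \<in> reduced w" using a base_coset[OF w] by (simp add: reduced_Cons)
  have "act w d [(?L, a)] = act w (ev w m) [(s <# ?L, a)]"
    using act_eq[OF w dc La] by (simp add: m_def s_def)
  moreover have "act w d [(?L, a)] = act w (a \<otimes> l) m"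
  proof -
    have "[(?L, a)] = act w (a \<otimes> l) []"
      using a by (simp add: act_x cons_syl_fresh[OF w])
    then have "act w d [(?L, a)] = act w (d \<otimes> (a \<otimes> l)) []"
      using dc ac lc by (simp add: act_mult[OF w])
    then show ?thesis using dc ac lc by (simp add: dcomm m_def act_mult[OF w])
  qed
  ultimately have e: "act w (ev w m) [(s <# ?L, a)] = (?L, a) # translate l m" using rhs by simp
  have sLa: "[(s <# ?L, a)] \<in> reduced w" using reduced_translate[OF w s(1) La] by simp
  \<comment> \<open>The right-hand side of \<open>e\<close> has length \<open>length m + 1\<close>,
    so the strict alternative in \<open>act_ev_cases\<close> is excluded.\<close>
  have app: "m @ [(s <# ?L, a)] = (?L, a) # translate l m"
    using act_ev_cases[OF w m sLa] e by simp
  with hd have m_Nil: "m = []" by (cases m) auto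
  then have "s <# ?L = ?L" using app by simp
  then have "s \<in> ?L" using s by (simp add: base_coset_fixed_iff[OF w])
  moreover have "d = s" using tail(2)[OF w dc] s m_Nil by (simp add: s_def m_def)
  ultimately have d: "d \<in> gspan (st w)" using gspan_mono[of "lk w" "st w"] by (auto simp: st_def)
  have "b \<in> gspan (st w)" using b w by (intro U_span) (auto simp: st_def)
  moreover have "c = b \<otimes> d" using b c by (simp add: d_def mult_inv_cancel)
  ultimately show ?thesis using d gspan_mult by simp
qed

text \<open>The commutators of \<open>a\<close> with the \<open>b i\<close> are translations along axes which meet only at the
  block of \<open>a\<close>, so an element commuting with all of them fixes that block pointwise.\<close>

lemma commute_commutators:
  assumes a: "a \<in> U w" "a \<noteq> \<one>" and B: "\<And>b. b \<in> B \<Longrightarrow> b \<in> gspan (V - {w})"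
    and B_lk: "\<And>b. b \<in> B \<Longrightarrow> b \<notin> gspan (lk w)"
    and B_diff: "\<And>b c. b \<in> B \<Longrightarrow> c \<in> B \<Longrightarrow> b \<noteq> c \<Longrightarrow> inv b \<otimes> c \<notin> gspan (lk w)"
    and card: "card B = 3"
    and y: "y \<in> carrier G"
    and comm: "\<And>b. b \<in> B \<Longrightarrow> y \<otimes> commutator G a b = commutator G a b \<otimes> y"
  shows "y \<in> gspan (lk w)"
proof -
  let ?L = "gspan (lk w)"
  define m where "m = act w y []"
  define s where "s = tail w y"
  have m: "m \<in> reduced w" using act_Nil_reduced[OF w y] by (simp add: m_def)
  have s: "s \<in> gspan (V - {w})" "s \<in> carrier G"
    using tail(1)[OF w y] gspan_carrier by (auto simp: s_def)
  have ac: "a \<in> carrier G" "inv a \<in> U w" "inv a \<noteq> \<one>"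
    using U_carrier[OF w] U_inv[OF w] a inv_eq_1_iff by auto
  define z where "z b = b <# ?L" for b
  have z: "z b \<in> cosets w" "z b \<noteq> ?L" if "b \<in> B" for b
    using B[OF that] B_lk[OF that] base_coset_moved gspan_carrier by (auto simp: z_def cosets_def)
  have z_inj: "z b \<noteq> z c" if "b \<in> B" "c \<in> B" "b \<noteq> c" for b c
  proof
    assume eq: "z b = z c"
    have bc: "b \<in> carrier G" "c \<in> carrier G" using that B gspan_carrier by auto
    have "(inv b \<otimes> c) <# ?L = inv b <# z c"
      using bc by (simp add: z_def coset_mult[OF w] base_coset[OF w])
    also have "\<dots> = ?L"
      unfolding eq[symmetric] using bc by (simp add: z_def coset_mult[OF w] coset_one[OF w] base_coset[OF w])
    finally show False using base_coset_moved[of "inv b \<otimes> c"] bc B_diff[OF that] by simp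
  qed
  have act_t: "act w (commutator G a b) n = cons_syl ?L a (cons_syl (z b) (inv a) n)"
    if "b \<in> B" "n \<in> reduced w" for b n
  proof -
    have b: "b \<in> gspan (V - {w})" "b \<in> carrier G" using that B gspan_carrier by auto
    have "commutator G a b = a \<otimes> syl w (z b, inv a)"
      using ac b by (simp add: commutator_def z_def syl_eq[OF w] m_assoc)
    then show ?thesis
      using that ac z[OF that(1)] a
      by (simp add: act_mult[OF w] syl_carrier[OF w] act_syl[OF w] cons_syl_reduced[OF w] act_U[OF w])
  qed
  have tc: "commutator G a b \<in> carrier G" if "b \<in> B" for b
    using ac B[OF that] gspan_carrier by (auto simp: commutator_def)
  have t_Nil: "act w (commutator G a b) [] = [(?L, a), (z b, inv a)]" if "b \<in> B" for b
    using that ac a z[OF that] by (simp add: act_t cons_syl_fresh[OF w])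
  \<comment> \<open>Both orders of multiplication are applied to the empty word. The results have
    length \<open>length m + 2\<close>, so again nothing was merged.\<close>
  have key: "m @ [(s <# ?L, a), (s <# z b, inv a)] = (?L, a) # (z b, inv a) # m"
    if b: "b \<in> B" and fresh: "m = [] \<or> fst (hd m) \<noteq> z b" for b
  proof -
    have r: "[(?L, a), (z b, inv a)] \<in> reduced w"
      using act_Nil_reduced[OF w tc[OF b]] t_Nil[OF b] by simp
    have "act w y [(?L, a), (z b, inv a)] = act w (ev w m) [(s <# ?L, a), (s <# z b, inv a)]"
      using act_eq[OF w y r] by (simp add: m_def s_def)
    moreover have "act w y [(?L, a), (z b, inv a)] = act w (commutator G a b) m"
    proof -
      have "act w y [(?L, a), (z b, inv a)] = act w (y \<otimes> commutator G a b) []"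
        using y tc[OF b] by (simp add: act_mult[OF w] t_Nil[OF b])
      then show ?thesis using y tc[OF b] comm[OF b] by (simp add: m_def act_mult[OF w])
    qed
    moreover have "act w (commutator G a b) m = (?L, a) # (z b, inv a) # m"
      using b m fresh ac a z(2)[OF b] by (simp add: act_t cons_syl_fresh[OF w])
    ultimately have e: "act w (ev w m) [(s <# ?L, a), (s <# z b, inv a)] = (?L, a) # (z b, inv a) # m"
      by simp
    have "[(s <# ?L, a), (s <# z b, inv a)] \<in> reduced w"
      using reduced_translate[OF w s(1) r] by simp
    from act_ev_cases[OF w m this] show ?thesis unfolding e by auto
  qed
  have "m = []"
  proof (rule ccontr)
    assume "m \<noteq> []"
    then obtain c m' where mc: "m = c # m'" by (cases m) auto
    \<comment> \<open>The first coset of \<open>m\<close> equals at most one of three distinct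
      cosets. For the two remaining elements \<open>key\<close> applies, and it prescribes
      \<open>z b\<close> and \<open>z b'\<close> as the second coset of what is essentially the same
      word.\<close>
    obtain b1 b2 b3 where "B = {b1, b2, b3}" "b1 \<noteq> b2" "b1 \<noteq> b3" "b2 \<noteq> b3"
      using card by (auto simp: card_3_iff)
    then obtain b b' where bb: "b \<in> B" "b' \<in> B" "b \<noteq> b'" "fst c \<noteq> z b" "fst c \<noteq> z b'"
      using z_inj[of b1 b2] z_inj[of b1 b3] z_inj[of b2 b3]
      by (cases "fst c = z b1"; cases "fst c = z b2") auto
    have second: "fst (((m' @ [(s <# ?L, a), (s <# z b, inv a)])) ! 0) = z b"
      "fst (((m' @ [(s <# ?L, a), (s <# z b', inv a)])) ! 0) = z b'"
      using key[of b] key[of b'] bb mc by auto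
    then have "z b = z b'" by (cases m') auto
    then show False using z_inj bb by blast
  qed
  moreover obtain b where "b \<in> B" using card by fastforce
  ultimately have "s <# ?L = ?L" using key[of b] by simp
  then have "s \<in> ?L" using s base_coset_moved by simp
  moreover have "y = s" using tail(2)[OF w y] s \<open>m = []\<close> by (simp add: s_def m_def)
  ultimately show ?thesis by simp
qed

end

end

section \<open>Conjugation and commuting elements\<close>

context group
begin

definition cj :: "'a \<Rightarrow> 'a \<Rightarrow> 'a" where "cj k x = k \<otimes> x \<otimes> inv k"

lemma cj_carrier [simp]: "k \<in> carrier G \<Longrightarrow> x \<in> carrier G \<Longrightarrow> cj k x \<in> carrier G"
  by (simp add: cj_def)

lemma cj_mult: "k \<in> carrier G \<Longrightarrow> x \<in> carrier G \<Longrightarrow> y \<in> carrier G \<Longrightarrow> cj k (x \<otimes> y) = cj k x \<otimes> cj k y"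
  by (simp add: cj_def m_assoc mult_inv_cancel)

lemma cj_inv: "k \<in> carrier G \<Longrightarrow> x \<in> carrier G \<Longrightarrow> cj k (inv x) = inv (cj k x)"
  by (simp add: cj_def inv_mult_group m_assoc)

lemma cj_cj: "k \<in> carrier G \<Longrightarrow> h \<in> carrier G \<Longrightarrow> x \<in> carrier G \<Longrightarrow> cj k (cj h x) = cj (k \<otimes> h) x"
  by (simp add: cj_def inv_mult_group m_assoc)

lemma cj_one [simp]: "x \<in> carrier G \<Longrightarrow> cj \<one> x = x" "k \<in> carrier G \<Longrightarrow> cj k \<one> = \<one>"
  by (simp_all add: cj_def)

lemma cj_cancel [simp]:
  "k \<in> carrier G \<Longrightarrow> x \<in> carrier G \<Longrightarrow> cj (inv k) (cj k x) = x"
  "k \<in> carrier G \<Longrightarrow> x \<in> carrier G \<Longrightarrow> cj k (cj (inv k) x) = x"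
  by (simp_all add: cj_cj)

lemma cj_inj: "k \<in> carrier G \<Longrightarrow> x \<in> carrier G \<Longrightarrow> y \<in> carrier G \<Longrightarrow> cj k x = cj k y \<longleftrightarrow> x = y"
  by (metis cj_cancel(1))

lemma cj_eq_iff_commute: "k \<in> carrier G \<Longrightarrow> x \<in> carrier G \<Longrightarrow> cj k x = x \<longleftrightarrow> k \<otimes> x = x \<otimes> k"
  by (metis cj_def inv_solve_right m_closed)

lemma cj_commutator:
  "k \<in> carrier G \<Longrightarrow> x \<in> carrier G \<Longrightarrow> y \<in> carrier G \<Longrightarrow>
    cj k (commutator G x y) = commutator G (cj k x) (cj k y)"
  by (simp add: commutator_def cj_mult cj_inv)

lemma commutator_carrier [simp]:
  "x \<in> carrier G \<Longrightarrow> y \<in> carrier G \<Longrightarrow> commutator G x y \<in> carrier G"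
  by (simp add: commutator_def)

lemma commute_inv:
  "x \<in> carrier G \<Longrightarrow> y \<in> carrier G \<Longrightarrow> x \<otimes> y = y \<otimes> x \<Longrightarrow> inv x \<otimes> y = y \<otimes> inv x"
  by (metis inv_closed inv_solve_left inv_solve_right m_assoc m_closed)

lemma commute_mult:
  "x \<in> carrier G \<Longrightarrow> y \<in> carrier G \<Longrightarrow> z \<in> carrier G \<Longrightarrow> x \<otimes> z = z \<otimes> x \<Longrightarrow> y \<otimes> z = z \<otimes> y
    \<Longrightarrow> (x \<otimes> y) \<otimes> z = z \<otimes> (x \<otimes> y)"
  by (metis m_assoc)

lemma commute_pow:
  "x \<in> carrier G \<Longrightarrow> y \<in> carrier G \<Longrightarrow> x \<otimes> y = y \<otimes> x \<Longrightarrow> (x [^] (j::nat)) \<otimes> y = y \<otimes> (x [^] j)"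
  by (induction j) (simp_all add: commute_mult)

end

section \<open>Axes of cyclically reduced elements\<close>

context graph_product_group
begin

context
  fixes w assumes w: "w \<in> V"
begin

text \<open>An element \<open>g\<close> whose word \<open>n = act w g []\<close> is cyclically reduced moves \<open>[]\<close> along the ray
  of prefixes of \<open>n g(n) g\<^sup>2(n) \<dots>\<close>. Whatever commutes with \<open>g\<close> eventually shifts this ray,
  so commutators fix it pointwise.\<close>

lemma commutators_fix_axis:
  assumes g: "g \<in> carrier G" and n: "act w g [] \<noteq> []"
    and cyc: "fst (last (act w g [])) \<noteq> tail w g <# fst (hd (act w g []))"
    and c: "c1 \<in> carrier G" "c1 \<otimes> g = g \<otimes> c1" "c2 \<in> carrier G" "c2 \<otimes> g = g \<otimes> c2"
  shows "act w (commutator G c1 c2) [] = []"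
    "act w (commutator G c1 c2) [hd (act w g [])] = [hd (act w g [])]"
proof -
  define n where "n = act w g []"
  define h where "h = tail w g"
  have nr: "n \<in> reduced w" using act_Nil_reduced[OF w g] by (simp add: n_def)
  have h: "h \<in> gspan (V - {w})" "h \<in> carrier G"
    using tail(1)[OF w g] gspan_carrier by (auto simp: h_def)
  have n0: "n \<noteq> []" and cyc': "fst (last n) \<noteq> h <# fst (hd n)" using n cyc by (auto simp: n_def h_def)
  define W where "W j = act w (g [^] (j::nat)) []" for j
  have Wr: "W j \<in> reduced w" for j using act_Nil_reduced[OF w] g by (simp add: W_def)
  have W0: "W 0 = []" by (simp add: W_def act_one[OF w])
  have W_act: "W (Suc j) = act w g (W j)" for j
    unfolding W_def nat_pow_Suc2[OF g] using g by (simp add: act_mult[OF w])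
  \<comment> \<open>By \<open>cyc'\<close> no merging takes place between \<open>n\<close> and the
    translate of a word that starts in the same coset as \<open>n\<close>.\<close>
  have act_g: "act w g p = n @ translate h p" if "p \<in> reduced w" "p \<noteq> [] \<Longrightarrow> fst (hd p) = fst (hd n)" for p
  proof -
    have "n @ translate h p \<in> reduced w"
      using nr reduced_translate[OF w h(1) that(1)] cyc' that(2) by (auto simp: reduced_append fst_hd_translate)
    then show ?thesis using act_eq[OF w g that(1)] by (simp add: act_ev_append[OF w] n_def h_def)
  qed
  have W_hd: "W j \<noteq> [] \<Longrightarrow> hd (W j) = hd n" and W_Suc: "W (Suc j) = n @ translate h (W j)" for j
  proof -
    show hd: "W j \<noteq> [] \<Longrightarrow> hd (W j) = hd n" for j
    proof (induction j)
      case (Suc j)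
      then have "W (Suc j) = n @ translate h (W j)"
        unfolding W_act by (intro act_g[OF Wr]) simp
      then show ?case using n0 by simp
    qed (simp add: W0)
    show "W (Suc j) = n @ translate h (W j)"
      unfolding W_act by (rule act_g[OF Wr]) (simp add: hd)
  qed
  have prefix_translate: "prefix (translate h p) (translate h q)" if "prefix p q" for p q
    using that by (auto simp: prefix_def)
  have W_mono1: "prefix (W j) (W (Suc j))" for j
  proof (induction j)
    case (Suc j)
    then show ?case using prefix_translate by (subst (1 2) W_Suc) simp
  qed (simp add: W0)
  have W_mono: "prefix (W i) (W j)" if "i \<le> j" for i j
    using that by (induction rule: dec_induct) (auto intro: prefix_order.trans W_mono1)
  have W_length: "length (W j) = j * length n" for j
    by (induction j) (simp_all add: W0 W_Suc)
  have W_length': "j \<le> length (W j)" for j using n0 by (cases n) (auto simp: W_length)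
  define ray where "ray p \<longleftrightarrow> (\<exists>j. prefix p (W j))" for p
  have ray_reduced: "p \<in> reduced w" if "ray p" for p
    using that Wr by (auto simp: ray_def prefix_def) (metis reduced_append)
  have ray_W: "ray (W j)" for j by (auto simp: ray_def)
  have ray_long: "\<exists>j\<ge>k. prefix p (W j)" if "ray p" for p k
  proof -
    obtain i where i: "prefix p (W i)" using \<open>ray p\<close> by (auto simp: ray_def)
    have "prefix p (W (max i k))" by (rule prefix_order.trans[OF i W_mono]) simp
    then show ?thesis by (intro exI[of _ "max i k"]) simp
  qed
  have ray_total: "prefix p q" if "ray p" "ray q" "length p \<le> length q" for p q
  proof -
    obtain i where i: "prefix p (W i)" using \<open>ray p\<close> by (auto simp: ray_def)
    obtain j where "j \<ge> i" "prefix q (W j)" using ray_long[OF \<open>ray q\<close>] by blast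
    then show ?thesis
      using prefix_length_prefix[OF prefix_order.trans[OF i W_mono] _ that(3)] by blast
  qed
  have ray_eq: "p = q" if "ray p" "ray q" "length p = length q" for p q
    using ray_total[OF that(1,2)] that(3) by (auto simp: prefix_def)
  have ray_g: "ray (act w g p)" if "ray p" for p
  proof -
    obtain j where j: "prefix p (W j)" using \<open>ray p\<close> by (auto simp: ray_def)
    have "p \<noteq> [] \<Longrightarrow> fst (hd p) = fst (hd n)"
      using j W_hd[of j] by (auto simp: prefix_def)
    then have "act w g p = n @ translate h p" using act_g ray_reduced[OF that] by blast
    then have "prefix (act w g p) (W (Suc j))" using W_Suc prefix_translate[OF j] by simp
    then show ?thesis by (auto simp: ray_def)
  qed
  \<comment> \<open>An element commuting with \<open>g\<close> maps the far part of the ray into the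
    ray and changes lengths by a constant. The constant is read off at one fixed point of the ray,
    the word \<open>W (length (act w c []))\<close>. Words shorter than \<open>act w c []\<close>
    are excluded, since cancellation could go beyond their end.\<close>
  have shift: "ray (act w c p) \<and> int (length (act w c p)) = int (length p) + \<tau>"
    if "c \<in> carrier G" "c \<otimes> g = g \<otimes> c" "ray p" "length (act w c []) \<le> length p"
      "\<tau> = int (length (act w c (W (length (act w c []))))) - int (length (W (length (act w c []))))"
    for c p \<tau>
  proof -
    define m where "m = act w c []"
    define s where "s = tail w c"
    have m: "m \<in> reduced w" using act_Nil_reduced[OF w that(1)] by (simp add: m_def)
    have s: "s \<in> gspan (V - {w})" using tail(1)[OF w that(1)] by (simp add: s_def)
    have ext: "act w c (p @ q) = act w c p @ translate s q"
      if "p @ q \<in> reduced w" "length m \<le> length p" for p q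
    proof -
      have "translate s p @ translate s q \<in> reduced w"
        using reduced_translate[OF w s that(1)] by simp
      moreover have "p \<in> reduced w" using that by (simp add: reduced_append)
      ultimately show ?thesis
        unfolding act_eq[OF w \<open>c \<in> carrier G\<close> that(1)] act_eq[OF w \<open>c \<in> carrier G\<close> \<open>p \<in> reduced w\<close>]
          m_def[symmetric] s_def[symmetric]
        using that(2) act_ev_append_right[OF w m, of "translate s p" "translate s q"] by simp
    qed
    have len: "length (act w c (p @ q)) + length p = length (act w c p) + length (p @ q)"
      if "p @ q \<in> reduced w" "length m \<le> length p" for p q
      using ext[OF that] by simp
    \<comment> \<open>Since \<open>W j\<close> has length at least \<open>j\<close>, the word
      \<open>act w c p\<close> is then no longer than the initial part of \<open>W j\<close> that
      \<open>m\<close> cannot alter.\<close>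
    obtain j where j: "j \<ge> length (act w c p) + length m" "prefix p (W j)"
      using ray_long[OF \<open>ray p\<close>] by blast
    then obtain q where q: "W j = p @ q" by (auto simp: prefix_def)
    have "act w c (W j) = act w (c \<otimes> g [^] j) []"
      using that(1) g by (simp add: W_def act_mult[OF w])
    also have "c \<otimes> g [^] j = g [^] j \<otimes> c"
      by (rule commute_pow[OF g that(1) that(2)[symmetric], symmetric])
    also have "act w (g [^] j \<otimes> c) [] = act w (g [^] j) m"
      using that(1) g by (simp add: m_def act_mult[OF w])
    also have "\<dots> = act w (ev w (W j)) (translate (tail w (g [^] j)) m)"
      using act_eq[OF w _ m, of "g [^] j"] g by (simp add: W_def)
    finally have e: "act w c (W j) = act w (ev w (W j)) (translate (tail w (g [^] j)) m)" .
    have "translate (tail w (g [^] j)) m \<in> reduced w"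
      using reduced_translate[OF w tail(1)[OF w] m] g by simp
    from take_act_ev[OF w Wr this, of j]
    have tk: "take (length (W j) - length m) (act w c (W j)) = take (length (W j) - length m) (W j)"
      by (simp add: e)
    have "length (act w c p) \<le> length (W j) - length m"
      using j(1) W_length'[of j] by linarith
    then have "take (length (act w c p)) (act w c (W j)) = take (length (act w c p)) (W j)"
      using arg_cong[OF tk, of "take (length (act w c p))"] by (simp add: min_def)
    moreover have "act w c (W j) = act w c p @ translate s q"
      using ext[of p q] q Wr[of j] that(4) by (simp add: m_def)
    ultimately have "act w c p = take (length (act w c p)) (W j)" by simp
    then have r: "ray (act w c p)" unfolding ray_def by (metis take_is_prefix)
    let ?P = "W (length m)"
    have lP: "length m \<le> length ?P" by (rule W_length')
    have "length (act w c p) + length ?P = length (act w c ?P) + length p"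
    proof (cases "length p \<le> length ?P")
      case True
      then obtain q' where "?P = p @ q'" using ray_total[OF \<open>ray p\<close> ray_W] by (auto simp: prefix_def)
      then show ?thesis using len[of p q'] Wr[of "length m"] that(4) by (simp add: m_def)
    next
      case False
      then obtain q' where "p = ?P @ q'" using ray_total[OF ray_W[of "length m"] \<open>ray p\<close>] by (auto simp: prefix_def)
      then show ?thesis using len[of ?P q'] ray_reduced[OF that(3)] lP by simp
    qed
    then show ?thesis using r that(5) by (simp add: m_def)
  qed
  define d1 where "d1 = inv c1"
  define d2 where "d2 = inv c2"
  have d: "d1 \<in> carrier G" "d1 \<otimes> g = g \<otimes> d1" "d2 \<in> carrier G" "d2 \<otimes> g = g \<otimes> d2"
    using c g commute_inv[OF c(1) g c(2)] commute_inv[OF c(3) g c(4)] by (simp_all add: d1_def d2_def)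
  define t where "t = commutator G c1 c2"
  have t: "t \<in> carrier G" using c by (simp add: t_def)
  \<comment> \<open>In this form only the shifts by the two inverses have to be compared, in both
    orders.\<close>
  have t_eq: "d2 \<otimes> d1 \<otimes> t = d1 \<otimes> d2"
    using c by (simp add: t_def commutator_def d1_def d2_def m_assoc mult_inv_cancel)
  have tg: "t \<otimes> g = g \<otimes> t"
    unfolding t_def commutator_def
    by (intro commute_mult m_closed inv_closed c g d[unfolded d1_def d2_def])
  define M where "M = length (act w d1 []) + length (act w d2 [])"
  have len_ge: "length p \<le> length (act w c []) + length (act w c p)" if "c \<in> carrier G" "p \<in> reduced w" for c p
  proof -
    have "translate (tail w c) p \<in> reduced w"
      using reduced_translate[OF w tail(1)[OF w that(1)] that(2)] .
    from length_act_ev(2)[OF w act_Nil_reduced[OF w that(1)] this] show ?thesis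
      by (simp add: act_eq[OF w that])
  qed
  have fix_ray: "act w t p = p" if "ray p" "M \<le> length p" for p
  proof -
    have pr: "p \<in> reduced w" using ray_reduced that by blast
    obtain \<tau>1 \<tau>2 where
      1: "\<And>q. ray q \<Longrightarrow> length (act w d1 []) \<le> length q \<Longrightarrow>
        ray (act w d1 q) \<and> int (length (act w d1 q)) = int (length q) + \<tau>1" and
      2: "\<And>q. ray q \<Longrightarrow> length (act w d2 []) \<le> length q \<Longrightarrow>
        ray (act w d2 q) \<and> int (length (act w d2 q)) = int (length q) + \<tau>2"
      using shift[OF d(1,2) _ _ refl] shift[OF d(3,4) _ _ refl] by blast
    have l: "length (act w d1 []) \<le> length p" "length (act w d2 []) \<le> length p" using that by (auto simp: M_def)
    have r1: "ray (act w d1 p)" and r2: "ray (act w d2 p)" using 1 2 l that by auto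
    have l1: "length (act w d2 []) \<le> length (act w d1 p)" and l2: "length (act w d1 []) \<le> length (act w d2 p)"
      using len_ge[OF d(1) pr] len_ge[OF d(3) pr] that(2) by (auto simp: M_def)
    \<comment> \<open>Both sides lie on the ray and have length
      \<open>length p + \<tau>1 + \<tau>2\<close>, and a point of the ray is determined by its
      length. The bound \<open>M\<close> keeps the intermediate words long enough for a second
      shift.\<close>
    have "act w d1 (act w d2 p) = act w d2 (act w d1 p)"
      by (rule ray_eq)
        (use 1[OF that(1) l(1)] 1[OF r2 l2] 2[OF that(1) l(2)] 2[OF r1 l1] in linarith)+
    then have "act w (d1 \<otimes> d2) p = act w (d2 \<otimes> d1) p"
      using d pr by (simp add: act_mult[OF w])
    then have "act w (d2 \<otimes> d1) (act w t p) = act w (d2 \<otimes> d1) p"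
      unfolding t_eq[symmetric] using d t pr by (simp add: act_mult[OF w])
    then show ?thesis using d t pr by (simp add: act_eq_iff[OF w] act_reduced[OF w])
  qed
  have fix_orbit: "act w t p = p" if p: "ray p" for p
  proof -
    \<comment> \<open>Since \<open>t\<close> commutes with \<open>g\<close>, it fixes
      \<open>p\<close> as soon as it fixes the image of \<open>p\<close> under a power of
      \<open>g\<close>. The power \<open>M\<close> carries \<open>p\<close> into the range of
      \<open>fix_ray\<close>.\<close>
    define q where "q = act w (g [^] M) p"
    have pr: "p \<in> reduced w" using ray_reduced p by blast
    have "ray (act w (g [^] (j::nat)) p)" for j
    proof (induction j)
      case (Suc j)
      then show ?case unfolding nat_pow_Suc2[OF g] using pr g by (simp add: act_mult[OF w] ray_g)
    qed (simp add: act_one[OF w] p pr)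
    then have "ray q" by (simp add: q_def)
    have "length (act w (g [^] (j::nat)) p) = j * length n + length p" for j
    proof (induction j)
      case (Suc j)
      let ?q = "act w (g [^] j) p"
      have rq: "ray ?q" by fact
      then obtain i where "prefix ?q (W i)" by (auto simp: ray_def)
      then have "?q \<noteq> [] \<Longrightarrow> fst (hd ?q) = fst (hd n)" using W_hd[of i] by (auto simp: prefix_def)
      then have "act w g ?q = n @ translate h ?q" using act_g ray_reduced[OF rq] by blast
      then show ?case unfolding nat_pow_Suc2[OF g] using Suc pr g by (simp add: act_mult[OF w])
    qed (simp add: act_one[OF w] pr)
    then have "M \<le> length q" using n0 by (cases n) (auto simp: q_def)
    from fix_ray[OF \<open>ray q\<close> this] have "act w (t \<otimes> g [^] M) p = act w (g [^] M) p"
      using t g pr by (simp add: q_def act_mult[OF w])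
    then have "act w (g [^] M) (act w t p) = act w (g [^] M) p"
      unfolding commute_pow[OF g t tg[symmetric], of M, symmetric]
      using t g pr by (simp add: act_mult[OF w])
    then show ?thesis using t g pr by (simp add: act_eq_iff[OF w] act_reduced[OF w])
  qed
  have "ray []" by (auto simp: ray_def)
  moreover have "ray [hd n]" unfolding ray_def
    by (rule exI[of _ 1]) (use n0 in \<open>cases n; simp add: W_Suc W0\<close>)
  ultimately show "act w (commutator G c1 c2) [] = []"
    "act w (commutator G c1 c2) [hd (act w g [])] = [hd (act w g [])]"
    using fix_orbit by (auto simp: t_def n_def)
qed

end

end

section \<open>Vertex groups are preserved up to conjugacy\<close>

context graph_product_group
begin

lemma retr_cj: "k \<in> carrier G \<Longrightarrow> x \<in> carrier G \<Longrightarrow> retr S (cj k x) = cj (retr S k) (retr S x)"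
  by (simp add: cj_def)

text \<open>The hypotheses say that \<open>g\<close> fixes no vertex of the tree. A conjugate with
  shortest word is then cyclically reduced, and by \<open>commutators_fix_axis\<close> the
  commutators fix an edge of its axis. The stabilizer of that edge is a conjugate of
  \<open>gspan (lk w)\<close>, which commutes with the same conjugate of \<open>U w\<close>.\<close>

lemma elliptic_or_commutators:
  assumes w: "w \<in> V" and g: "g \<in> carrier G"
    and not_H: "\<And>k. k \<in> carrier G \<Longrightarrow> cj k g \<notin> gspan (V - {w})"
    and not_st: "\<And>k. k \<in> carrier G \<Longrightarrow> cj k g \<notin> gspan (st w)"
  obtains y where "y \<in> carrier G"
    "\<And>c1 c2 a. c1 \<in> carrier G \<Longrightarrow> c1 \<otimes> g = g \<otimes> c1 \<Longrightarrow> c2 \<in> carrier G \<Longrightarrow> c2 \<otimes> g = g \<otimes> c2 \<Longrightarrow> a \<in> U w \<Longrightarrow>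
      commutator G c1 c2 \<otimes> cj y a = cj y a \<otimes> commutator G c1 c2"
proof -
  let ?L = "gspan (lk w)"
  obtain k where k: "k \<in> carrier G"
    and min: "\<And>k'. k' \<in> carrier G \<Longrightarrow> length (act w (cj k g) []) \<le> length (act w (cj k' g) [])"
    using ex_has_least_nat[of "\<lambda>k. k \<in> carrier G" \<one> "\<lambda>k. length (act w (cj k g) [])"] by auto
  define g' where "g' = cj k g"
  have g': "g' \<in> carrier G" using k g by (simp add: g'_def)
  define n where "n = act w g' []"
  define h where "h = tail w g'"
  have nr: "n \<in> reduced w" using act_Nil_reduced[OF w g'] by (simp add: n_def)
  have h: "h \<in> gspan (V - {w})" "h \<in> carrier G"
    using tail(1)[OF w g'] gspan_carrier by (auto simp: h_def)
  have "n \<noteq> []"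
    using act_Nil_eq_Nil[OF w g'] not_H[OF k] by (auto simp: n_def g'_def)
  then obtain x a n' where n: "n = (x, a) # n'" by (cases n) auto
  have x: "x \<in> cosets w" "a \<in> U w" "a \<noteq> \<one>" "n' \<in> reduced w" using nr n by (auto simp: reduced_Cons)
  define r where "r = coset_rep w x"
  have r: "r \<in> gspan (V - {w})" "r \<in> carrier G" "x = r <# ?L"
    using coset_rep[OF w x(1)] gspan_carrier by (auto simp: r_def)
  have fixes_x: "cj (inv r) s \<in> ?L" if "s \<in> carrier G" "s <# x = x" for s
  proof -
    have "cj (inv r) s <# ?L = inv r <# (s <# (r <# ?L))"
      using that(1) r(2) by (simp add: coset_mult[OF w] base_coset[OF w] cj_def m_assoc)
    also have "\<dots> = inv r <# (r <# ?L)" using that(2) r(3) by simp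
    also have "\<dots> = ?L"
      using r(2) by (simp add: coset_mult[OF w] coset_one[OF w] base_coset[OF w])
    finally show ?thesis using base_coset_moved[OF w] that r(2) by simp
  qed
  have ac: "a \<in> carrier G" using U_carrier[OF w x(2)] .
  \<comment> \<open>For a word of one syllable, equality means that the tail fixes the coset
    \<open>x\<close>, and a conjugate of \<open>g\<close> falls into \<open>gspan (st w)\<close>.
    For a longer word, equality contradicts minimality.\<close>
  have cyc: "fst (last n) \<noteq> h <# fst (hd n)"
  proof
    assume eq: "fst (last n) = h <# fst (hd n)"
    show False
    proof (cases "n' = []")
      case True
      then have "h <# x = x" using eq n by simp
      from fixes_x[OF h(2) this] have l: "cj (inv r) h \<in> gspan (st w)"
        using gspan_mono[of "lk w" "st w"] by (auto simp: st_def)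
      have "g' = syl w (x, a) \<otimes> h"
        using tail(2)[OF w g'] True n syl_carrier[OF w x(1,2)] by (simp add: n_def[symmetric] h_def)
      also have "syl w (x, a) = cj r a" using syl_eq[OF w r(1) x(2)] r(3) by (simp add: cj_def)
      finally have "cj (inv r) g' = a \<otimes> cj (inv r) h" using r(2) h ac by (simp add: cj_mult)
      moreover have "a \<in> gspan (st w)" using x w by (intro U_span) (auto simp: st_def)
      ultimately have "cj (inv r) g' \<in> gspan (st w)" using l gspan_mult by simp
      then show False using not_st[of "inv r \<otimes> k"] r k g by (simp add: g'_def cj_cj)
    next
      case False
      \<comment> \<open>Conjugating by the first syllable moves it to the end of the word, where it
        merges with the last one.\<close>
      define u where "u = syl w (x, a)"
      have u: "u \<in> carrier G" using syl_carrier[OF w x(1,2)] by (simp add: u_def)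
      have xa: "[(x, a)] \<in> reduced w" using x by (simp add: reduced_Cons)
      have hx: "[(h <# x, a)] \<in> reduced w" using reduced_translate[OF w h(1) xa] by simp
      have "act w (cj (inv u) g') [] = act w (inv u) (act w g' (act w u []))"
        using u g' by (simp add: cj_def act_mult[OF w] act_reduced[OF w] m_assoc)
      also have "act w u [] = [(x, a)]"
        using act_syl[OF w x(1,2)] x(3) by (simp add: u_def cons_syl_fresh[OF w x(2)])
      also have "act w g' [(x, a)] = act w (ev w n) [(h <# x, a)]"
        using act_eq[OF w g' xa] by (simp add: n_def h_def)
      also have "\<dots> = act w u (act w (ev w n') [(h <# x, a)])"
        using n u x hx by (simp add: u_def[symmetric] act_mult[OF w] ev_carrier[OF w])
      also have "act w (inv u) \<dots> = act w (ev w n') [(h <# x, a)]"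
        using u x hx by (simp add: act_inv[OF w] act_reduced[OF w] ev_carrier[OF w])
      finally have "act w (cj (inv u) g') [] = act w (ev w n') [(h <# x, a)]" .
      moreover have "length (act w (ev w n') [(h <# x, a)]) < length n' + 1"
        using length_act_ev_less[OF w x(4) False hx] eq n False by simp
      ultimately show False
        using min[of "inv u \<otimes> k"] u k g n by (simp add: g'_def[symmetric] n_def[symmetric] flip: cj_cj)
    qed
  qed
  show thesis
  \<comment> \<open>\<open>r\<close> carries the base coset to the first coset on the axis of
    \<open>cj k g\<close>, and \<open>inv k\<close> leads back to the axis of
    \<open>g\<close>.\<close>
  proof (rule that[of "inv k \<otimes> r"])
    show "inv k \<otimes> r \<in> carrier G" using k r by simp
    fix c1 c2 b
    assume c: "c1 \<in> carrier G" "c1 \<otimes> g = g \<otimes> c1" "c2 \<in> carrier G" "c2 \<otimes> g = g \<otimes> c2" and b: "b \<in> U w"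
    have c': "cj k c \<otimes> g' = g' \<otimes> cj k c" if "c \<in> carrier G" "c \<otimes> g = g \<otimes> c" for c
      using that k g by (simp add: g'_def flip: cj_mult)
    define t where "t = commutator G (cj k c1) (cj k c2)"
    have t: "t \<in> carrier G" "t = cj k (commutator G c1 c2)" using c k by (simp_all add: t_def cj_commutator)
    have "act w t [] = []" "act w t [(x, a)] = [(x, a)]"
      using commutators_fix_axis[OF w g' _ _ _ c'[OF c(1,2)] _ c'[OF c(3,4)]] cyc n c k
      by (auto simp: t_def n_def[symmetric] h_def[symmetric])
    then have "t \<in> gspan (V - {w})" "translate t [(x, a)] = [(x, a)]"
      using act_Nil_eq_Nil[OF w t(1)] act_translate[OF w, of t "[(x, a)]"] x by (auto simp: reduced_Cons)
    then have "cj (inv r) t \<in> ?L" using fixes_x[OF t(1)] by simp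
    then have e: "b \<otimes> cj (inv r) t = cj (inv r) t \<otimes> b" by (rule U_span_lk[OF w b])
    have bc: "b \<in> carrier G" using U_carrier[OF w b] .
    let ?c = "commutator G c1 c2" and ?y = "inv k \<otimes> r"
    have tt: "cj ?y (cj (inv r) t) = ?c" using t k r c by (simp add: cj_cj m_assoc mult_inv_cancel)
    have "cj ?y (b \<otimes> cj (inv r) t) = cj ?y (cj (inv r) t \<otimes> b)" by (simp add: e)
    then show "?c \<otimes> cj ?y b = cj ?y b \<otimes> ?c"
      using t k r bc tt by (simp add: cj_mult)
  qed
qed

lemma commute_U:
  "v \<in> V \<Longrightarrow> a \<in> U v \<Longrightarrow> a \<noteq> \<one> \<Longrightarrow> c \<in> carrier G \<Longrightarrow> c \<otimes> a = a \<otimes> c \<Longrightarrow> c \<in> gspan (st v)"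
  using commute_star[of v a \<one> c] U_carrier by simp

lemma retr_U_other: "v \<in> V \<Longrightarrow> a \<in> U v \<Longrightarrow> v \<notin> S \<Longrightarrow> retr S a = \<one>"
  by (simp add: retr(2))

lemma cj_eq_one: "k \<in> carrier G \<Longrightarrow> x \<in> carrier G \<Longrightarrow> cj k x = \<one> \<longleftrightarrow> x = \<one>"
  using cj_inj[of k x \<one>] by simp

text \<open>Apply \<open>retr {v}\<close>: conjugation by \<open>k\<close> becomes conjugation
  inside the abelian group \<open>U v\<close>, hence trivial, while the group of any other vertex
  would be killed.\<close>

lemma conj_in_U:
  assumes "v \<in> V" "w \<in> V" "a \<in> U v" "a \<noteq> \<one>" "k \<in> carrier G" "cj k a \<in> U w"
  shows "v = w" "cj k a = a"
proof -
  have ac: "a \<in> carrier G" using U_carrier assms by blast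
  have e: "retr {v} (cj k a) = cj (retr {v} k) a"
    unfolding retr_cj[OF assms(5) ac] using assms(1,3) by (simp add: retr(2))
  show "v = w"
  proof (rule ccontr)
    assume "v \<noteq> w"
    then have "cj (retr {v} k) a = \<one>" using e retr_U_other[OF assms(2,6), of "{v}"] by simp
    then show False using assms ac by (simp add: cj_eq_one)
  qed
  then have "retr {v} (cj k a) = cj k a" using retr(2)[OF assms(2,6), of "{v}"] by auto
  then have "cj k a = cj (retr {v} k) a" using e by simp
  moreover have "retr {v} k \<in> U v" using retr_in_span[OF assms(5)] gspan_singleton[OF assms(1)] by blast
  ultimately show "cj k a = a"
    using U_abelian[OF assms(1)] assms ac by (simp add: cj_eq_iff_commute)
qed

text \<open>The second conclusion says that the cosets \<open>g <# gspan (st s)\<close> and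
  \<open>h <# gspan (st t)\<close> meet. For \<open>r = inv g \<otimes> h\<close> the element
  \<open>cj r b\<close> centralizes \<open>a\<close>, so it lies in \<open>gspan (st s)\<close> and
  is fixed by the retraction. Retracting \<open>r\<close> as well gives \<open>p\<close> with
  \<open>cj r b = cj p b\<close>, and \<open>inv p \<otimes> r\<close> centralizes
  \<open>b\<close>.\<close>

lemma conj_commute_adjacent:
  assumes "s \<in> V" "t \<in> V" "s \<noteq> t" "a \<in> U s" "a \<noteq> \<one>" "b \<in> U t" "b \<noteq> \<one>" "g \<in> carrier G" "h \<in> carrier G"
    and comm: "cj g a \<otimes> cj h b = cj h b \<otimes> cj g a"
  shows "t \<in> lk s" "\<exists>p\<in>gspan (st s). \<exists>q\<in>gspan (st t). inv g \<otimes> h = p \<otimes> q"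
proof -
  define r where "r = inv g \<otimes> h"
  have r: "r \<in> carrier G" using assms by (simp add: r_def)
  have ab: "a \<in> carrier G" "b \<in> carrier G" using U_carrier assms by auto
  have "cj (inv g) (cj g a \<otimes> cj h b) = cj (inv g) (cj h b \<otimes> cj g a)" by (simp add: comm)
  then have "cj r b \<otimes> a = a \<otimes> cj r b" using assms(1-9) ab by (simp add: cj_mult cj_cj r_def)
  then have in_st: "cj r b \<in> gspan (st s)" using commute_U[of s a "cj r b"] assms r ab by simp
  have "retr {t} (cj r b) = cj (retr {t} r) b" using r ab assms by (simp add: retr_cj retr(2))
  then have "retr {t} (cj r b) \<noteq> \<one>" using r ab assms by (simp add: cj_eq_one)
  then have "t \<in> st s" using gspan_disjoint[OF in_st, of "{t}"] by simp
  then show "t \<in> lk s" using assms by (simp add: st_def)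
  define p where "p = retr (st s) r"
  have p: "p \<in> gspan (st s)" "p \<in> carrier G" using retr_in_span[OF r] gspan_carrier by (auto simp: p_def)
  have "cj r b = retr (st s) (cj r b)" using retr_id[OF in_st] by simp
  also have "\<dots> = cj p b" using r ab assms \<open>t \<in> st s\<close> by (simp add: retr_cj retr(2) p_def)
  finally have "cj r b = cj p b" .
  then have "cj (inv p \<otimes> r) b = b" using p r ab by (simp flip: cj_cj)
  then have "inv p \<otimes> r \<in> gspan (st t)"
    using commute_U[of t b "inv p \<otimes> r"] assms ab p r by (simp add: cj_eq_iff_commute)
  moreover have "inv g \<otimes> h = p \<otimes> (inv p \<otimes> r)" using p r by (simp add: mult_inv_cancel) (simp add: r_def)
  ultimately show "\<exists>p\<in>gspan (st s). \<exists>q\<in>gspan (st t). inv g \<otimes> h = p \<otimes> q" using p by blast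
qed

text \<open>Solve for \<open>s\<close> and apply \<open>retr S\<close>, which fixes it. A retraction
  maps every parabolic subgroup into itself, so the outer factors stay in \<open>gspan A\<close> and
  \<open>gspan B\<close>, while \<open>t\<close> is moved into
  \<open>gspan (S \<inter> T)\<close>.\<close>

lemma triple_product_Int:
  assumes "p \<in> gspan A" "s \<in> gspan S" "q \<in> gspan B" "p' \<in> gspan A" "t \<in> gspan T" "q' \<in> gspan B"
    and eq: "p \<otimes> s \<otimes> q = p' \<otimes> t \<otimes> q'"
  shows "\<exists>p\<in>gspan A. \<exists>d\<in>gspan (S \<inter> T). \<exists>r\<in>gspan B. p' \<otimes> t \<otimes> q' = p \<otimes> d \<otimes> r"
proof -
  note c = assms(1-6)[THEN gspan_carrier]
  have "s = inv p \<otimes> (p \<otimes> s \<otimes> q) \<otimes> inv q" using c by (simp add: m_assoc mult_inv_cancel)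
  also have "\<dots> = (inv p \<otimes> p') \<otimes> t \<otimes> (q' \<otimes> inv q)" unfolding eq using c by (simp add: m_assoc)
  finally have s: "s = (inv p \<otimes> p') \<otimes> t \<otimes> (q' \<otimes> inv q)" .
  have "s = retr S s" using retr_id[OF assms(2)] by simp
  also have "\<dots> = retr S (inv p \<otimes> p') \<otimes> retr S t \<otimes> retr S (q' \<otimes> inv q)"
    using c unfolding s by simp
  finally have e: "s = retr S (inv p \<otimes> p') \<otimes> retr S t \<otimes> retr S (q' \<otimes> inv q)" .
  have in_A: "retr S (inv p \<otimes> p') \<in> gspan A"
    using retr_span[of "inv p \<otimes> p'" A S] gspan_mono[of "S \<inter> A" A] assms by (auto simp: gspan_mult gspan_inv)
  have in_B: "retr S (q' \<otimes> inv q) \<in> gspan B"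
    using retr_span[of "q' \<otimes> inv q" B S] gspan_mono[of "S \<inter> B" B] assms by (auto simp: gspan_mult gspan_inv)
  have in_D: "retr S t \<in> gspan (S \<inter> T)" by (rule retr_span[OF assms(5)])
  have "p' \<otimes> t \<otimes> q' = p \<otimes> (retr S (inv p \<otimes> p') \<otimes> retr S t \<otimes> retr S (q' \<otimes> inv q)) \<otimes> q"
    unfolding e[symmetric] eq ..
  also have "\<dots> = (p \<otimes> retr S (inv p \<otimes> p')) \<otimes> retr S t \<otimes> (retr S (q' \<otimes> inv q) \<otimes> q)"
    using c by (simp add: m_assoc)
  finally show ?thesis using assms in_A in_B in_D gspan_mult by blast
qed

lemma triple_product_Inter:
  assumes "finite \<S>" "g \<in> carrier G"
    and "\<And>S. S \<in> \<S> \<Longrightarrow> \<exists>p\<in>gspan A. \<exists>s\<in>gspan S. \<exists>q\<in>gspan B. g = p \<otimes> s \<otimes> q"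
  shows "\<exists>p\<in>gspan A. \<exists>s\<in>gspan (\<Inter>\<S>). \<exists>q\<in>gspan B. g = p \<otimes> s \<otimes> q"
  using assms
proof (induction rule: finite_induct)
  case empty
  have "g \<in> gspan UNIV" using gspan_mono[of V UNIV] empty by (auto simp: gspan_V)
  moreover have "g = \<one> \<otimes> g \<otimes> \<one>" using empty by simp
  ultimately show ?case using gspan_one unfolding Inter_empty by blast
next
  case (insert S \<S>)
  then obtain p t q where 1: "p \<in> gspan A" "t \<in> gspan (\<Inter>\<S>)" "q \<in> gspan B" "g = p \<otimes> t \<otimes> q" by auto
  obtain p' s q' where 2: "p' \<in> gspan A" "s \<in> gspan S" "q' \<in> gspan B" "g = p' \<otimes> s \<otimes> q'"
    using insert.prems(2)[of S] by auto
  have "p' \<otimes> s \<otimes> q' = p \<otimes> t \<otimes> q" using 1 2 by simp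
  from triple_product_Int[OF 2(1-3) 1(1-3) this] show ?case using 1(4) by simp
qed

end

section \<open>Graphs with the extension property\<close>

locale generic_graph_product = graph_product_group G V E U
  for G :: "'g monoid" (structure) and V :: "'v set" and E and U +
  assumes extension: "\<lbrakk>S \<subseteq> V; T \<subseteq> V; S \<inter> T = {}; card S \<le> 2; card T \<le> 3\<rbrakk>
    \<Longrightarrow> \<exists>z\<in>V - S - T. S \<subseteq> lk z \<and> lk z \<inter> T = {}"
begin

lemma ext_vertex:
  assumes "v \<in> V" "T \<subseteq> V" "v \<notin> T" "card T \<le> 3"
  obtains z where "z \<in> lk v" "z \<notin> T" "lk z \<inter> T = {}"
proof -
  have "\<exists>z\<in>V - {v} - T. {v} \<subseteq> lk z \<and> lk z \<inter> T = {}"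
    by (rule extension) (use assms in auto)
  then show thesis using that lk_sym by auto
qed

lemma ext_pair:
  assumes "v \<in> V" "w \<in> V" "T \<subseteq> V" "v \<notin> T" "w \<notin> T" "card T \<le> 3"
  obtains z where "z \<in> lk v" "z \<in> lk w" "z \<notin> T" "lk z \<inter> T = {}"
proof -
  have "\<exists>z\<in>V - {v, w} - T. {v, w} \<subseteq> lk z \<and> lk z \<inter> T = {}"
    by (rule extension) (use assms in \<open>auto simp: card_insert_if\<close>)
  then show thesis using that lk_sym by auto
qed

text \<open>For each neighbour \<open>u\<close> of \<open>v\<close>, three further neighbours of
  \<open>v\<close> not joined to \<open>u\<close> supply the set required by
  \<open>commute_commutators\<close>, so \<open>y\<close> lies in \<open>gspan (lk u)\<close>. Only
  \<open>v\<close> itself is joined to all neighbours of \<open>v\<close>, so these subgroups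
  intersect in \<open>U v\<close>.\<close>

lemma commute_link_derived:
  assumes v: "v \<in> V" and y: "y \<in> carrier G"
    and comm: "\<And>x1 x2. x1 \<in> gspan (lk v) \<Longrightarrow> x2 \<in> gspan (lk v) \<Longrightarrow>
      y \<otimes> commutator G x1 x2 = commutator G x1 x2 \<otimes> y"
  shows "y \<in> U v"
proof -
  have link: "y \<in> gspan (lk u)" if u: "u \<in> lk v" for u
  proof -
    have uV: "u \<in> V" and uv: "u \<noteq> v" using u lk_subset by auto
    obtain u1 where u1: "u1 \<in> lk v" "u1 \<noteq> u" "u \<notin> lk u1"
      using ext_vertex[of v "{u}"] v uV uv by auto
    have u1V: "u1 \<in> V" "u1 \<noteq> v" using u1 lk_subset by auto
    obtain u2 where u2: "u2 \<in> lk v" "u2 \<notin> {u, u1}" "u \<notin> lk u2"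
      using ext_vertex[of v "{u, u1}"] v uV uv u1V u1(2) by (auto simp: card_insert_if)
    have u2V: "u2 \<in> V" "u2 \<noteq> v" using u2 lk_subset by auto
    have "card {u, u1, u2} \<le> 3" by (simp add: card_insert_if)
    then obtain u3 where "u3 \<in> lk v" "u3 \<notin> {u, u1, u2}" "lk u3 \<inter> {u, u1, u2} = {}"
      using ext_vertex[OF v, of "{u, u1, u2}"] uV uv u1V u2V by blast
    then have u3: "u3 \<in> lk v" "u3 \<notin> {u, u1, u2}" "u \<notin> lk u3" by auto
    have u3V: "u3 \<in> V" using u3 lk_subset by auto
    define I where "I = {u1, u2, u3}"
    have I: "i \<in> V" "i \<in> lk v" "i \<noteq> u" "i \<notin> lk u" if "i \<in> I" for i
      using that u1 u2 u3 u1V u2V u3V lk_sym[OF uV] by (auto simp: I_def)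
    obtain b where b: "b i \<in> U i" "b i \<noteq> \<one>" if "i \<in> V" for i
      using U_nontrivial by metis
    have bc: "b i \<in> carrier G" if "i \<in> I" for i using b I that U_carrier by blast
    have retr_b: "retr {i} (b j) = (if i = j then b j else \<one>)" if "j \<in> I" for i j
      using retr(2)[OF I(1)[OF that] b(1)[OF I(1)[OF that]], of "{i}"] by auto
    have b_inj: "inj_on b I"
      by (rule inj_onI) (metis retr_b b(2) I(1))
    have card_I: "card I = 3" using u2(2) u3(2) by (auto simp: I_def card_insert_if)
    have "y \<in> gspan (lk u)"
    proof (rule commute_commutators[OF uV, where a = "b u" and B = "b ` I"])
      show "b u \<in> U u" "b u \<noteq> \<one>" using b uV by auto
      show "card (b ` I) = 3" using card_image[OF b_inj] card_I by simp
      show "y \<in> carrier G" by fact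
    next
      fix c assume "c \<in> b ` I"
      then obtain i where i: "i \<in> I" "c = b i" by auto
      show "c \<in> gspan (V - {u})" using U_span[of i "V - {u}" "b i"] i(2) I[OF i(1)] b by auto
      show "c \<notin> gspan (lk u)"
        using gspan_disjoint[of c "lk u" "{i}"] i I[OF i(1)] b retr_b by auto
      have "b u \<in> gspan (lk v)" "c \<in> gspan (lk v)"
        using U_span[of u "lk v" "b u"] U_span[of i "lk v" "b i"] u uV b i(2) I[OF i(1)] by auto
      then show "y \<otimes> commutator G (b u) c = commutator G (b u) c \<otimes> y" by (rule comm)
    next
      fix c d assume "c \<in> b ` I" "d \<in> b ` I" "c \<noteq> d"
      then obtain i j where ij: "i \<in> I" "c = b i" "j \<in> I" "d = b j" "i \<noteq> j" by auto
      have "retr {i} (inv c \<otimes> d) = inv c" using ij bc by (simp add: retr_b)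
      moreover have "inv c \<noteq> \<one>" using ij bc b I by (simp add: inv_eq_1_iff)
      ultimately show "inv c \<otimes> d \<notin> gspan (lk u)"
        using gspan_disjoint[of "inv c \<otimes> d" "lk u" "{i}"] I[OF ij(1)] by auto
    qed
    then show ?thesis .
  qed
  have "y \<in> gspan (\<Inter> (lk ` lk v))"
    by (rule gspan_Inter) (use y link finite_subset[OF lk_subset finite_V] in auto)
  moreover have "\<Inter> (lk ` lk v) \<inter> V \<subseteq> {v}"
  proof
    fix z assume z: "z \<in> \<Inter> (lk ` lk v) \<inter> V"
    show "z \<in> {v}"
    proof (rule ccontr)
      assume "z \<notin> {v}"
      then obtain u where "u \<in> lk v" "lk u \<inter> {z} = {}" using ext_vertex[of v "{z}"] v z by auto
      then show False using z by auto
    qed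
  qed
  ultimately have "y \<in> gspan {v}" using gspan_mono by blast
  then show ?thesis using gspan_singleton[OF v] by simp
qed

end

section \<open>Automorphisms and their effect on vertex groups\<close>

context generic_graph_product
begin

text \<open>Carrying the inverse along as a second homomorphism makes every fact on
  \<open>\<phi>\<close> available for \<open>\<psi>\<close> through
  \<open>mutual_inverse_sym\<close>.\<close>

definition mutual_inverse :: "('g \<Rightarrow> 'g) \<Rightarrow> ('g \<Rightarrow> 'g) \<Rightarrow> bool" where
  "mutual_inverse \<phi> \<psi> \<longleftrightarrow> \<phi> \<in> hom G G \<and> \<psi> \<in> hom G G \<and>
    (\<forall>x\<in>carrier G. \<psi> (\<phi> x) = x) \<and> (\<forall>x\<in>carrier G. \<phi> (\<psi> x) = x)"

lemma mutual_inverse_sym: "mutual_inverse \<phi> \<psi> \<Longrightarrow> mutual_inverse \<psi> \<phi>"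
  by (simp add: mutual_inverse_def)

context
  fixes \<phi> \<psi> assumes inverse: "mutual_inverse \<phi> \<psi>"
begin

lemma aut_simps:
  "x \<in> carrier G \<Longrightarrow> \<psi> (\<phi> x) = x"
  "x \<in> carrier G \<Longrightarrow> \<phi> x \<in> carrier G"
  "x \<in> carrier G \<Longrightarrow> y \<in> carrier G \<Longrightarrow> \<phi> (x \<otimes> y) = \<phi> x \<otimes> \<phi> y"
  "x \<in> carrier G \<Longrightarrow> \<phi> (inv x) = inv (\<phi> x)"
  "\<phi> \<one> = \<one>"
  using inverse group_hom.hom_inv[of G G \<phi>] group_hom.hom_one[of G G \<phi>]
  by (auto simp: mutual_inverse_def hom_def group_hom_def group_hom_axioms_def is_group)

lemma aut_cj: "k \<in> carrier G \<Longrightarrow> x \<in> carrier G \<Longrightarrow> \<phi> (cj k x) = cj (\<phi> k) (\<phi> x)"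
  by (simp add: cj_def aut_simps)

lemma aut_commutator:
  "x \<in> carrier G \<Longrightarrow> y \<in> carrier G \<Longrightarrow> \<phi> (commutator G x y) = commutator G (\<phi> x) (\<phi> y)"
  by (simp add: commutator_def aut_simps)

lemma aut_commute: "x \<in> carrier G \<Longrightarrow> y \<in> carrier G \<Longrightarrow> x \<otimes> y = y \<otimes> x \<Longrightarrow> \<phi> x \<otimes> \<phi> y = \<phi> y \<otimes> \<phi> x"
  by (metis aut_simps(3))

lemma aut_eq_one: "x \<in> carrier G \<Longrightarrow> \<phi> x = \<one> \<longleftrightarrow> x = \<one>"
  by (metis aut_simps(1,5) one_closed)

end

lemma image_elliptic:
  assumes \<phi>: "mutual_inverse \<phi> \<psi>" and v: "v \<in> V" "a \<in> U v" and w: "w \<in> V"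
  shows "\<exists>k\<in>carrier G. cj k (\<phi> a) \<in> gspan (V - {w}) \<or> cj k (\<phi> a) \<in> gspan (st w)"
proof (rule ccontr)
  note \<psi> = mutual_inverse_sym[OF \<phi>]
  assume neg: "\<not> ?thesis"
  have ac: "a \<in> carrier G" using U_carrier v by blast
  then have gc: "\<phi> a \<in> carrier G" by (rule aut_simps(2)[OF \<phi>])
  obtain y where y: "y \<in> carrier G" and
    y_comm: "\<And>c1 c2 b. c1 \<in> carrier G \<Longrightarrow> c1 \<otimes> \<phi> a = \<phi> a \<otimes> c1 \<Longrightarrow> c2 \<in> carrier G \<Longrightarrow> c2 \<otimes> \<phi> a = \<phi> a \<otimes> c2
      \<Longrightarrow> b \<in> U w \<Longrightarrow> commutator G c1 c2 \<otimes> cj y b = cj y b \<otimes> commutator G c1 c2"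
    using elliptic_or_commutators[OF w gc] neg by blast
  obtain b where b: "b \<in> U w" "b \<noteq> \<one>" using U_nontrivial[OF w] by blast
  have bc: "b \<in> carrier G" using U_carrier[OF w b(1)] .
  define z where "z = \<psi> (cj y b)"
  have z: "z \<in> carrier G" "\<phi> z = cj y b"
    using y bc by (simp_all add: z_def aut_simps(1,2)[OF \<psi>])
  \<comment> \<open>The images of elements of \<open>gspan (lk v)\<close> commute with
    \<open>\<phi> a\<close>, so \<open>y_comm\<close> applies to their commutators.\<close>
  have "z \<in> U v"
  proof (rule commute_link_derived[OF v(1) z(1)])
    fix x1 x2 assume x: "x1 \<in> gspan (lk v)" "x2 \<in> gspan (lk v)"
    have xc: "x1 \<in> carrier G" "x2 \<in> carrier G" using x gspan_carrier by auto
    have "\<phi> x \<otimes> \<phi> a = \<phi> a \<otimes> \<phi> x" if "x \<in> gspan (lk v)" for x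
      using aut_commute[OF \<phi> ac gspan_carrier[OF that] U_span_lk[OF v that]] by simp
    from y_comm[OF _ this[OF x(1)] _ this[OF x(2)] b(1)]
    have "commutator G (\<phi> x1) (\<phi> x2) \<otimes> cj y b = cj y b \<otimes> commutator G (\<phi> x1) (\<phi> x2)"
      using xc aut_simps(2)[OF \<phi>] by simp
    then have "\<phi> (commutator G x1 x2) \<otimes> \<phi> z = \<phi> z \<otimes> \<phi> (commutator G x1 x2)"
      using xc by (simp add: z(2) aut_commutator[OF \<phi>])
    from aut_commute[OF \<psi> _ _ this] show "z \<otimes> commutator G x1 x2 = commutator G x1 x2 \<otimes> z"
      using xc z(1) by (simp add: aut_simps(1,2)[OF \<phi>])
  qed
  then have "z \<otimes> a = a \<otimes> z" using U_abelian[OF v(1)] v(2) by blast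
  from aut_commute[OF \<phi> z(1) ac this] have e: "cj y b \<otimes> \<phi> a = \<phi> a \<otimes> cj y b" by (simp add: z(2))
  have "cj (inv y) (cj y b \<otimes> \<phi> a) = cj (inv y) (\<phi> a \<otimes> cj y b)" by (simp only: e)
  then have "cj (inv y) (\<phi> a) \<otimes> b = b \<otimes> cj (inv y) (\<phi> a)"
    using y bc gc by (simp add: cj_mult)
  then have "cj (inv y) (\<phi> a) \<in> gspan (st w)" using commute_U[OF w b] y gc by simp
  then show False using neg y by (meson inv_closed)
qed

text \<open>Let \<open>S\<close> be a smallest vertex set such that a conjugate of
  \<open>\<phi> a\<close> lies in \<open>gspan S\<close>. By \<open>image_elliptic\<close> it is
  contained in the star of each of its vertices. For \<open>w\<close> in \<open>S\<close> the
  conjugate has a non-trivial factor in \<open>U w\<close>, so its centralizer lies in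
  \<open>gspan (st w)\<close> and commutes with \<open>U w\<close>. Pulled back by
  \<open>\<psi>\<close>, this is the hypothesis of \<open>commute_link_derived\<close>.\<close>

lemma image_meets_vertex_group:
  assumes \<phi>: "mutual_inverse \<phi> \<psi>" and v: "v \<in> V" "a \<in> U v" "a \<noteq> \<one>"
  obtains w k where "w \<in> V" "k \<in> carrier G" "\<And>b. b \<in> U w \<Longrightarrow> \<psi> (cj k b) \<in> U v"
proof -
  note \<psi> = mutual_inverse_sym[OF \<phi>]
  have ac: "a \<in> carrier G" using U_carrier v by blast
  define g where "g = \<phi> a"
  have gc: "g \<in> carrier G" using ac by (simp add: g_def aut_simps[OF \<phi>])
  let ?P = "\<lambda>S. S \<subseteq> V \<and> (\<exists>k\<in>carrier G. cj k g \<in> gspan S)"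
  have "?P V" using gc by (auto simp: gspan_V intro: bexI[of _ \<one>])
  then obtain S where S: "?P S" and min: "\<And>T. ?P T \<Longrightarrow> card S \<le> card T"
    using ex_has_least_nat[of ?P V card] by blast
  then obtain k where k: "k \<in> carrier G" "cj k g \<in> gspan S" by blast
  define g' where "g' = cj k g"
  have g': "g' \<in> carrier G" "g' \<in> gspan S" using k gc by (auto simp: g'_def)
  have finS: "finite S" using S finite_V finite_subset by blast
  \<comment> \<open>Retracting the conjugating element to \<open>S\<close> yields a conjugate in
    \<open>gspan (S \<inter> T)\<close>, which minimality does not allow to be smaller.\<close>
  have shrink: "S \<subseteq> T" if "h \<in> carrier G" "cj h g \<in> gspan T" for h T
  proof -
    define r where "r = h \<otimes> inv k"
    have r: "r \<in> carrier G" "cj r g' = cj h g" using that k gc by (simp_all add: r_def g'_def cj_cj m_assoc)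
    have "cj (retr S r) g' = retr S (cj r g')"
      using retr_cj[OF r(1) g'(1)] retr_id[OF g'(2)] by simp
    then have "cj (retr S r) g' \<in> gspan (S \<inter> T)" using retr_span[of "cj r g'" T S] r that by simp
    then have "cj (retr S r \<otimes> k) g \<in> gspan (S \<inter> T)" using r k gc by (simp add: g'_def cj_cj)
    then have "?P (S \<inter> T)" using S r k by auto
    then have "card S \<le> card (S \<inter> T)" by (rule min)
    then show ?thesis using finS by (metis Int_lower1 card_seteq inf.absorb_iff1)
  qed
  have "S \<noteq> {}"
  proof
    assume "S = {}"
    then have "cj k g = \<one>" using k gspan_empty by simp
    then have "g = \<one>" using k gc by (simp add: cj_eq_one)
    then show False using v ac by (simp add: g_def aut_eq_one[OF \<phi>])
  qed
  then obtain w where w: "w \<in> S" by blast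
  then have wV: "w \<in> V" using S by blast
  obtain h where h: "h \<in> carrier G" "cj h g \<in> gspan (V - {w}) \<or> cj h g \<in> gspan (st w)"
    using image_elliptic[OF \<phi> v(1,2) wV] by (auto simp: g_def)
  then have Sst: "S \<subseteq> st w" using shrink[OF h(1)] w by blast
  obtain a1 l where al: "a1 \<in> U w" "l \<in> gspan (S - {w})" "g' = a1 \<otimes> l"
    using gspan_star_decomp[OF wV _ g'(2)] Sst by blast
  have lc: "l \<in> carrier G" using gspan_carrier[OF al(2)] .
  have "a1 \<noteq> \<one>"
  proof
    assume "a1 = \<one>"
    then have "cj k g \<in> gspan (S - {w})" using al lc by (simp add: g'_def)
    then show False using shrink[OF k(1)] w by blast
  qed
  have l: "l \<in> gspan (lk w)" using al(2) gspan_mono[of "S - {w}" "lk w"] Sst by (auto simp: st_def)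
  have cent: "x \<in> gspan (st w)" if "x \<in> carrier G" "x \<otimes> g' = g' \<otimes> x" for x
    using commute_star[OF wV al(1) \<open>a1 \<noteq> \<one>\<close> l that(1)] that(2) al(3) by simp
  show thesis
  proof (rule that[OF wV inv_closed[OF k(1)]])
    fix b assume b: "b \<in> U w"
    have bc: "b \<in> carrier G" using U_carrier[OF wV b] .
    let ?z = "\<psi> (cj (inv k) b)"
    have z: "?z \<in> carrier G" "\<phi> ?z = cj (inv k) b"
      using k bc by (simp_all add: aut_simps(1,2)[OF \<psi>])
    show "?z \<in> U v"
    proof (rule commute_link_derived[OF v(1) z(1)])
      fix x1 x2 assume x: "x1 \<in> gspan (lk v)" "x2 \<in> gspan (lk v)"
      define c where "c = commutator G x1 x2"
      have "c \<in> gspan (lk v)" unfolding c_def commutator_def using x by (intro gspan_mult gspan_inv)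
      then have "a \<otimes> c = c \<otimes> a" and cc: "c \<in> carrier G" using U_span_lk[OF v(1,2)] gspan_carrier by auto
      from aut_commute[OF \<phi> ac cc this(1)] have e: "\<phi> c \<otimes> g = g \<otimes> \<phi> c" by (simp add: g_def)
      have fc: "\<phi> c \<in> carrier G" using cc by (rule aut_simps(2)[OF \<phi>])
      have "cj k (\<phi> c \<otimes> g) = cj k (g \<otimes> \<phi> c)" by (simp only: e)
      then have "cj k (\<phi> c) \<otimes> g' = g' \<otimes> cj k (\<phi> c)" using k gc fc by (simp add: g'_def cj_mult)
      then have "cj k (\<phi> c) \<in> gspan (st w)" using cent k fc by simp
      then have e2: "b \<otimes> cj k (\<phi> c) = cj k (\<phi> c) \<otimes> b" by (rule U_span_st[OF wV b])
      have "cj (inv k) (b \<otimes> cj k (\<phi> c)) = cj (inv k) (cj k (\<phi> c) \<otimes> b)" by (simp only: e2)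
      then have "\<phi> ?z \<otimes> \<phi> c = \<phi> c \<otimes> \<phi> ?z"
        using k bc fc by (simp add: z(2) cj_mult)
      from aut_commute[OF \<psi> _ _ this] show "?z \<otimes> commutator G x1 x2 = commutator G x1 x2 \<otimes> ?z"
        using cc z(1) by (simp add: aut_simps(1,2)[OF \<phi>] c_def)
    qed
  qed
qed

text \<open>The inclusions obtained for \<open>\<phi>\<close> and for \<open>\<psi>\<close> compose
  to a conjugation of one vertex group into another. By \<open>conj_in_U\<close> it is the identity
  of \<open>U v\<close>, so neither inclusion is proper.\<close>

lemma image_U:
  assumes \<phi>: "mutual_inverse \<phi> \<psi>" and v: "v \<in> V"
  shows "\<exists>w\<in>V. \<exists>k\<in>carrier G. \<phi> ` U v = cj k ` U w"
proof -
  note \<psi> = mutual_inverse_sym[OF \<phi>]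
  obtain a where a: "a \<in> U v" "a \<noteq> \<one>" using U_nontrivial[OF v] by blast
  obtain w k where w: "w \<in> V" "k \<in> carrier G" and wk: "\<And>b. b \<in> U w \<Longrightarrow> \<psi> (cj k b) \<in> U v"
    using image_meets_vertex_group[OF \<phi> v a] by blast
  obtain a' where a': "a' \<in> U w" "a' \<noteq> \<one>" using U_nontrivial[OF w(1)] by blast
  obtain v' k' where v': "v' \<in> V" "k' \<in> carrier G" and vk: "\<And>b. b \<in> U v' \<Longrightarrow> \<phi> (cj k' b) \<in> U w"
    using image_meets_vertex_group[OF \<psi> w(1) a'] by blast
  define r where "r = \<psi> k \<otimes> k'"
  have kc: "\<psi> k \<in> carrier G" using w by (simp add: aut_simps[OF \<psi>])
  have r: "r \<in> carrier G" using kc v' by (simp add: r_def)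
  have r_eq: "cj r b = \<psi> (cj k (\<phi> (cj k' b)))" if "b \<in> U v'" for b
  proof -
    have bc: "b \<in> carrier G" using U_carrier[OF v'(1) that] .
    then show ?thesis
      using w v' kc by (simp add: r_def aut_cj[OF \<psi>] aut_simps(1,2)[OF \<phi>] cj_cj)
  qed
  have in_U: "cj r b \<in> U v" if "b \<in> U v'" for b
    using r_eq[OF that] wk[OF vk[OF that]] by simp
  obtain b where b: "b \<in> U v'" "b \<noteq> \<one>" using U_nontrivial[OF v'(1)] by blast
  have vv: "v' = v" using conj_in_U(1)[OF v'(1) v b r in_U[OF b(1)]] .
  have fixed: "cj r b = b" if "b \<in> U v" for b
    using conj_in_U(2)[OF v v that _ r] in_U that vv r by (cases "b = \<one>") auto
  have "\<phi> ` U v = cj k ` U w"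
  proof
    show "\<phi> ` U v \<subseteq> cj k ` U w"
    proof
      fix x assume "x \<in> \<phi> ` U v"
      then obtain b where b: "b \<in> U v" "x = \<phi> b" by blast
      have bc: "b \<in> carrier G" using U_carrier[OF v b(1)] .
      have "b = \<psi> (cj k (\<phi> (cj k' b)))" using fixed[OF b(1)] r_eq b vv by simp
      then have "\<phi> b = cj k (\<phi> (cj k' b))"
        using w v' bc by (metis aut_simps(1)[OF \<psi>] aut_simps(2)[OF \<phi>] cj_carrier)
      then show "x \<in> cj k ` U w" using vk b vv by blast
    qed
    show "cj k ` U w \<subseteq> \<phi> ` U v"
    proof
      fix x assume "x \<in> cj k ` U w"
      then obtain b where b: "b \<in> U w" "x = cj k b" by blast
      have "x = \<phi> (\<psi> (cj k b))" using b w U_carrier[OF w(1)] by (simp add: aut_simps(1)[OF \<psi>])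
      then show "x \<in> \<phi> ` U v" using wk[OF b(1)] by blast
    qed
  qed
  then show ?thesis using w by blast
qed

text \<open>In terms of the cosets \<open>k s <# gspan (st s)\<close>: those of adjacent vertices
  meet, and \<open>c\<close> is a point common to all of them.\<close>

lemma common_conjugator:
  assumes k: "\<And>s. s \<in> V \<Longrightarrow> k s \<in> carrier G"
    and adj: "\<And>s t. s \<in> V \<Longrightarrow> t \<in> lk s \<Longrightarrow> \<exists>p\<in>gspan (st s). \<exists>q\<in>gspan (st t). inv (k s) \<otimes> k t = p \<otimes> q"
  obtains c where "c \<in> carrier G" "\<And>s. s \<in> V \<Longrightarrow> inv c \<otimes> k s \<in> gspan (st s)"
proof -
  have split: "inv (k s) \<otimes> k t = (inv (k s) \<otimes> k x) \<otimes> (inv (k x) \<otimes> k t)"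
    if "s \<in> V" "t \<in> V" "x \<in> V" for s t x
    using that k by (simp add: m_assoc mult_inv_cancel)
  \<comment> \<open>Passing through a common neighbour \<open>x\<close> gives a product with middle
    factor in \<open>gspan (st x)\<close>. The stars of all common neighbours have at most
    \<open>s\<close> and \<open>t\<close> in common, so \<open>triple_product_Inter\<close> shrinks
    the middle factor.\<close>
  have bridge: "\<exists>p\<in>gspan (st s). \<exists>d\<in>gspan {s, t}. \<exists>q\<in>gspan (st t). inv (k s) \<otimes> k t = p \<otimes> d \<otimes> q"
    if s: "s \<in> V" and t: "t \<in> V" for s t
  proof -
    define \<S> where "\<S> = st ` (lk s \<inter> lk t)"
    have "finite \<S>" using finite_subset[OF lk_subset finite_V] by (simp add: \<S>_def)
    moreover have "\<exists>p\<in>gspan (st s). \<exists>d\<in>gspan S. \<exists>q\<in>gspan (st t). inv (k s) \<otimes> k t = p \<otimes> d \<otimes> q"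
      if "S \<in> \<S>" for S
    proof -
      obtain x where x: "x \<in> lk s" "x \<in> lk t" "S = st x" using \<open>S \<in> \<S>\<close> by (auto simp: \<S>_def)
      have xV: "x \<in> V" using x lk_subset by auto
      obtain p q where 1: "p \<in> gspan (st s)" "q \<in> gspan (st x)" "inv (k s) \<otimes> k x = p \<otimes> q"
        using adj[OF s x(1)] by blast
      obtain q' r where 2: "q' \<in> gspan (st x)" "r \<in> gspan (st t)" "inv (k x) \<otimes> k t = q' \<otimes> r"
        using adj[OF xV lk_sym[OF t x(2)]] by blast
      have "inv (k s) \<otimes> k t = p \<otimes> (q \<otimes> q') \<otimes> r"
        using split[OF s t xV] 1 2 by (simp add: gspan_carrier m_assoc)
      then show ?thesis using 1 2 x(3) gspan_mult by blast
    qed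
    ultimately obtain p d q where pdq: "p \<in> gspan (st s)" "d \<in> gspan (\<Inter>\<S>)" "q \<in> gspan (st t)"
      "inv (k s) \<otimes> k t = p \<otimes> d \<otimes> q"
      using triple_product_Inter[of \<S> "inv (k s) \<otimes> k t" "st s" "st t"] k s t by auto
    have "\<Inter>\<S> \<inter> V \<subseteq> {s, t}"
    proof
      fix z assume z: "z \<in> \<Inter>\<S> \<inter> V"
      show "z \<in> {s, t}"
      proof (rule ccontr)
        assume "z \<notin> {s, t}"
        then obtain x where "x \<in> lk s" "x \<in> lk t" "x \<notin> {z}" "lk x \<inter> {z} = {}"
          using ext_pair[OF s t, of "{z}"] z by auto
        then show False using z by (auto simp: \<S>_def st_def)
      qed
    qed
    then show ?thesis using pdq gspan_mono by blast
  qed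
  have meet: "\<exists>p\<in>gspan (st s). \<exists>q\<in>gspan (st t). inv (k s) \<otimes> k t = p \<otimes> q"
    if s: "s \<in> V" and t: "t \<in> V" for s t
  proof (cases "s = t \<or> t \<in> lk s")
    case True
    then show ?thesis
    proof
      assume "s = t"
      then have "inv (k s) \<otimes> k t = \<one> \<otimes> \<one>" using k s by simp
      then show ?thesis using gspan_one by blast
    qed (use adj s in blast)
  next
    case False
    \<comment> \<open>For non-adjacent \<open>s\<close> and \<open>t\<close> the middle factor
      \<open>d\<close> still has to be split. A detour through a vertex \<open>y\<close> joined to
      \<open>s\<close> but not to \<open>t\<close> gives a second expression for it. Under
      \<open>retr {s, t}\<close> the part on the star of \<open>y\<close> goes into
      \<open>U s\<close> and the part on \<open>{y, t}\<close> goes into \<open>U t\<close>.\<close>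
    have "s \<notin> lk t" using False lk_sym[OF t] by blast
    obtain y where y: "y \<in> lk s" "y \<noteq> t" "t \<notin> lk y" using ext_vertex[of s "{t}"] s t False by auto
    have yV: "y \<in> V" "y \<noteq> s" using y lk_subset by auto
    obtain p d r where pdr: "p \<in> gspan (st s)" "d \<in> gspan {s, t}" "r \<in> gspan (st t)"
      "inv (k s) \<otimes> k t = p \<otimes> d \<otimes> r" using bridge[OF s t] by blast
    obtain p1 q1 where 1: "p1 \<in> gspan (st s)" "q1 \<in> gspan (st y)" "inv (k s) \<otimes> k y = p1 \<otimes> q1"
      using adj[OF s y(1)] by blast
    obtain q2 e r2 where 2: "q2 \<in> gspan (st y)" "e \<in> gspan {y, t}" "r2 \<in> gspan (st t)"
      "inv (k y) \<otimes> k t = q2 \<otimes> e \<otimes> r2" using bridge[OF yV(1) t] by blast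
    note c = pdr(1-3)[THEN gspan_carrier] 1(1,2)[THEN gspan_carrier] 2(1-3)[THEN gspan_carrier]
    have "p \<otimes> d \<otimes> r = p1 \<otimes> q1 \<otimes> (q2 \<otimes> e \<otimes> r2)"
      using split[OF s t yV(1)] pdr 1 2 by simp
    then have "inv p \<otimes> (p \<otimes> d \<otimes> r) \<otimes> inv r = inv p \<otimes> (p1 \<otimes> q1 \<otimes> (q2 \<otimes> e \<otimes> r2)) \<otimes> inv r" by simp
    then have d: "d = (inv p \<otimes> p1) \<otimes> (q1 \<otimes> q2) \<otimes> (e \<otimes> (r2 \<otimes> inv r))"
      using c by (simp add: m_assoc mult_inv_cancel)
    let ?R = "retr {s, t}"
    have "d = ?R d" using retr_id[OF pdr(2)] by simp
    also have "\<dots> = ?R (inv p \<otimes> p1) \<otimes> ?R (q1 \<otimes> q2) \<otimes> ?R (e \<otimes> (r2 \<otimes> inv r))"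
      unfolding d using c by simp
    finally have d_eq: "d = ?R (inv p \<otimes> p1) \<otimes> ?R (q1 \<otimes> q2) \<otimes> ?R (e \<otimes> (r2 \<otimes> inv r))" .
    have "{s, t} \<inter> st s \<subseteq> st s" "{s, t} \<inter> st y \<inter> V \<subseteq> st s"
      "{s, t} \<inter> {y, t} \<inter> V \<subseteq> st t" "{s, t} \<inter> st t \<inter> V \<subseteq> st t"
      using False y yV by (auto simp: st_def)
    note sub = gspan_mono[OF this(2)] gspan_mono[OF this(3)] gspan_mono[OF this(4)] gspan_mono[of "{s, t} \<inter> st s" "st s"]
    have "?R (inv p \<otimes> p1) \<in> gspan (st s)"
      using retr_span[of "inv p \<otimes> p1" "st s" "{s, t}"] sub pdr 1 gspan_mult gspan_inv by blast
    moreover have "?R (q1 \<otimes> q2) \<in> gspan (st s)"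
      using retr_span[of "q1 \<otimes> q2" "st y" "{s, t}"] sub 1 2 gspan_mult by blast
    ultimately have f1: "?R (inv p \<otimes> p1) \<otimes> ?R (q1 \<otimes> q2) \<in> gspan (st s)" by (rule gspan_mult)
    have "?R e \<in> gspan (st t)" using retr_span[OF 2(2), of "{s, t}"] sub by blast
    moreover have "?R (r2 \<otimes> inv r) \<in> gspan (st t)"
      using retr_span[of "r2 \<otimes> inv r" "st t" "{s, t}"] sub pdr 2 gspan_mult gspan_inv by blast
    ultimately have f2: "?R (e \<otimes> (r2 \<otimes> inv r)) \<in> gspan (st t)"
      using c gspan_mult by simp
    have "inv (k s) \<otimes> k t = (p \<otimes> (?R (inv p \<otimes> p1) \<otimes> ?R (q1 \<otimes> q2))) \<otimes> (?R (e \<otimes> (r2 \<otimes> inv r)) \<otimes> r)"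
      unfolding pdr(4) by (subst d_eq) (use c gspan_carrier[OF f1] gspan_carrier[OF f2] in \<open>simp add: m_assoc\<close>)
    then show ?thesis using gspan_mult[OF pdr(1) f1] gspan_mult[OF f2 pdr(3)] by blast
  qed
  \<comment> \<open>The point \<open>c\<close> common to the earlier cosets is moved by an element
    \<open>e\<close> spanned by the intersection of their stars: this reaches the coset of
    \<open>t\<close> without leaving the others. \<open>triple_product_Inter\<close> with trivial
    left factor provides \<open>e\<close>.\<close>
  have helly: "\<exists>c\<in>carrier G. \<forall>s\<in>F. inv c \<otimes> k s \<in> gspan (st s)" if "finite F" "F \<subseteq> V" for F
    using that
  proof (induction rule: finite_induct)
    case empty
    then show ?case by (auto intro: bexI[of _ \<one>])
  next
    case (insert t F)
    then obtain c where c: "c \<in> carrier G" "\<And>s. s \<in> F \<Longrightarrow> inv c \<otimes> k s \<in> gspan (st s)" by auto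
    have tV: "t \<in> V" using insert by auto
    define g where "g = inv c \<otimes> k t"
    have gc: "g \<in> carrier G" using c k tV by (simp add: g_def)
    have "\<exists>p\<in>gspan {}. \<exists>s\<in>gspan (\<Inter>(st ` F)). \<exists>q\<in>gspan (st t). g = p \<otimes> s \<otimes> q"
    proof (rule triple_product_Inter[OF _ gc])
      show "finite (st ` F)" using insert by simp
      fix S assume "S \<in> st ` F"
      then obtain s where s: "s \<in> F" "S = st s" by blast
      have sV: "s \<in> V" using s insert by auto
      obtain p q where pq: "p \<in> gspan (st s)" "q \<in> gspan (st t)" "inv (k s) \<otimes> k t = p \<otimes> q"
        using meet[OF sV tV] by blast
      have "g = (inv c \<otimes> k s) \<otimes> (inv (k s) \<otimes> k t)"
        using c k sV tV by (simp add: g_def m_assoc mult_inv_cancel)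
      then have "g = \<one> \<otimes> ((inv c \<otimes> k s) \<otimes> p) \<otimes> q"
        using pq c(1) k sV by (simp add: gspan_carrier m_assoc)
      then show "\<exists>p\<in>gspan {}. \<exists>x\<in>gspan S. \<exists>q\<in>gspan (st t). g = p \<otimes> x \<otimes> q"
        using gspan_one gspan_mult[OF c(2)[OF s(1)] pq(1)] pq(2) s(2) by blast
    qed
    then obtain e q where e: "e \<in> gspan (\<Inter>(st ` F))" "q \<in> gspan (st t)" "g = e \<otimes> q"
      by (auto simp: gspan_empty gspan_carrier)
    have ec: "e \<in> carrier G" using e gspan_carrier by blast
    have "inv (c \<otimes> e) \<otimes> k s = inv e \<otimes> (inv c \<otimes> k s)" if "s \<in> V" for s
      using c ec k that by (simp add: inv_mult_group m_assoc)
    note step = this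
    show ?case
    proof (intro bexI ballI)
      show "c \<otimes> e \<in> carrier G" using c ec by simp
      fix s assume s: "s \<in> insert t F"
      have sV: "s \<in> V" using s insert by auto
      show "inv (c \<otimes> e) \<otimes> k s \<in> gspan (st s)"
      proof (cases "s = t")
        case True
        then show ?thesis using step[OF sV] e ec by (simp add: g_def[symmetric] gspan_carrier mult_inv_cancel)
      next
        case False
        then have sF: "s \<in> F" using s by simp
        then have "e \<in> gspan (st s)" using e(1) gspan_mono[of "\<Inter>(st ` F)" "st s"] by blast
        then show ?thesis unfolding step[OF sV] using c(2)[OF sF] gspan_mult gspan_inv by blast
      qed
    qed
  qed
  from helly[OF finite_V subset_refl] show thesis using that by blast
qed

theorem aut_normal_form:
  assumes \<phi>: "mutual_inverse \<phi> \<psi>"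
  obtains c where "c \<in> carrier G" "\<And>v. v \<in> V \<Longrightarrow> \<exists>w\<in>V. \<phi> ` U v = cj c ` U w"
proof -
  note \<psi> = mutual_inverse_sym[OF \<phi>]
  obtain \<sigma> l where \<sigma>: "\<And>v. v \<in> V \<Longrightarrow> \<sigma> v \<in> V" and l: "\<And>v. v \<in> V \<Longrightarrow> l v \<in> carrier G"
    and im: "\<And>v. v \<in> V \<Longrightarrow> \<phi> ` U v = cj (l v) ` U (\<sigma> v)"
    using image_U[OF \<phi>] by metis
  have preim: "\<exists>a'\<in>U v. cj (l v) a = \<phi> a'" if "v \<in> V" "a \<in> U (\<sigma> v)" for v a
    using im[OF that(1)] that(2) by blast
  have "inj_on \<sigma> V"
  proof (rule inj_onI)
    fix v v' assume v: "v \<in> V" "v' \<in> V" and eq: "\<sigma> v = \<sigma> v'"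
    obtain a where a: "a \<in> U (\<sigma> v)" "a \<noteq> \<one>" using U_nontrivial[OF \<sigma>[OF v(1)]] by blast
    have ac: "a \<in> carrier G" using U_carrier[OF \<sigma>[OF v(1)] a(1)] .
    obtain b where b: "b \<in> U v" "cj (l v) a = \<phi> b" using preim[OF v(1) a(1)] by blast
    obtain b' where b': "b' \<in> U v'" "cj (l v') a = \<phi> b'" using preim[OF v(2)] a(1) eq by auto
    have bc: "b \<in> carrier G" "b' \<in> carrier G" using b b' v U_carrier by auto
    have "cj (l v) a \<noteq> \<one>" using a ac l v by (simp add: cj_eq_one)
    then have "b \<noteq> \<one>" using b by (auto simp: aut_simps[OF \<phi>])
    define r where "r = l v' \<otimes> inv (l v)"
    have r: "r \<in> carrier G" using l v by (simp add: r_def)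
    have "cj r (\<phi> b) = \<phi> b'"
      using b b' l v ac by (simp add: r_def cj_cj m_assoc flip: b(2) b'(2))
    then have "\<psi> (cj r (\<phi> b)) = b'" using bc by (simp add: aut_simps(1)[OF \<phi>])
    then have "cj (\<psi> r) b = b'" using r bc by (simp add: aut_cj[OF \<psi>] aut_simps(1,2)[OF \<phi>])
    then show "v = v'"
      using conj_in_U(1)[OF v b(1) \<open>b \<noteq> \<one>\<close>, of "\<psi> r"] b' r by (simp add: aut_simps(2)[OF \<psi>])
  qed
  then have bij: "bij_betw \<sigma> V V"
    using \<sigma> finite_V by (simp add: bij_betw_def endo_inj_surj image_subsetI)
  define \<tau> where "\<tau> = inv_into V \<sigma>"
  have \<tau>: "\<tau> s \<in> V" "\<sigma> (\<tau> s) = s" if "s \<in> V" for s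
    using that bij by (auto simp: \<tau>_def bij_betw_def inv_into_into f_inv_into_f)
  \<comment> \<open>\<open>k s\<close> conjugates \<open>U s\<close> onto the image of the vertex
    group \<open>U (\<tau> s)\<close>; \<open>common_conjugator\<close> will replace all of these by
    one element.\<close>
  define k where "k s = l (\<tau> s)" for s
  have k: "k s \<in> carrier G" if "s \<in> V" for s using l \<tau> that by (simp add: k_def)
  have pre: "\<exists>a'\<in>U (\<tau> s). a' \<noteq> \<one> \<and> cj (k s) a = \<phi> a'" if "s \<in> V" "a \<in> U s" "a \<noteq> \<one>" for s a
  proof -
    obtain a' where a': "a' \<in> U (\<tau> s)" "cj (k s) a = \<phi> a'"
      using preim[of "\<tau> s" a] \<tau>[OF \<open>s \<in> V\<close>] \<open>a \<in> U s\<close> by (auto simp: k_def)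
    moreover have "cj (k s) a \<noteq> \<one>" using that k U_carrier by (simp add: cj_eq_one)
    ultimately have "a' \<noteq> \<one>" using aut_simps(5)[OF \<phi>] by auto
    then show ?thesis using a' by blast
  qed
  \<comment> \<open>Adjacency is first carried back: \<open>a\<close> and \<open>b\<close> commute,
    so do their images under \<open>\<psi>\<close>, and \<open>\<tau> s\<close> and
    \<open>\<tau> t\<close> are adjacent. Hence \<open>a'\<close> and \<open>b'\<close> commute, and
    applying \<open>\<phi>\<close> shows that the conjugates of \<open>a\<close> by
    \<open>k s\<close> and of \<open>b\<close> by \<open>k t\<close> commute.\<close>
  have "\<exists>p\<in>gspan (st s). \<exists>q\<in>gspan (st t). inv (k s) \<otimes> k t = p \<otimes> q" if s: "s \<in> V" and t: "t \<in> lk s" for s t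
  proof -
    have tV: "t \<in> V" and ts: "t \<noteq> s" using t lk_subset by auto
    obtain a where a: "a \<in> U s" "a \<noteq> \<one>" using U_nontrivial[OF s] by blast
    obtain b where b: "b \<in> U t" "b \<noteq> \<one>" using U_nontrivial[OF tV] by blast
    have ac: "a \<in> carrier G" "b \<in> carrier G" using U_carrier a b s tV by auto
    obtain a' where a': "a' \<in> U (\<tau> s)" "a' \<noteq> \<one>" "cj (k s) a = \<phi> a'" using pre[OF s a] by blast
    obtain b' where b': "b' \<in> U (\<tau> t)" "b' \<noteq> \<one>" "cj (k t) b = \<phi> b'" using pre[OF tV b] by blast
    have c': "a' \<in> carrier G" "b' \<in> carrier G" using a' b' U_carrier \<tau> s tV by auto
    have ab: "a \<otimes> b = b \<otimes> a" using U_adjacent[OF s tV _ a(1) b(1)] t by (simp add: lk_def)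
    have pk: "\<psi> (k s) \<in> carrier G" "\<psi> (k t) \<in> carrier G" using k s tV by (simp_all add: aut_simps[OF \<psi>])
    have pa: "\<psi> a = cj (inv (\<psi> (k s))) a'" and pb: "\<psi> b = cj (inv (\<psi> (k t))) b'"
    proof -
      have "cj (\<psi> (k s)) (\<psi> a) = \<psi> (cj (k s) a)" using k s ac by (simp add: aut_cj[OF \<psi>])
      also have "\<dots> = a'" using c' by (simp add: a'(3) aut_simps(1)[OF \<phi>])
      finally show "\<psi> a = cj (inv (\<psi> (k s))) a'"
        using cj_cancel(1)[OF pk(1), of "\<psi> a"] ac by (simp add: aut_simps(2)[OF \<psi>])
      have "cj (\<psi> (k t)) (\<psi> b) = \<psi> (cj (k t) b)" using k tV ac by (simp add: aut_cj[OF \<psi>])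
      also have "\<dots> = b'" using c' by (simp add: b'(3) aut_simps(1)[OF \<phi>])
      finally show "\<psi> b = cj (inv (\<psi> (k t))) b'"
        using cj_cancel(1)[OF pk(2), of "\<psi> b"] ac by (simp add: aut_simps(2)[OF \<psi>])
    qed
    have "\<tau> s \<noteq> \<tau> t" using \<tau>(2)[OF s] \<tau>(2)[OF tV] ts by metis
    moreover have "cj (inv (\<psi> (k s))) a' \<otimes> cj (inv (\<psi> (k t))) b' = cj (inv (\<psi> (k t))) b' \<otimes> cj (inv (\<psi> (k s))) a'"
      using aut_commute[OF \<psi> ac ab] by (simp add: pa pb)
    ultimately have "\<tau> t \<in> lk (\<tau> s)"
      by (rule conj_commute_adjacent(1)[OF \<tau>(1)[OF s] \<tau>(1)[OF tV] _ a'(1,2) b'(1,2)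
            inv_closed[OF pk(1)] inv_closed[OF pk(2)]])
    then have "a' \<otimes> b' = b' \<otimes> a'"
      using U_adjacent[OF \<tau>(1)[OF s] \<tau>(1)[OF tV] _ a'(1) b'(1)] by (simp add: lk_def)
    from aut_commute[OF \<phi> c' this] have "cj (k s) a \<otimes> cj (k t) b = cj (k t) b \<otimes> cj (k s) a"
      by (simp add: a'(3) b'(3))
    from conj_commute_adjacent(2)[OF s tV ts[symmetric] a b k[OF s] k[OF tV] this] show ?thesis .
  qed
  from common_conjugator[of k, OF k this] obtain c where
    c: "c \<in> carrier G" "\<And>s. s \<in> V \<Longrightarrow> inv c \<otimes> k s \<in> gspan (st s)" by blast
  show thesis
  proof (rule that[OF c(1)])
    fix v assume v: "v \<in> V"
    define s where "s = \<sigma> v"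
    have s: "s \<in> V" using \<sigma> v by (simp add: s_def)
    have "\<tau> s = v" using v bij by (simp add: s_def \<tau>_def bij_betw_def)
    then have "\<phi> ` U v = cj (k s) ` U s" using im[OF v] by (simp add: k_def s_def)
    \<comment> \<open>\<open>k s\<close> and \<open>c\<close> differ by an element of
      \<open>gspan (st s)\<close>, which commutes with \<open>U s\<close>.\<close>
    moreover have "cj (k s) b = cj c b" if b: "b \<in> U s" for b
    proof -
      have bc: "b \<in> carrier G" using U_carrier[OF s b] .
      have "cj (inv c \<otimes> k s) b = b"
        using U_span_st[OF s b c(2)[OF s]] c(1) k[OF s] bc by (simp add: cj_eq_iff_commute)
      then have "cj c (cj (inv c \<otimes> k s) b) = cj c b" by simp
      then show ?thesis using c(1) k[OF s] bc by (simp add: cj_cj mult_inv_cancel)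
    qed
    ultimately have "\<phi> ` U v = cj c ` U s" by (auto simp: image_iff)
    then show "\<exists>w\<in>V. \<phi> ` U v = cj c ` U w" using s by blast
  qed
qed

end

section \<open>Finiteness of the outer automorphism group\<close>

text \<open>In the infinite case exponents are unique, so a generator is the power of
  \<open>a\<close> with exponent a unit of the integers.\<close>

lemma (in group) finite_cyclic_generators:
  assumes a: "a \<in> carrier G"
  shows "finite {b \<in> carrier G. range (\<lambda>n::int. b [^] n) = range (\<lambda>n::int. a [^] n)}"
proof -
  have mem: "b \<in> range (\<lambda>n::int. b [^] n)" if "b \<in> carrier G" for b
    using that by (intro range_eqI[of _ _ 1]) simp
  show ?thesis
  proof (cases "finite (range (\<lambda>n::int. a [^] n))")
    case True
    show ?thesis
    proof (rule finite_subset[OF _ True], rule subsetI)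
      fix b assume "b \<in> {b \<in> carrier G. range (\<lambda>n::int. b [^] n) = range (\<lambda>n::int. a [^] n)}"
      then show "b \<in> range (\<lambda>n::int. a [^] n)" using mem[of b] by (simp only: mem_Collect_eq)
    qed
  next
    case False
    then have inj: "i = j" if "a [^] i = a [^] j" for i j :: int
      using infinite_cyclic_subgroup_int[OF a] that
      unfolding carrier_subgroup_generated_by_singleton[OF a] by blast
    show ?thesis
    proof (rule finite_subset[of _ "{a [^] (1::int), a [^] (-1::int)}"], rule subsetI)
      fix b assume "b \<in> {b \<in> carrier G. range (\<lambda>n::int. b [^] n) = range (\<lambda>n::int. a [^] n)}"
      then have b: "b \<in> carrier G" and eq: "range (\<lambda>n::int. b [^] n) = range (\<lambda>n::int. a [^] n)"
        by (simp_all only: mem_Collect_eq)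
      obtain m :: int where m: "b = a [^] m" using mem[OF b] unfolding eq by (rule rangeE)
      obtain n :: int where n: "a = b [^] n" using mem[OF a] unfolding eq[symmetric] by (rule rangeE)
      have "a [^] (m * n) = b [^] n" unfolding m using a by (simp add: int_pow_pow)
      also have "\<dots> = a [^] (1::int)" unfolding n[symmetric] using a by simp
      finally have "m * n = 1" by (rule inj)
      then have "m = 1 \<or> m = -1" by (auto simp: zmult_eq_1_iff)
      then show "b \<in> {a [^] (1::int), a [^] (-1::int)}" unfolding m by blast
    qed simp
  qed
qed

lemma (in group) hom_eq_on_generate:
  assumes "\<phi> \<in> hom G G" "\<psi> \<in> hom G G" "A \<subseteq> carrier G" "\<And>a. a \<in> A \<Longrightarrow> \<phi> a = \<psi> a" "x \<in> generate G A"
  shows "\<phi> x = \<psi> x"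
proof -
  interpret p: group_hom G G \<phi> by unfold_locales (rule assms)
  interpret q: group_hom G G \<psi> by unfold_locales (rule assms)
  show ?thesis using assms(5)
  proof (induction rule: generate.induct)
    case (inv h)
    then have "h \<in> carrier G" using assms(3) by blast
    then show ?case using inv assms(4) by simp
  next
    case (eng g h)
    then show ?case using generate_in_carrier[OF assms(3)] by simp
  qed (use assms in auto)
qed

lemma (in generic_graph_product) finite_Out:
  assumes cyclic: "\<And>v. v \<in> V \<Longrightarrow> \<exists>a\<in>U v. U v = range (\<lambda>n::int. a [^] n)"
  shows "finite (carrier (Out G))"
proof -
  interpret A: group "AutoGroup G" by (rule AutoGroup)
  have carA: "carrier (AutoGroup G) = auto G" by (simp add: AutoGroup_def)
  obtain a where a: "a v \<in> U v" "U v = range (\<lambda>n::int. a v [^] n)" if "v \<in> V" for v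
    using cyclic by metis
  have ac: "a v \<in> carrier G" if "v \<in> V" for v using a[OF that] U_carrier that by blast
  \<comment> \<open>Every coset of \<open>Inn G\<close> will be represented by an element of
    \<open>T\<close>, so finiteness of \<open>T\<close> suffices.\<close>
  define T where "T = {\<phi> \<in> auto G. \<forall>v\<in>V. \<exists>w\<in>V. \<phi> ` U v = U w}"
  have hom: "\<phi> \<in> hom G G" and ext: "\<phi> \<in> extensional (carrier G)" if "\<phi> \<in> auto G" for \<phi>
    using that by (auto simp: auto_def Bij_def)
  have hom_pow: "\<phi> (x [^] (n::int)) = \<phi> x [^] n" if "\<phi> \<in> auto G" "x \<in> carrier G" for \<phi> x n
    using hom_int_pow[OF hom[OF that(1)] that(2) is_group is_group] .
  have finT: "finite T"
  proof (rule inj_on_finite)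
    show "inj_on (\<lambda>\<phi>. \<lambda>v\<in>V. \<phi> (a v)) T"
    proof (rule inj_onI)
      fix \<phi> \<psi> assume T: "\<phi> \<in> T" "\<psi> \<in> T" and eq: "(\<lambda>v\<in>V. \<phi> (a v)) = (\<lambda>v\<in>V. \<psi> (a v))"
      have au: "\<phi> \<in> auto G" "\<psi> \<in> auto G" using T by (auto simp: T_def)
      have eqa: "\<phi> (a v) = \<psi> (a v)" if "v \<in> V" for v using fun_cong[OF eq, of v] that by simp
      have "\<phi> x = \<psi> x" if "v \<in> V" "x \<in> U v" for v x
        using that(2) unfolding a(2)[OF that(1)]
        by (auto simp: eqa[OF that(1)] hom_pow[OF au(1) ac[OF that(1)]] hom_pow[OF au(2) ac[OF that(1)]])
      then have "\<phi> x = \<psi> x" if "x \<in> carrier G" for x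
        using hom_eq_on_generate[OF hom[OF au(1)] hom[OF au(2)], of "\<Union>v\<in>V. U v" x] that U_carrier
        by (auto simp: U_generate[symmetric])
      then show "\<phi> = \<psi>" using extensionalityI[OF ext[OF au(1)] ext[OF au(2)]] by blast
    qed
    show "(\<lambda>\<phi>. \<lambda>v\<in>V. \<phi> (a v)) ` T \<subseteq>
        PiE V (\<lambda>_. \<Union>w\<in>V. {b \<in> carrier G. range (\<lambda>n::int. b [^] n) = U w})"
    proof (clarify, rule PiE_I)
      fix \<phi> v assume T: "\<phi> \<in> T" and v: "v \<in> V"
      then obtain w where w: "w \<in> V" "\<phi> ` U v = U w" by (auto simp: T_def)
      have au: "\<phi> \<in> auto G" using T by (simp add: T_def)
      have "U w = range (\<lambda>n::int. \<phi> (a v) [^] n)"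
        using w(2) a(2)[OF v] hom_pow[OF au ac[OF v]] by (auto simp: image_image)
      moreover have "\<phi> (a v) \<in> carrier G" using hom_in_carrier[OF hom[OF au] ac[OF v]] .
      ultimately show "(\<lambda>v\<in>V. \<phi> (a v)) v \<in> (\<Union>w\<in>V. {b \<in> carrier G. range (\<lambda>n::int. b [^] n) = U w})"
        using w v by auto
    qed auto
    show "finite (PiE V (\<lambda>_. \<Union>w\<in>V. {b \<in> carrier G. range (\<lambda>n::int. b [^] n) = U w}))"
      using finite_V finite_cyclic_generators[OF ac] by (intro finite_PiE finite_UN_I) (simp_all add: a(2))
  qed
  have "carrier (Out G) \<subseteq> (\<lambda>\<phi>. Inn G #>\<^bsub>AutoGroup G\<^esub> \<phi>) ` T"
  proof
    fix C assume "C \<in> carrier (Out G)"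
    then obtain \<phi> where \<phi>: "\<phi> \<in> auto G" "C = Inn G #>\<^bsub>AutoGroup G\<^esub> \<phi>"
      by (auto simp: Out_def carrier_FactGroup carA)
    define \<psi> where "\<psi> = inv\<^bsub>AutoGroup G\<^esub> \<phi>"
    have \<psi>: "\<psi> \<in> auto G" using \<phi>(1) A.inv_closed by (simp add: \<psi>_def carA)
    have mult: "(f \<otimes>\<^bsub>AutoGroup G\<^esub> h) x = f (h x)" if "f \<in> auto G" "h \<in> auto G" "x \<in> carrier G" for f h x
      using that by (simp add: AutoGroup_def BijGroup_def auto_def compose_eq)
    have one: "\<one>\<^bsub>AutoGroup G\<^esub> x = x" if "x \<in> carrier G" for x
      using that by (simp add: AutoGroup_def BijGroup_def)
    have "mutual_inverse \<phi> \<psi>"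
      unfolding mutual_inverse_def
      using hom \<phi>(1) \<psi> mult[OF \<psi> \<phi>(1)] mult[OF \<phi>(1) \<psi>] A.l_inv[of \<phi>] A.r_inv[of \<phi>] one
      by (simp add: carA \<psi>_def)
    then obtain c where c: "c \<in> carrier G" "\<And>v. v \<in> V \<Longrightarrow> \<exists>w\<in>V. \<phi> ` U v = cj c ` U w"
      using aut_normal_form by metis
    define i where "i = (\<lambda>x\<in>carrier G. inv c \<otimes> x \<otimes> inv (inv c))"
    have i: "i \<in> Inn G" unfolding Inn_def i_def using inv_closed[OF c(1)] by blast
    have sub: "subgroup (Inn G) (AutoGroup G)"
      using Inn_normal[OF is_group] by (rule normal_imp_subgroup)
    have ia: "i \<in> auto G" using subgroup.mem_carrier[OF sub i] by (simp add: carA)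
    define \<phi>' where "\<phi>' = i \<otimes>\<^bsub>AutoGroup G\<^esub> \<phi>"
    have \<phi>': "\<phi>' \<in> auto G" using A.m_closed[of i \<phi>] ia \<phi>(1) by (simp add: \<phi>'_def carA)
    have "\<phi>' \<in> Inn G #>\<^bsub>AutoGroup G\<^esub> \<phi>" using i by (auto simp: r_coset_def \<phi>'_def)
    then have C: "C = Inn G #>\<^bsub>AutoGroup G\<^esub> \<phi>'"
      using A.repr_independence[of \<phi>' "Inn G" \<phi>] sub \<phi> by (simp add: carA)
    have val: "\<phi>' x = cj (inv c) (\<phi> x)" if "x \<in> carrier G" for x
      using mult[OF ia \<phi>(1) that] hom_in_carrier[OF hom[OF \<phi>(1)] that]
      by (simp add: \<phi>'_def i_def cj_def)
    have "\<exists>w\<in>V. \<phi>' ` U v = U w" if v: "v \<in> V" for v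
    proof -
      obtain w where w: "w \<in> V" "\<phi> ` U v = cj c ` U w" using c(2)[OF v] by blast
      have "\<phi>' ` U v = cj (inv c) ` \<phi> ` U v"
        using val U_carrier[OF v] by (auto simp: image_image intro!: image_cong)
      also have "\<dots> = (\<lambda>b. b) ` U w"
        unfolding w(2) image_image using U_carrier[OF w(1)] c(1) by (intro image_cong) auto
      finally show ?thesis using w(1) by auto
    qed
    then have "\<phi>' \<in> T" using \<phi>' by (auto simp: T_def)
    then show "C \<in> (\<lambda>\<phi>. Inn G #>\<^bsub>AutoGroup G\<^esub> \<phi>) ` T" using C by blast
  qed
  then show ?thesis using finT finite_surj by blast
qed

section \<open>Graph products as instances of the abstract setting\<close>

lemma graph_product_is_graph_product_group:
  assumes V: "finite V" and loops: "\<And>v. {v} \<notin> E"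
    and G: "\<And>v. v \<in> V \<Longrightarrow> group (G v)" and comm: "\<And>v. v \<in> V \<Longrightarrow> comm_group (G v)"
    and nontriv: "\<And>v. v \<in> V \<Longrightarrow> \<not> trivial_group (G v)"
  shows "graph_product_group (graph_product V E G) V E (\<lambda>v. gp_inj V E G v ` carrier (G v))"
proof -
  let ?P = "graph_product V E G" and ?j = "gp_inj V E G"
  interpret P: group ?P using G by (rule group_graph_product)
  have j_hom: "?j v \<in> hom (G v) ?P" if "v \<in> V" for v
    using gp_inj_hom[where V = V and G = G] G that by blast
  have j_group_hom: "group_hom (G v) ?P (?j v)" if "v \<in> V" for v
    using G[OF that] j_hom[OF that] P.is_group by (simp add: group_hom_def group_hom_axioms_def)
  have inj: "inj_on (?j v) (carrier (G v))" if "v \<in> V" for v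
    using gp_inj_injective[where V = V and G = G] G that loops by blast
  \<comment> \<open>The target is arbitrary, of any type, so that this one statement yields both
    \<open>lift_endo\<close> and \<open>lift_perm\<close>.\<close>
  have lift: "\<exists>F\<in>hom ?P K. \<forall>v\<in>V. \<forall>a\<in>?j v ` carrier (G v). F a = f v a"
    if K: "group K" and f: "\<And>v. v \<in> V \<Longrightarrow> f v \<in> hom (?P\<lparr>carrier := ?j v ` carrier (G v)\<rparr>) K"
      and fcomm: "\<And>v w a b. v \<in> V \<Longrightarrow> w \<in> V \<Longrightarrow> {v, w} \<in> E \<Longrightarrow> a \<in> ?j v ` carrier (G v) \<Longrightarrow>
        b \<in> ?j w ` carrier (G w) \<Longrightarrow> f v a \<otimes>\<^bsub>K\<^esub> f w b = f w b \<otimes>\<^bsub>K\<^esub> f v a"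
    for K :: "('x, 'y) monoid_scheme" and f
  proof -
    have "(\<lambda>a. f v (?j v a)) \<in> hom (G v) K" if v: "v \<in> V" for v
    proof (rule homI)
      fix a b assume "a \<in> carrier (G v)" "b \<in> carrier (G v)"
      then show "f v (?j v (a \<otimes>\<^bsub>G v\<^esub> b)) = f v (?j v a) \<otimes>\<^bsub>K\<^esub> f v (?j v b)"
        using f[OF v] j_hom[OF v] by (auto simp: hom_def)
    qed (use f[OF v] in \<open>auto simp: hom_def\<close>)
    note f_hom = this
    show ?thesis
    proof (rule graph_product_lift[where V = V and G = G and E = E and K = K and f = "\<lambda>v a. f v (?j v a)"])
      fix F assume "F \<in> hom ?P K" "\<And>v a. v \<in> V \<Longrightarrow> a \<in> carrier (G v) \<Longrightarrow> F (?j v a) = f v (?j v a)"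
      then show ?thesis by blast
    qed (erule G | rule K | erule f_hom | (rule fcomm; (assumption | erule imageI)))+
  qed
  show ?thesis
  proof (intro graph_product_group.intro graph_product_group_axioms.intro P.is_group, goal_cases)
    case (3 v)
    interpret group_hom "G v" ?P "?j v" by (rule j_group_hom[OF 3])
    show ?case by (rule img_is_subgroup)
  next
    case (4 v a b)
    interpret group_hom "G v" ?P "?j v" by (rule j_group_hom[OF 4(1)])
    interpret c: comm_group "G v" by (rule comm[OF 4(1)])
    obtain x y where "x \<in> carrier (G v)" "y \<in> carrier (G v)" "a = ?j v x" "b = ?j v y" using 4 by blast
    then show ?case using c.m_comm[of x y] hom_mult[of x y] hom_mult[of y x] by simp
  next
    case (5 v w a b)
    obtain x y where "x \<in> carrier (G v)" "y \<in> carrier (G w)" "a = ?j v x" "b = ?j w y" using 5 by blast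
    then show ?case using gp_inj_commute[of V G v w E x y, OF G] 5 by simp
  next
    case (6 v)
    interpret group_hom "G v" ?P "?j v" by (rule j_group_hom[OF 6])
    obtain a where a: "a \<in> carrier (G v)" "a \<noteq> \<one>\<^bsub>G v\<^esub>"
      using nontriv[OF 6] group.trivial_group_subset[OF G[OF 6]] by auto
    then have "?j v a \<noteq> ?j v \<one>\<^bsub>G v\<^esub>" using inj[OF 6] by (auto simp: inj_on_def)
    then show ?case using a by auto
  next
    case 7
    show ?case by (rule graph_product_generate) (rule G)
  next
    case (8 f)
    show ?case by (rule lift[OF P.is_group 8])
  next
    case (9 p R)
    show ?case by (rule lift[OF group_BijGroup 9])
  qed (use V loops in auto)
qed

theorem finite_Out_graph_product:
  assumes V: "finite V" and loops: "\<And>v. {v} \<notin> E"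
    and G: "\<And>v. v \<in> V \<Longrightarrow> group (G v)" and cyclic: "\<And>v. v \<in> V \<Longrightarrow> cyclic_group (G v)"
    and nontriv: "\<And>v. v \<in> V \<Longrightarrow> \<not> trivial_group (G v)"
    and ext: "\<And>S T. \<lbrakk>S \<subseteq> V; T \<subseteq> V; S \<inter> T = {}; card S \<le> 2; card T \<le> 3\<rbrakk>
      \<Longrightarrow> \<exists>z\<in>V - S - T. (\<forall>s\<in>S. {z, s} \<in> E) \<and> (\<forall>t\<in>T. {z, t} \<notin> E)"
  shows "finite (carrier (Out (graph_product V E G)))"
proof -
  interpret graph_product_group "graph_product V E G" V E "\<lambda>v. gp_inj V E G v ` carrier (G v)"
    by (rule graph_product_is_graph_product_group[OF V loops G])
       (simp_all add: G cyclic nontriv group.cyclic_imp_abelian_group)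
  interpret generic_graph_product "graph_product V E G" V E "\<lambda>v. gp_inj V E G v ` carrier (G v)"
  proof (unfold_locales, goal_cases)
    case (1 S T)
    from ext[OF this] show ?case using 1 by (auto simp: lk_def)
  qed
  show ?thesis
  proof (rule finite_Out)
    fix v assume v: "v \<in> V"
    have hom: "gp_inj V E G v \<in> hom (G v) (graph_product V E G)"
      using gp_inj_hom[where V = V and G = G] G v by blast
    obtain a where a: "a \<in> carrier (G v)" "carrier (G v) = range (\<lambda>n::int. a [^]\<^bsub>G v\<^esub> n)"
      using group.cyclic_group[OF G[OF v]] cyclic[OF v] by auto
    have "gp_inj V E G v ` carrier (G v) = range (\<lambda>n::int. gp_inj V E G v a [^]\<^bsub>graph_product V E G\<^esub> n)"
      using hom_int_pow[OF hom a(1) G[OF v] is_group] by (subst a(2)) (simp add: image_image)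
    then show "\<exists>a\<in>gp_inj V E G v ` carrier (G v).
        gp_inj V E G v ` carrier (G v) = range (\<lambda>n::int. a [^]\<^bsub>graph_product V E G\<^esub> n)"
      using a(1) by blast
  qed
qed

section \<open>The extension property of random graphs\<close>

definition star_pattern :: "nat \<Rightarrow> nat set \<Rightarrow> nat set \<Rightarrow> nat set set \<Rightarrow> bool" where
  "star_pattern z S T \<Gamma> \<longleftrightarrow> (\<forall>s\<in>S. {z, s} \<in> \<Gamma>) \<and> (\<forall>t\<in>T. {z, t} \<notin> \<Gamma>)"

lemma finite_complete_edges: "finite (complete_edges n)"
  by (auto simp: complete_edges_def)

text \<open>The edges from \<open>z\<close> to the vertices of \<open>S\<close> and \<open>T\<close>
  are pairwise distinct, so the event fixes \<open>card S + card T\<close> independent coordinates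
  and leaves the others free.\<close>

lemma prob_star_pattern:
  assumes p: "0 \<le> p" "p \<le> 1" and ST: "S \<subseteq> {1..n}" "T \<subseteq> {1..n}" "S \<inter> T = {}"
    and z: "z \<in> {1..n} - S - T"
  shows "measure_pmf.prob (Pi_pmf (complete_edges n) False (\<lambda>_. bernoulli_pmf p))
    {f. (\<forall>s\<in>S. f {z, s}) \<and> (\<forall>t\<in>T. \<not> f {z, t})} = p ^ card S * (1 - p) ^ card T"
proof -
  let ?I = "complete_edges n"
  have fin: "finite S" "finite T" using ST finite_subset by blast+
  define eS where "eS = (\<lambda>s. {z, s}) ` S"
  define eT where "eT = (\<lambda>t. {z, t}) ` T"
  have inj: "inj_on (\<lambda>s. {z, s}) A" for A by (auto simp: inj_on_def doubleton_eq_iff)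
  have sub: "eS \<subseteq> ?I" "eT \<subseteq> ?I"
    using ST z by (auto simp: eS_def eT_def complete_edges_def card_insert_if)
  have disj: "eS \<inter> eT = {}" using ST z by (auto simp: eS_def eT_def doubleton_eq_iff)
  define B where "B e = (if e \<in> eS then {True} else if e \<in> eT then {False} else UNIV)" for e
  have "(\<forall>e\<in>?I. f e \<in> B e) \<longleftrightarrow> (\<forall>e\<in>eS. f e) \<and> (\<forall>e\<in>eT. \<not> f e)" for f
  proof
    assume f: "\<forall>e\<in>?I. f e \<in> B e"
    have "f e" if "e \<in> eS" for e using f sub(1) that by (auto simp: B_def dest!: bspec[of _ _ e])
    moreover have "\<not> f e" if "e \<in> eT" for e
    proof -
      have "e \<notin> eS" "f e \<in> B e" using f sub(2) disj that by blast+
      then show ?thesis using that by (simp add: B_def)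
    qed
    ultimately show "(\<forall>e\<in>eS. f e) \<and> (\<forall>e\<in>eT. \<not> f e)" by blast
  qed (auto simp: B_def)
  then have "{f. (\<forall>s\<in>S. f {z, s}) \<and> (\<forall>t\<in>T. \<not> f {z, t})} = Pi ?I B"
    by (auto simp: Pi_def eS_def eT_def)
  then have "measure_pmf.prob (Pi_pmf ?I False (\<lambda>_. bernoulli_pmf p))
      {f. (\<forall>s\<in>S. f {z, s}) \<and> (\<forall>t\<in>T. \<not> f {z, t})} = (\<Prod>e\<in>?I. measure_pmf.prob (bernoulli_pmf p) (B e))"
    by (simp add: measure_Pi_pmf_Pi finite_complete_edges)
  also have "\<dots> = (\<Prod>e\<in>eS \<union> eT. measure_pmf.prob (bernoulli_pmf p) (B e))"
    by (rule prod.mono_neutral_right) (use sub finite_complete_edges in \<open>auto simp: B_def\<close>)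
  also have "\<dots> = (\<Prod>e\<in>eS. measure_pmf.prob (bernoulli_pmf p) (B e)) * (\<Prod>e\<in>eT. measure_pmf.prob (bernoulli_pmf p) (B e))"
    using disj fin by (intro prod.union_disjoint) (auto simp: eS_def eT_def)
  also have "(\<Prod>e\<in>eS. measure_pmf.prob (bernoulli_pmf p) (B e)) = (\<Prod>e\<in>eS. p)"
    using p by (intro prod.cong) (auto simp: B_def measure_pmf_single)
  also have "(\<Prod>e\<in>eT. measure_pmf.prob (bernoulli_pmf p) (B e)) = (\<Prod>e\<in>eT. 1 - p)"
    using p disj by (intro prod.cong) (auto simp: B_def measure_pmf_single)
  also have "(\<Prod>e\<in>eS. p) * (\<Prod>e\<in>eT. 1 - p) = p ^ card S * (1 - p) ^ card T"
    by (simp add: eS_def eT_def card_image inj)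
  finally show ?thesis .
qed

text \<open>The candidates \<open>z\<close> lie outside \<open>S \<union> T\<close>, so different
  ones use disjoint sets \<open>K z\<close> of edges and their failures are independent.\<close>

lemma prob_no_star_pattern:
  assumes p: "0 \<le> p" "p \<le> 1" and ST: "S \<subseteq> {1..n}" "T \<subseteq> {1..n}" "S \<inter> T = {}"
  shows "measure_pmf.prob (random_graph n p) {\<Gamma>. \<forall>z\<in>{1..n} - S - T. \<not> star_pattern z S T \<Gamma>}
    = (1 - p ^ card S * (1 - p) ^ card T) ^ card ({1..n} - S - T)"
\<comment> \<open>The product rule for independent variables asks for a nonempty index set. Without
  candidates both sides are one.\<close>
proof (cases "{1..n} - S - T = {}")
  case True
  then show ?thesis by (simp only: True) simp
next
  case False
  let ?I = "complete_edges n" and ?Z = "{1..n} - S - T"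
  let ?P = "Pi_pmf ?I False (\<lambda>_. bernoulli_pmf p)"
  define K where "K z = (\<lambda>u. {z, u}) ` (S \<union> T)" for z
  have K: "K z \<subseteq> ?I" if "z \<in> ?Z" for z
    using ST that by (auto simp: K_def complete_edges_def card_insert_if)
  have finK: "finite (K z)" for z using ST(1,2)[THEN finite_subset] by (simp add: K_def)
  have disj: "disjoint_family_on K ?Z"
    by (auto simp: disjoint_family_on_def K_def doubleton_eq_iff)
  have ind: "prob_space.indep_vars (measure_pmf ?P) (\<lambda>z. PiM (K z) (\<lambda>_. count_space UNIV)) (\<lambda>z f. restrict (\<lambda>e. f e) (K z)) ?Z"
    by (rule prob_space.indep_vars_restrict[OF measure_pmf.prob_space_axioms indep_vars_Pi_pmf[OF finite_complete_edges] K disj])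
  define B where "B z = PiE (K z) (\<lambda>e. if e \<in> (\<lambda>s. {z, s}) ` S then {True} else {False})" for z
  let ?A = "\<lambda>z. {f. (\<forall>s\<in>S. f {z, s}) \<and> (\<forall>t\<in>T. \<not> f {z, t})}"
  have B_iff: "restrict (\<lambda>e. f e) (K z) \<in> B z \<longleftrightarrow> f \<in> ?A z" if "z \<in> ?Z" for z f
  proof -
    have "{z, t} \<notin> (\<lambda>s. {z, s}) ` S" if "t \<in> T" for t
      using ST \<open>z \<in> ?Z\<close> that by (auto simp: doubleton_eq_iff)
    then show ?thesis by (auto simp: B_def K_def PiE_def Pi_def)
  qed
  define N where "N z = space (PiM (K z) (\<lambda>_. count_space (UNIV :: bool set))) - B z" for z
  have N: "N z \<in> sets (PiM (K z) (\<lambda>_. count_space UNIV))" for z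
    unfolding N_def B_def by (intro sets.Diff sets.top sets_PiM_I_finite finK) auto
  have N_eq: "(\<lambda>f. restrict (\<lambda>e. f e) (K z)) -` N z = - ?A z" if "z \<in> ?Z" for z
    using B_iff[OF that] by (auto simp: N_def space_PiM)
  have "measure_pmf.prob (random_graph n p) {\<Gamma>. \<forall>z\<in>?Z. \<not> star_pattern z S T \<Gamma>}
      = measure_pmf.prob ?P {f. \<forall>z\<in>?Z. f \<notin> ?A z}"
  proof -
    have e: "{z, u} \<in> ?I" if "z \<in> ?Z" "u \<in> S \<union> T" for z u
      using that K[OF that(1)] by (auto simp: K_def)
    have "star_pattern z S T {e \<in> ?I. f e} \<longleftrightarrow> f \<in> ?A z" if "z \<in> ?Z" for f z
      using e[OF that] by (auto simp: star_pattern_def)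
    then have "(\<lambda>f. {e \<in> ?I. f e}) -` {\<Gamma>. \<forall>z\<in>?Z. \<not> star_pattern z S T \<Gamma>} = {f. \<forall>z\<in>?Z. f \<notin> ?A z}"
      by auto
    then show ?thesis by (simp add: random_graph_def)
  qed
  also have "{f. \<forall>z\<in>?Z. f \<notin> ?A z} = (\<Inter>z\<in>?Z. (\<lambda>f. restrict (\<lambda>e. f e) (K z)) -` N z \<inter> space (measure_pmf ?P))"
    using N_eq by auto
  also have "measure_pmf.prob ?P \<dots> = (\<Prod>z\<in>?Z. measure_pmf.prob ?P ((\<lambda>f. restrict (\<lambda>e. f e) (K z)) -` N z \<inter> space (measure_pmf ?P)))"
    by (rule prob_space.indep_varsD_finite[OF measure_pmf.prob_space_axioms ind False]) (use N in auto)
  also have "\<dots> = (\<Prod>z\<in>?Z. 1 - p ^ card S * (1 - p) ^ card T)"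
  proof (rule prod.cong[OF refl])
    fix z assume z: "z \<in> ?Z"
    have "measure_pmf.prob ?P ((\<lambda>f. restrict (\<lambda>e. f e) (K z)) -` N z \<inter> space (measure_pmf ?P)) = measure_pmf.prob ?P (- ?A z)"
      by (simp add: N_eq[OF z])
    also have "\<dots> = 1 - measure_pmf.prob ?P (?A z)"
      using measure_pmf.prob_compl[of "?A z"] by (simp add: Compl_eq_Diff_UNIV)
    finally show "measure_pmf.prob ?P ((\<lambda>f. restrict (\<lambda>e. f e) (K z)) -` N z \<inter> space (measure_pmf ?P))
        = 1 - p ^ card S * (1 - p) ^ card T"
      using prob_star_pattern[OF p ST z] by simp
  qed
  finally show ?thesis by simp
qed

text \<open>An enumeration of \<open>S\<close> is padded to a list of length exactly
  \<open>k\<close> by the entry 0, which lies outside \<open>{1..n}\<close>; there are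
  \<open>n + 1\<close> choices for each entry.\<close>

lemma card_subsets_le:
  "finite {S. S \<subseteq> {1..n} \<and> card S \<le> k}" "card {S. S \<subseteq> {1..n::nat} \<and> card S \<le> k} \<le> (n + 1) ^ k"
proof -
  show "finite {S. S \<subseteq> {1..n} \<and> card S \<le> k}" by simp
  let ?L = "{xs. set xs \<subseteq> {0..n} \<and> length xs = k}"
  have "{S. S \<subseteq> {1..n} \<and> card S \<le> k} \<subseteq> (\<lambda>xs. set xs \<inter> {1..n}) ` ?L"
  proof
    fix S assume "S \<in> {S. S \<subseteq> {1..n} \<and> card S \<le> k}"
    then have S: "S \<subseteq> {1..n}" "card S \<le> k" "finite S" using finite_subset by auto
    let ?xs = "sorted_list_of_set S @ replicate (k - card S) 0"
    have "?xs \<in> ?L" using S by auto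
    moreover have "S = set ?xs \<inter> {1..n}" using S by auto
    ultimately show "S \<in> (\<lambda>xs. set xs \<inter> {1..n}) ` ?L" by blast
  qed
  then have "card {S. S \<subseteq> {1..n} \<and> card S \<le> k} \<le> card ?L"
    by (rule surj_card_le[OF finite_lists_length_eq[OF finite_atLeastAtMost]])
  then show "card {S. S \<subseteq> {1..n::nat} \<and> card S \<le> k} \<le> (n + 1) ^ k"
    by (simp add: card_lists_length_eq)
qed

definition extension_property :: "nat \<Rightarrow> nat set set \<Rightarrow> bool" where
  "extension_property n \<Gamma> \<longleftrightarrow> (\<forall>S T. S \<subseteq> {1..n} \<and> T \<subseteq> {1..n} \<and> S \<inter> T = {} \<and> card S \<le> 2 \<and> card T \<le> 3 \<longrightarrow>
    (\<exists>z\<in>{1..n} - S - T. star_pattern z S T \<Gamma>))"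

text \<open>A union bound: polynomially many pairs \<open>(S, T)\<close>, each of which fails with
  exponentially small probability.\<close>

lemma aas_extension_property:
  assumes p: "0 < p" "p < 1"
  shows "asymptotically_almost_surely (\<lambda>n. random_graph n p) extension_property"
proof -
  \<comment> \<open>A bound for the probability that one candidate fails, attained at the largest
    sizes \<open>card S = 2\<close> and \<open>card T = 3\<close>.\<close>
  define r where "r = 1 - p ^ 2 * (1 - p) ^ 3"
  have "0 < p ^ 2 * (1 - p) ^ 3" using p by simp
  moreover have "p ^ 2 * (1 - p) ^ 3 < 1"
    using p mult_strict_mono[of "p ^ 2" 1 "(1 - p) ^ 3" 1] by (simp add: power_less_one_iff)
  ultimately have r: "0 < r" "r < 1" by (auto simp: r_def)
  \<comment> \<open>At least \<open>n - 5\<close> candidates remain outside \<open>S\<close> and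
    \<open>T\<close>; dividing by \<open>r ^ 5\<close> avoids a truncated difference in the
    exponent. The power 5 of \<open>n + 1\<close> is 2 + 3, counting the choices of \<open>S\<close>
    and of \<open>T\<close>.\<close>
  have bound: "1 - measure_pmf.prob (random_graph n p) {\<Gamma>. extension_property n \<Gamma>} \<le> (n + 1) ^ 5 * (r ^ n / r ^ 5)" for n
  proof -
    let ?M = "measure_pmf (random_graph n p)"
    define \<S> where "\<S> k = {S. S \<subseteq> {1..n} \<and> card S \<le> k}" for k
    define Q where "Q = {ST \<in> \<S> 2 \<times> \<S> 3. fst ST \<inter> snd ST = {}}"
    define bad where "bad ST = {\<Gamma>. \<forall>z\<in>{1..n} - fst ST - snd ST. \<not> star_pattern z (fst ST) (snd ST) \<Gamma>}" for ST
    have finS: "finite (\<S> k)" for k unfolding \<S>_def by (rule card_subsets_le)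
    have finQ: "finite Q" by (rule finite_subset[of _ "\<S> 2 \<times> \<S> 3"]) (auto simp: Q_def finS)
    have "1 - measure_pmf.prob (random_graph n p) {\<Gamma>. extension_property n \<Gamma>} = measure ?M (- {\<Gamma>. extension_property n \<Gamma>})"
      using measure_pmf.prob_compl[of "{\<Gamma>. extension_property n \<Gamma>}" "random_graph n p"] by (simp add: Compl_eq_Diff_UNIV)
    also have "- {\<Gamma>. extension_property n \<Gamma>} = (\<Union>ST\<in>Q. bad ST)"
    proof (intro Set.set_eqI iffI)
      fix \<Gamma> assume "\<Gamma> \<in> - {\<Gamma>. extension_property n \<Gamma>}"
      then obtain S T where "(S, T) \<in> Q" "\<Gamma> \<in> bad (S, T)"
        unfolding extension_property_def Q_def bad_def \<S>_def by auto
      then show "\<Gamma> \<in> (\<Union>ST\<in>Q. bad ST)" by blast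
    next
      fix \<Gamma> assume "\<Gamma> \<in> (\<Union>ST\<in>Q. bad ST)"
      then obtain S T where "(S, T) \<in> Q" "\<Gamma> \<in> bad (S, T)" by auto
      then have "S \<subseteq> {1..n} \<and> T \<subseteq> {1..n} \<and> S \<inter> T = {} \<and> card S \<le> 2 \<and> card T \<le> 3"
        "\<not> (\<exists>z\<in>{1..n} - S - T. star_pattern z S T \<Gamma>)"
        by (simp_all add: Q_def bad_def \<S>_def)
      then show "\<Gamma> \<in> - {\<Gamma>. extension_property n \<Gamma>}"
        unfolding extension_property_def by blast
    qed
    also have "measure ?M \<dots> \<le> (\<Sum>ST\<in>Q. measure ?M (bad ST))"
      by (rule measure_pmf.finite_measure_subadditive_finite) (auto simp: finQ)
    also have "\<dots> \<le> (\<Sum>ST\<in>Q. r ^ n / r ^ 5)"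
    proof (rule sum_mono)
      fix ST assume ST: "ST \<in> Q"
      obtain S T where e: "ST = (S, T)" by force
      have h: "S \<subseteq> {1..n}" "T \<subseteq> {1..n}" "S \<inter> T = {}" "card S \<le> 2" "card T \<le> 3"
        using ST by (auto simp: Q_def \<S>_def e)
      define m where "m = card ({1..n} - S - T)"
      have fin: "finite S" "finite T" using h finite_subset by blast+
      have "m = card ({1..n} - (S \<union> T))" by (simp add: m_def Diff_eq Int_assoc)
      also have "\<dots> = n - card (S \<union> T)" using h fin by (subst card_Diff_subset) auto
      finally have "m = n - card (S \<union> T)" .
      then have m: "n \<le> m + 5" using h card_Un_le[of S T] by linarith
      have "p ^ 2 \<le> p ^ card S" "(1 - p) ^ 3 \<le> (1 - p) ^ card T"
        using p h by (auto intro!: power_decreasing)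
      then have "p ^ 2 * (1 - p) ^ 3 \<le> p ^ card S * (1 - p) ^ card T"
        using p by (intro mult_mono) auto
      then have le: "1 - p ^ card S * (1 - p) ^ card T \<le> r" by (simp add: r_def)
      have "p ^ card S * (1 - p) ^ card T \<le> 1 * 1"
        using p by (intro mult_mono power_le_one) auto
      then have ge: "0 \<le> 1 - p ^ card S * (1 - p) ^ card T" by simp
      have "measure ?M (bad ST) = (1 - p ^ card S * (1 - p) ^ card T) ^ m"
        unfolding bad_def e m_def fst_conv snd_conv by (rule prob_no_star_pattern) (use p h in auto)
      also have "\<dots> \<le> r ^ m" by (rule power_mono[OF le ge])
      also have "r ^ m \<le> r ^ n / r ^ 5"
        using r m power_decreasing[of n "m + 5" r] by (simp add: power_add field_simps)
      finally show "measure ?M (bad ST) \<le> r ^ n / r ^ 5" .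
    qed
    also have "\<dots> = real (card Q) * (r ^ n / r ^ 5)" by simp
    also have "\<dots> \<le> real ((n + 1) ^ 5) * (r ^ n / r ^ 5)"
    proof (rule mult_right_mono)
      have "card Q \<le> card (\<S> 2 \<times> \<S> 3)" by (rule card_mono) (auto simp: Q_def finS)
      also have "\<dots> \<le> (n + 1) ^ 2 * (n + 1) ^ 3"
        unfolding card_cartesian_product \<S>_def by (intro mult_mono card_subsets_le(2)) auto
      also have "\<dots> = (n + 1) ^ 5" by (simp flip: power_add)
      finally show "real (card Q) \<le> real ((n + 1) ^ 5)" by (rule of_nat_mono)
    qed (use r in auto)
    finally show ?thesis by (simp add: add.commute)
  qed
  have lim: "(\<lambda>n. (real n + 1) ^ 5 * (r ^ n / r ^ 5)) \<longlonglongrightarrow> 0" using r by real_asymp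
  have "(\<lambda>n. 1 - measure_pmf.prob (random_graph n p) {\<Gamma>. extension_property n \<Gamma>}) \<longlonglongrightarrow> 0"
    by (rule tendsto_sandwich[OF _ _ tendsto_const lim])
       (use bound in \<open>auto intro!: always_eventually simp: add.commute\<close>)
  then have "(\<lambda>n. 1 - (1 - measure_pmf.prob (random_graph n p) {\<Gamma>. extension_property n \<Gamma>})) \<longlonglongrightarrow> 1 - 0"
    by (intro tendsto_diff tendsto_const)
  then show ?thesis by (simp add: asymptotically_almost_surely_def)
qed

text \<open>The implication is required on the support only, because that is where a sampled edge
  set consists of two-element subsets of \<open>{1..n}\<close>.\<close>

lemma aas_mono:
  assumes "asymptotically_almost_surely M P" "\<And>n x. x \<in> set_pmf (M n) \<Longrightarrow> P n x \<Longrightarrow> Q n x"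
  shows "asymptotically_almost_surely M Q"
  unfolding asymptotically_almost_surely_def
proof (rule tendsto_sandwich[OF _ _ _ tendsto_const])
  show "(\<lambda>n. measure_pmf.prob (M n) {x. P n x}) \<longlonglongrightarrow> 1"
    using assms(1) by (simp add: asymptotically_almost_surely_def)
  show "\<forall>\<^sub>F n in sequentially. measure_pmf.prob (M n) {x. P n x} \<le> measure_pmf.prob (M n) {x. Q n x}"
  proof (intro always_eventually allI)
    fix n
    have "AE x in measure_pmf (M n). x \<in> {x. P n x} \<longrightarrow> x \<in> {x. Q n x}"
      by (rule AE_pmfI) (simp add: assms(2))
    then show "measure_pmf.prob (M n) {x. P n x} \<le> measure_pmf.prob (M n) {x. Q n x}"
      by (rule measure_pmf.finite_measure_mono_AE) simp
  qed
qed auto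

theorem theorem8:
  fixes G :: "nat \<Rightarrow> 'a monoid" and p :: real
  assumes "\<And>i. i \<ge> 1 \<Longrightarrow> group (G i)"
    and "\<And>i. i \<ge> 1 \<Longrightarrow> cyclic_group (G i)"
    and "\<And>i. i \<ge> 1 \<Longrightarrow> \<not> trivial_group (G i)"
    and "1 - 1 / sqrt 2 < p" and "p < 1"
  shows "asymptotically_almost_surely (\<lambda>n. random_graph n p)
    (\<lambda>n \<Gamma>. finite (carrier (Out (graph_product {1..n} \<Gamma> G))))"
proof (rule aas_mono[OF aas_extension_property])
  have "1 / sqrt 2 \<le> 1" using real_sqrt_ge_one[of 2] by (simp add: divide_le_eq_1)
  then show "0 < p" using assms(4) by linarith
  show "p < 1" by fact
  fix n \<Gamma> assume \<Gamma>: "\<Gamma> \<in> set_pmf (random_graph n p)" and ext: "extension_property n \<Gamma>"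
  have sub: "\<Gamma> \<subseteq> complete_edges n" using \<Gamma> by (auto simp: random_graph_def)
  show "finite (carrier (Out (graph_product {1..n} \<Gamma> G)))"
  proof (rule finite_Out_graph_product)
    show "{v} \<notin> \<Gamma>" for v using sub by (auto simp: complete_edges_def)
    fix S T assume "S \<subseteq> {1..n}" "T \<subseteq> {1..n}" "S \<inter> T = {}" "card S \<le> 2" "card T \<le> 3"
    then show "\<exists>z\<in>{1..n} - S - T. (\<forall>s\<in>S. {z, s} \<in> \<Gamma>) \<and> (\<forall>t\<in>T. {z, t} \<notin> \<Gamma>)"
      using ext unfolding extension_property_def star_pattern_def by blast
  qed (use assms in simp_all)
qed

end
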